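(* Let $f=(f_1,\dots,f_n)$ be an admissible $n$-tuple of functions $\mathbb{R}\to\mathbb{R}$, and let $\theta:\mathbb{R}^n\to\operatorname{Proj}(L^2(\mathbb{R}))$ be the map $\theta(\lambda)=[e^{i\langle f,\lambda\rangle}H^2(\mathbb{R})]$. Then the closure of the range $\mathcal{M}(\mathcal{S}_f)=\theta(\mathbb{R}^n)$ of $\theta$ in the strong operator topology is $$\overline{\mathcal{M}(\mathcal{S}_f)}=\theta(\mathbb{R}^n)\cup\big\{[L^2\big((\psi')^{-1}((-\infty,0))\big)]:\psi\in\mathcal{S}_f\setminus\{0\}\big\}.$$
   Context: $H^2(\mathbb{R})\subseteq L^2(\mathbb{R})$ is the Hardy space of the upper half plane. $\operatorname{Proj}(\mathcal{H})$ is the set of self-adjoint projections on a Hilbert space $\mathcal{H}$, with the strong operator topology. For a closed subspace $K$, $[K]$ is the orthogonal projection onto $K$. For measurable $E\subseteq\mathbb{R}$, $L^2(E)$ is the subspace of functions in $L^2(\mathbb{R})$ supported on $E$. A function $\psi:\mathbb{R}\to\mathbb{R}$ is admissible if the following subsets of $\mathbb{R}$ are discrete (have no accumulation points): (1) the set $\Gamma(\psi)$ of points at which $\psi$ fails to be twice continuously differentiable; (2) $(\psi')^{-1}(0)$; (3) the set $\Lambda(\psi)$ of points at which $\operatorname{sgn}(\psi'')$ is not locally constant. For an $n$-tuple $f=(f_1,\dots,f_n)$ of functions $f_j:\mathbb{R}\to\mathbb{R}$ and $\lambda\in\mathbb{R}^n$, write $\langle f,\lambda\rangle=\lambda_1f_1+\dots+\lambda_nf_n$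 and $\mathcal{S}_f=\{\langle f,\lambda\rangle:\lambda\in\mathbb{R}^n\}$. The $n$-tuple $f$ is admissible if (1) $\{f_1,\dots,f_n\}$ is linearly independent over $\mathbb{R}$; (2) every nonzero function in $\mathcal{S}_f$ is admissible; and (3) $\sup_{g\in\mathcal{S}_f\setminus\{0\}}|K\cap\Lambda(g)|<\infty$ for each compact set $K\subseteq\mathbb{R}$. *)

theory Defs
  imports "HOL-Analysis.Analysis"
begin

section \<open>The Hilbert space of square-integrable functions on the real line\<close>

definition square_integrable :: "(real \<Rightarrow> complex) \<Rightarrow> bool" where
  "square_integrable f \<longleftrightarrow>
     f \<in> borel_measurable lborel \<and> integrable lborel (\<lambda>x. (cmod (f x))\<^sup>2)"

lemma square_integrable_measurable:
  "square_integrable f \<Longrightarrow> f \<in> borel_measurable lborel"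
  by (simp add: square_integrable_def)

lemma square_integrable_zero: "square_integrable (\<lambda>x. 0)"
  by (simp add: square_integrable_def)

lemma square_integrable_scale:
  assumes "square_integrable f"
  shows "square_integrable (\<lambda>x. c * f x)"
  using assms by (auto simp: square_integrable_def norm_mult power_mult_distrib)

lemma measurable_mult_cnj:
  assumes f: "square_integrable f" and g: "square_integrable g"
  shows "(\<lambda>x. f x * cnj (g x)) \<in> borel_measurable lborel"
proof -
  have "cnj \<in> borel_measurable borel"
    by (intro borel_measurable_continuous_onI continuous_intros)
  then have "(\<lambda>x. cnj (g x)) \<in> borel_measurable lborel"
    using measurable_compose[OF square_integrable_measurable[OF g]] by simp
  then show ?thesis
    using square_integrable_measurable[OF f] by (rule borel_measurable_times[rotated])
qed

lemma square_integrable_mult_integrable: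
  assumes f: "square_integrable f" and g: "square_integrable g"
  shows "integrable lborel (\<lambda>x. f x * cnj (g x))"
proof (rule Bochner_Integration.integrable_bound)
  show "integrable lborel (\<lambda>x. (cmod (f x))\<^sup>2 + (cmod (g x))\<^sup>2)"
    using f g by (simp add: square_integrable_def)
  show "(\<lambda>x. f x * cnj (g x)) \<in> borel_measurable lborel"
    by (rule measurable_mult_cnj[OF f g])
  have "a * b \<le> a\<^sup>2 + b\<^sup>2" if "0 \<le> a" "0 \<le> b" for a b :: real
    using that sum_squares_bound[of a b] mult_nonneg_nonneg[of a b] by linarith
  then show "AE x in lborel. norm (f x * cnj (g x)) \<le> norm ((cmod (f x))\<^sup>2 + (cmod (g x))\<^sup>2)"
    by (auto simp: norm_mult)
qed

lemma square_integrable_add: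
  assumes f: "square_integrable f" and g: "square_integrable g"
  shows "square_integrable (\<lambda>x. f x + g x)"
proof -
  have [measurable]: "f \<in> borel_measurable lborel" "g \<in> borel_measurable lborel"
    using f g by (simp_all add: square_integrable_def)
  have "integrable lborel (\<lambda>x. (cmod (f x + g x))\<^sup>2)"
  proof (rule Bochner_Integration.integrable_bound)
    show "integrable lborel (\<lambda>x. 2 * (cmod (f x))\<^sup>2 + 2 * (cmod (g x))\<^sup>2)"
      using f g by (simp add: square_integrable_def)
    have "(cmod (a + b))\<^sup>2 \<le> 2 * (cmod a)\<^sup>2 + 2 * (cmod b)\<^sup>2" for a b :: complex
    proof -
      have "(cmod (a + b))\<^sup>2 \<le> (cmod a + cmod b)\<^sup>2"
        by (intro power_mono norm_triangle_ineq) simp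
      also have "\<dots> \<le> 2 * (cmod a)\<^sup>2 + 2 * (cmod b)\<^sup>2"
        using sum_squares_bound[of "cmod a" "cmod b"] by (simp add: power2_sum)
      finally show ?thesis .
    qed
    then show "AE x in lborel. norm ((cmod (f x + g x))\<^sup>2)
        \<le> norm (2 * (cmod (f x))\<^sup>2 + 2 * (cmod (g x))\<^sup>2)"
      by auto
  qed measurable
  then show ?thesis
    by (simp add: square_integrable_def)
qed

quotient_type L2 = "real \<Rightarrow> complex" /
  partial: "\<lambda>f g. square_integrable f \<and> square_integrable g \<and> (AE x in lborel. f x = g x)"
  morphisms rep_L2 abs_L2
proof (rule part_equivpI)
  show "\<exists>f. square_integrable f \<and> square_integrable f \<and> (AE x in lborel. f x = f x)"
    using square_integrable_zero by auto
  show "symp (\<lambda>f g. square_integrable f \<and> square_integrable g \<and> (AE x in lborel. f x = g x))"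
    by (auto simp: symp_def)
  show "transp (\<lambda>f g. square_integrable f \<and> square_integrable g \<and> (AE x in lborel. f x = g x))"
    unfolding transp_def by (auto elim: eventually_elim2)
qed

text \<open>\<open>rep_L2\<close> chooses some square-integrable representative of a class; below it is only
  used in ways that do not depend on the choice.\<close>

lemma square_integrable_rep_L2: "square_integrable (rep_L2 f)"
  using Quotient3_rep_reflp[OF Quotient3_L2] by blast

lemma rep_abs_L2:
  assumes "square_integrable f"
  shows "AE x in lborel. rep_L2 (abs_L2 f) x = f x"
  using rep_abs_rsp_left[OF Quotient3_L2, of f f] assms by blast

lemma abs_rep_L2: "abs_L2 (rep_L2 f) = f"
  using Quotient3_abs_rep[OF Quotient3_L2] .

lemma L2_eq_iff: "f = g \<longleftrightarrow> (AE x in lborel. rep_L2 f x = rep_L2 g x)"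
  using Quotient3_rel_rep[OF Quotient3_L2, of f g] square_integrable_rep_L2 by blast

lift_definition cscale_L2 :: "complex \<Rightarrow> L2 \<Rightarrow> L2" is "\<lambda>c f x. c * f x"
  by (auto simp: square_integrable_scale elim!: eventually_mono)

lift_definition cinner_L2 :: "L2 \<Rightarrow> L2 \<Rightarrow> complex" is "\<lambda>f g. \<integral>x. f x * cnj (g x) \<partial>lborel"
proof -
  fix f f' g g' :: "real \<Rightarrow> complex"
  assume f: "square_integrable f \<and> square_integrable f' \<and> (AE x in lborel. f x = f' x)"
    and g: "square_integrable g \<and> square_integrable g' \<and> (AE x in lborel. g x = g' x)"
  have "AE x in lborel. f x = f' x" "AE x in lborel. g x = g' x"
    using f g by auto
  then have "AE x in lborel. f x * cnj (g x) = f' x * cnj (g' x)"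
    by eventually_elim simp
  then show "(\<integral>x. f x * cnj (g x) \<partial>lborel) = (\<integral>x. f' x * cnj (g' x) \<partial>lborel)"
    using f g by (intro integral_cong_AE measurable_mult_cnj) auto
qed

text \<open>The distribution has no class of complex inner product spaces. \<open>L2\<close> is therefore made an
  instance of \<open>real_inner\<close> with the real part of \<^term>\<open>cinner_L2\<close> as inner product, which induces
  the usual norm; complex linearity and complex self-adjointness are required explicitly where
  they matter.\<close>

instantiation L2 :: real_vector
begin

lift_definition zero_L2 :: L2 is "\<lambda>x. 0"
  by (simp add: square_integrable_zero)

lift_definition plus_L2 :: "L2 \<Rightarrow> L2 \<Rightarrow> L2" is "\<lambda>f g x. f x + g x"
proof -
  fix f f' g g' :: "real \<Rightarrow> complex"
  assume f: "square_integrable f \<and> square_integrable f' \<and> (AE x in lborel. f x = f' x)"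
    and g: "square_integrable g \<and> square_integrable g' \<and> (AE x in lborel. g x = g' x)"
  have "AE x in lborel. f x = f' x" "AE x in lborel. g x = g' x"
    using f g by auto
  then have "AE x in lborel. f x + g x = f' x + g' x"
    by eventually_elim simp
  with f g show "square_integrable (\<lambda>x. f x + g x) \<and> square_integrable (\<lambda>x. f' x + g' x) \<and>
      (AE x in lborel. f x + g x = f' x + g' x)"
    by (simp add: square_integrable_add)
qed

definition scaleR_L2 :: "real \<Rightarrow> L2 \<Rightarrow> L2" where
  "scaleR_L2 r = cscale_L2 (complex_of_real r)"

definition uminus_L2 :: "L2 \<Rightarrow> L2" where
  "uminus_L2 = cscale_L2 (-1)"

definition minus_L2 :: "L2 \<Rightarrow> L2 \<Rightarrow> L2" where
  "minus_L2 f g = f + (- g)"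

instance
proof
  fix f g h :: L2 and r s :: real
  show "f + g + h = f + (g + h)"
    by transfer (auto simp: square_integrable_add add.assoc)
  show "f + g = g + f"
    by transfer (auto simp: square_integrable_add add.commute)
  show "0 + f = f"
    by transfer auto
  show "- f + f = 0"
    unfolding uminus_L2_def
    by transfer (use square_integrable_add square_integrable_scale[of _ "-1"] in
        \<open>auto simp: square_integrable_zero\<close>)
  show "f - g = f + - g"
    by (simp add: minus_L2_def)
  show "r *\<^sub>R (f + g) = r *\<^sub>R f + r *\<^sub>R g"
    unfolding scaleR_L2_def
    by transfer (auto simp: square_integrable_add square_integrable_scale distrib_left)
  show "(r + s) *\<^sub>R f = r *\<^sub>R f + s *\<^sub>R f"
    unfolding scaleR_L2_def
    by transfer (auto simp: square_integrable_add square_integrable_scale distrib_right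
        simp flip: distrib_right)
  show "r *\<^sub>R s *\<^sub>R f = (r * s) *\<^sub>R f"
    unfolding scaleR_L2_def
    by transfer (auto simp: square_integrable_scale mult.assoc simp flip: mult.assoc)
  show "1 *\<^sub>R f = f"
    unfolding scaleR_L2_def by transfer auto
qed

end

instantiation L2 :: real_inner
begin

definition inner_L2 :: "L2 \<Rightarrow> L2 \<Rightarrow> real" where
  "inner_L2 f g = Re (cinner_L2 f g)"

definition norm_L2 :: "L2 \<Rightarrow> real" where
  "norm_L2 f = sqrt (Re (cinner_L2 f f))"

definition dist_L2 :: "L2 \<Rightarrow> L2 \<Rightarrow> real" where
  "dist_L2 f g = norm (f - g)"

definition sgn_L2 :: "L2 \<Rightarrow> L2" where
  "sgn_L2 f = f /\<^sub>R norm f"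

definition uniformity_L2 :: "(L2 \<times> L2) filter" where
  "uniformity_L2 = (INF e\<in>{0<..}. principal {(f, g). dist f g < e})"

definition open_L2 :: "L2 set \<Rightarrow> bool" where
  "open_L2 U \<longleftrightarrow> (\<forall>x\<in>U. eventually (\<lambda>(x', y). x' = x \<longrightarrow> y \<in> U) uniformity)"

instance
proof
  fix f g h :: L2 and r :: real and U :: "L2 set"
  show "dist f g = norm (f - g)" by (rule dist_L2_def)
  show "sgn f = f /\<^sub>R norm f" by (rule sgn_L2_def)
  show "(uniformity :: (L2 \<times> L2) filter) = (INF e\<in>{0<..}. principal {(f, g). dist f g < e})"
    by (rule uniformity_L2_def)
  show "open U \<longleftrightarrow> (\<forall>x\<in>U. eventually (\<lambda>(x', y). x' = x \<longrightarrow> y \<in> U) uniformity)"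
    by (rule open_L2_def)
  have "cinner_L2 f g = cnj (cinner_L2 g f)"
    by transfer (simp add: mult.commute flip: Bochner_Integration.integral_cnj)
  then show "inner f g = inner g f"
    by (simp add: inner_L2_def)
  have "cinner_L2 (f + g) h = cinner_L2 f h + cinner_L2 g h"
    by transfer (simp add: distrib_right square_integrable_mult_integrable)
  then show "inner (f + g) h = inner f h + inner g h"
    by (simp add: inner_L2_def)
  have "cinner_L2 (cscale_L2 c f) g = c * cinner_L2 f g" for c
    by transfer (simp add: mult.assoc)
  then show "inner (r *\<^sub>R f) g = r * inner f g"
    by (simp add: inner_L2_def scaleR_L2_def)
  have eq: "inner f f = (\<integral>x. (cmod (rep_L2 f x))\<^sup>2 \<partial>lborel)"
  proof -
    have "cinner_L2 f f = (\<integral>x. complex_of_real ((cmod (rep_L2 f x))\<^sup>2) \<partial>lborel)"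
      unfolding cinner_L2.rep_eq complex_norm_square ..
    also have "\<dots> = complex_of_real (\<integral>x. (cmod (rep_L2 f x))\<^sup>2 \<partial>lborel)"
      by (rule integral_complex_of_real)
    finally show ?thesis
      by (simp add: inner_L2_def)
  qed
  show "0 \<le> inner f f"
    unfolding eq by simp
  have int: "integrable lborel (\<lambda>x. (cmod (rep_L2 f x))\<^sup>2)"
    using square_integrable_rep_L2 by (simp add: square_integrable_def)
  have "AE x in lborel. rep_L2 0 x = 0"
    using rep_abs_L2[OF square_integrable_zero] by (simp add: zero_L2_def)
  then have "f = 0 \<longleftrightarrow> (AE x in lborel. rep_L2 f x = 0)"
    unfolding L2_eq_iff by (auto elim: eventually_elim2)
  then show "inner f f = 0 \<longleftrightarrow> f = 0"
    unfolding eq using integral_nonneg_eq_0_iff_AE[OF int] by simp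
  show "norm f = sqrt (inner f f)"
    by (simp add: norm_L2_def inner_L2_def)
qed

end

section \<open>Projections and subspaces\<close>

definition projections :: "(L2 \<Rightarrow>\<^sub>L L2) set" where
  "projections = {P :: L2 \<Rightarrow>\<^sub>L L2. (\<forall>c f. P (cscale_L2 c f) = cscale_L2 c (P f)) \<and>
     (\<forall>f. P (P f) = P f) \<and> (\<forall>f g. cinner_L2 (P f) g = cinner_L2 f (P g))}"

text \<open>Meaningful for closed complex subspaces \<open>K\<close> only.\<close>

definition projection_onto :: "L2 set \<Rightarrow> L2 \<Rightarrow>\<^sub>L L2" where
  "projection_onto K = (THE P. P \<in> projections \<and> range (blinfun_apply P) = K)"

definition L2_on :: "real set \<Rightarrow> L2 set" where
  "L2_on E = {f. AE x in lborel. x \<notin> E \<longrightarrow> rep_L2 f x = 0}"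

text \<open>The Hardy space of the upper half plane, as the space of boundary functions of holomorphic
  functions \<open>F\<close> whose restrictions to horizontal lines are bounded in \<open>L\<^sup>2\<close>.  The boundary
  function is the limit in the mean of these restrictions, which coincides with the
  non-tangential limit.\<close>

definition H2 :: "L2 set" where
  "H2 = {f. \<exists>F. F holomorphic_on {z. 0 < Im z} \<and>
     (SUP y\<in>{0<..}. \<integral>\<^sup>+x. ennreal ((cmod (F (Complex x y)))\<^sup>2) \<partial>lborel) < \<infinity> \<and>
     ((\<lambda>y. \<integral>\<^sup>+x. ennreal ((cmod (F (Complex x y) - rep_L2 f x))\<^sup>2) \<partial>lborel) \<longlongrightarrow> 0)
       (at_right 0)}"

text \<open>The subspace \<open>e\<^sup>i\<^sup>\<phi> H2\<close>.\<close>

definition modulated_H2 :: "(real \<Rightarrow> real) \<Rightarrow> L2 set" where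
  "modulated_H2 \<phi> =
     {h. \<exists>g\<in>H2. AE x in lborel. rep_L2 h x = exp (\<i> * complex_of_real (\<phi> x)) * rep_L2 g x}"

section \<open>Admissible functions and tuples\<close>

definition no_accumulation_points :: "real set \<Rightarrow> bool" where
  "no_accumulation_points A \<longleftrightarrow> (\<forall>x. \<not> x islimpt A)"

definition has_second_derivative :: "(real \<Rightarrow> real) \<Rightarrow> real \<Rightarrow> real \<Rightarrow> bool" where
  "has_second_derivative \<psi> D x \<longleftrightarrow>
     (\<forall>\<^sub>F y in nhds x. \<psi> differentiable (at y)) \<and> (deriv \<psi> has_real_derivative D) (at x)"

definition C2_at :: "(real \<Rightarrow> real) \<Rightarrow> real \<Rightarrow> bool" where
  "C2_at \<psi> x \<longleftrightarrow> (\<forall>\<^sub>F y in nhds x.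
     \<psi> differentiable (at y) \<and> deriv \<psi> differentiable (at y) \<and> isCont (deriv (deriv \<psi>)) y)"

definition Gamma_set :: "(real \<Rightarrow> real) \<Rightarrow> real set" where
  "Gamma_set \<psi> = {x. \<not> C2_at \<psi> x}"

text \<open>Local constancy of \<open>sgn \<psi>''\<close> at \<open>x\<close> includes the existence of \<open>\<psi>''\<close> near \<open>x\<close>.\<close>

definition Lambda_set :: "(real \<Rightarrow> real) \<Rightarrow> real set" where
  "Lambda_set \<psi> =
     {x. \<not> (\<exists>s. \<forall>\<^sub>F y in nhds x. \<exists>D. has_second_derivative \<psi> D y \<and> sgn D = s)}"

text \<open>The preimage of a set under \<open>\<psi>'\<close>, whose domain is the set of points where \<open>\<psi>\<close> is
  differentiable.\<close>

definition deriv_vimage :: "(real \<Rightarrow> real) \<Rightarrow> real set \<Rightarrow> real set" where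
  "deriv_vimage \<psi> B = {x. \<exists>D\<in>B. (\<psi> has_real_derivative D) (at x)}"

definition admissible :: "(real \<Rightarrow> real) \<Rightarrow> bool" where
  "admissible \<psi> \<longleftrightarrow> no_accumulation_points (Gamma_set \<psi>) \<and>
     no_accumulation_points (deriv_vimage \<psi> {0}) \<and> no_accumulation_points (Lambda_set \<psi>)"

definition lin_comb :: "('n::finite \<Rightarrow> real \<Rightarrow> real) \<Rightarrow> real ^ 'n \<Rightarrow> real \<Rightarrow> real" where
  "lin_comb f c = (\<lambda>x. \<Sum>j\<in>UNIV. c $ j * f j x)"

definition span_funs :: "('n::finite \<Rightarrow> real \<Rightarrow> real) \<Rightarrow> (real \<Rightarrow> real) set" where
  "span_funs f = range (lin_comb f)"

definition admissible_tuple :: "('n::finite \<Rightarrow> real \<Rightarrow> real) \<Rightarrow> bool" where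
  "admissible_tuple f \<longleftrightarrow>
     (\<forall>c. lin_comb f c = (\<lambda>x. 0) \<longrightarrow> c = 0) \<and>
     (\<forall>g \<in> span_funs f - {\<lambda>x. 0}. admissible g) \<and>
     (\<forall>K. compact K \<longrightarrow>
        (\<exists>N. \<forall>g \<in> span_funs f - {\<lambda>x. 0}. finite (K \<inter> Lambda_set g) \<and> card (K \<inter> Lambda_set g) \<le> N))"

definition theta :: "('n::finite \<Rightarrow> real \<Rightarrow> real) \<Rightarrow> real ^ 'n \<Rightarrow> L2 \<Rightarrow>\<^sub>L L2" where
  "theta f c = projection_onto (modulated_H2 (lin_comb f c))"

end

theory Submission
  imports Defs "HOL-Complex_Analysis.Complex_Analysis"
begin

text \<open>Write \<open>\<theta>(\<lambda>) = M P M\<^sup>*\<close> with \<open>P\<close> the projection onto \<open>H\<^sup>2\<close> and \<open>M\<close> multiplication by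
  \<open>e\<^sup>i\<^sup>\<phi>\<close>, \<open>\<phi> = \<langle>f, \<lambda>\<rangle>\<close>.  On bounded sets of \<open>\<lambda>\<close> the map \<open>\<theta>\<close> is strongly continuous,
  so only \<open>\<lambda> = t d\<close> with \<open>t \<rightarrow> \<infinity>\<close> and unit vectors \<open>d \<rightarrow> c\<close> matters.  Let \<open>[a, b]\<close> be an interval on
  which all \<open>f\<^sub>j\<close> are \<open>C\<^sup>2\<close> and \<open>\<psi> = \<langle>f, c\<rangle>\<close> satisfies \<open>\<psi>' > 0\<close>.  For \<open>h \<in> H\<^sup>2\<close> the integral of
  \<open>h e\<^sup>i\<^sup>\<phi>\<close> over \<open>[a, b]\<close> is estimated by Stokes' theorem in the upper half plane, where
  \<open>exp (i \<phi> - y \<phi>')\<close> extends \<open>e\<^sup>i\<^sup>\<phi>\<close> almost analytically and decays; the result is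
  \<open>O(\<parallel>h\<parallel> / sqrt t)\<close> uniformly in \<open>d\<close>, so \<open>\<theta>(\<lambda>) 1\<^bsub>[a, b]\<^esub> \<rightarrow> 0\<close>.  If \<open>\<psi>' < 0\<close>, the same estimate for
  the complex conjugate space, which is the orthogonal complement of \<open>H\<^sup>2\<close>, gives
  \<open>\<theta>(\<lambda>) 1\<^bsub>[a, b]\<^esub> \<rightarrow> 1\<^bsub>[a, b]\<^esub>\<close>.  Such indicator functions span a dense subspace, hence \<open>\<theta>(\<lambda>)\<close> tends
  strongly to \<open>[L\<^sup>2(\<psi>' < 0)]\<close>.  Compactness of the unit sphere shows that there are no other limit
  points.

  The structure of \<open>H\<^sup>2\<close> is obtained without the Fourier transform, from the Cauchy kernels
  \<open>\<kappa>\<^sub>w\<close>.\<close>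

section \<open>The Hilbert space and its closed subspaces\<close>

text \<open>The rate 1/sqrt t balances two bounds at height y. The reproducing kernel gives |h(x + i
  y)| \<le> norm h / sqrt y, and the extended phase contributes a factor of order 1/(1 + t y). The
  integral of 1/(sqrt y (1 + t y)) over y > 0 is pi/sqrt t. A general h has boundary values only as
  limits in the mean, so Stokes' theorem cannot be applied to it down to y = 0. It is applied to
  finite sums of Cauchy kernels, which are holomorphic across the real line; density does the rest.
  Uniformity in the direction is obtained by letting the estimate see the phase only through a lower
  bound m of \<phi>' and a bound for |\<phi>''|/m. The ratio does not change when \<phi> is
  multiplied by t, while m grows like t. From its definition, neither the closedness of H2 nor its
  orthogonal complement is visible. Both come from one completeness statement: the Cauchy kernels
  and their conjugates together span a dense subspace, because a kernel plus its conjugate is a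
  Poisson kernel.\<close>

lemma cinner_abs_L2:
  "square_integrable f \<Longrightarrow> square_integrable g \<Longrightarrow>
    cinner_L2 (abs_L2 f) (abs_L2 g) = (\<integral>x. f x * cnj (g x) \<partial>lborel)"
  by (rule cinner_L2.abs_eq) auto

lemma plus_abs_L2:
  "square_integrable f \<Longrightarrow> square_integrable g \<Longrightarrow>
    abs_L2 f + abs_L2 g = abs_L2 (\<lambda>x. f x + g x)"
  by (rule plus_L2.abs_eq) auto

lemma cscale_abs_L2: "square_integrable f \<Longrightarrow> cscale_L2 c (abs_L2 f) = abs_L2 (\<lambda>x. c * f x)"
  by (rule cscale_L2.abs_eq) auto

lemma abs_L2_eqI:
  "square_integrable f \<Longrightarrow> square_integrable g \<Longrightarrow> AE x in lborel. f x = g x \<Longrightarrow> abs_L2 f = abs_L2 g"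
  using Quotient3_rel[OF Quotient3_L2, of f g] by blast

lemma abs_L2_rep_eqI:
  "square_integrable f \<Longrightarrow> AE x in lborel. rep_L2 h x = f x \<Longrightarrow> h = abs_L2 f"
  using abs_L2_eqI[OF square_integrable_rep_L2, of f h] by (simp add: abs_rep_L2)

lemma cinner_commute: "cinner_L2 f g = cnj (cinner_L2 g f)"
  by transfer (simp add: mult.commute flip: Bochner_Integration.integral_cnj)

lemma cinner_add_left: "cinner_L2 (f + g) h = cinner_L2 f h + cinner_L2 g h"
  by transfer (simp add: distrib_right square_integrable_mult_integrable)

lemma cinner_scale_left: "cinner_L2 (cscale_L2 c f) g = c * cinner_L2 f g"
  by transfer (simp add: mult.assoc)

lemma cinner_add_right: "cinner_L2 f (g + h) = cinner_L2 f g + cinner_L2 f h"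
  by (subst (1 2 3) cinner_commute) (simp add: cinner_add_left)

lemma cinner_scale_right: "cinner_L2 f (cscale_L2 c g) = cnj c * cinner_L2 f g"
  by (subst (1 2) cinner_commute) (simp add: cinner_scale_left)

lemma uminus_L2_eq: "- f = cscale_L2 (-1) f"
  by (simp add: uminus_L2_def)

lemma cinner_diff_left: "cinner_L2 (f - g) h = cinner_L2 f h - cinner_L2 g h"
  unfolding diff_conv_add_uminus uminus_L2_eq by (simp only: cinner_add_left cinner_scale_left) simp

lemma cinner_diff_right: "cinner_L2 f (g - h) = cinner_L2 f g - cinner_L2 f h"
  unfolding diff_conv_add_uminus uminus_L2_eq by (simp only: cinner_add_right cinner_scale_right) simp

lemma cinner_zero_left [simp]: "cinner_L2 0 f = 0"
  using cinner_diff_left[of f f f] by simp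

lemma cinner_zero_right [simp]: "cinner_L2 f 0 = 0"
  using cinner_diff_right[of f f f] by simp

lemma cscale_add_right: "cscale_L2 c (f + g) = cscale_L2 c f + cscale_L2 c g"
  by transfer (auto simp: square_integrable_add square_integrable_scale distrib_left)

lemma cscale_cscale: "cscale_L2 c (cscale_L2 d f) = cscale_L2 (c * d) f"
  by transfer (auto simp: square_integrable_scale mult.assoc simp flip: mult.assoc)

lemma cscale_one [simp]: "cscale_L2 1 f = f"
  by transfer auto

lemma cscale_of_real: "cscale_L2 (complex_of_real r) f = r *\<^sub>R f"
  by (simp add: scaleR_L2_def)

lemma cinner_self_square: "cinner_L2 f f = complex_of_real ((norm f)\<^sup>2)"
proof -
  have "Im (cinner_L2 f f) = 0"
    using arg_cong[OF cinner_commute[of f f], of Im] by simp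
  moreover have "Re (cinner_L2 f f) = (norm f)\<^sup>2"
    unfolding power2_norm_eq_inner by (simp add: inner_L2_def)
  ultimately show ?thesis by (simp add: complex_eq_iff)
qed

lemma norm_cscale: "norm (cscale_L2 c f) = cmod c * norm f"
proof -
  have "complex_of_real ((norm (cscale_L2 c f))\<^sup>2) = (c * cnj c) * cinner_L2 f f"
    unfolding cinner_self_square[symmetric] cinner_scale_left cinner_scale_right by (simp only: mult_ac)
  also have "\<dots> = complex_of_real ((cmod c * norm f)\<^sup>2)"
    by (simp only: cinner_self_square complex_norm_square[symmetric] power_mult_distrib of_real_mult)
  finally have "complex_of_real ((norm (cscale_L2 c f))\<^sup>2) = complex_of_real ((cmod c * norm f)\<^sup>2)" .
  then have "(norm (cscale_L2 c f))\<^sup>2 = (cmod c * norm f)\<^sup>2"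
    using of_real_eq_iff by blast
  then show ?thesis
    by (simp add: power2_eq_iff_nonneg)
qed

lemma cscale_diff_right: "cscale_L2 c (f - g) = cscale_L2 c f - cscale_L2 c g"
  unfolding diff_conv_add_uminus uminus_L2_eq by (simp only: cscale_add_right cscale_cscale) simp

lemma bounded_linear_cscale: "bounded_linear (cscale_L2 c)"
proof (rule bounded_linear_intro)
  show "cscale_L2 c (f + g) = cscale_L2 c f + cscale_L2 c g" for f g
    by (rule cscale_add_right)
  show "cscale_L2 c (r *\<^sub>R f) = r *\<^sub>R cscale_L2 c f" for r f
    by (simp add: scaleR_L2_def cscale_cscale mult.commute)
  show "norm (cscale_L2 c f) \<le> norm f * cmod c" for f
    by (simp add: norm_cscale mult.commute)
qed

text \<open>A unimodular factor \<open>u\<close> turns the inner product into its modulus, and the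
  real Cauchy-Schwarz inequality applies to the rotated vector.\<close>

lemma norm_cinner_le: "cmod (cinner_L2 f g) \<le> norm f * norm g"
proof (cases "cinner_L2 f g = 0")
  case False
  define u where "u = cnj (sgn (cinner_L2 f g))"
  have "cmod u = 1" using False by (simp add: u_def norm_sgn)
  have "complex_of_real (cmod (cinner_L2 f g)) = u * cinner_L2 f g"
    using False unfolding u_def sgn_eq
    by (simp add: field_simps complex_norm_square[symmetric] power2_eq_square flip: of_real_mult)
  then have "cmod (cinner_L2 f g) = Re (cinner_L2 (cscale_L2 u f) g)"
    by (metis Re_complex_of_real cinner_scale_left)
  also have "\<dots> \<le> norm (cscale_L2 u f) * norm g"
    using norm_cauchy_schwarz[of "cscale_L2 u f" g] by (simp add: inner_L2_def)
  finally show ?thesis using \<open>cmod u = 1\<close> by (simp add: norm_cscale)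
qed auto

lemma tendsto_cinner_left:
  "(u \<longlongrightarrow> a) F \<Longrightarrow> ((\<lambda>x. cinner_L2 (u x) g) \<longlongrightarrow> cinner_L2 a g) F"
proof (rule bounded_linear.tendsto[where f = "\<lambda>x. cinner_L2 x g"], rule bounded_linear_intro)
  show "cinner_L2 (r *\<^sub>R x) g = r *\<^sub>R cinner_L2 x g" for r x
    by (simp add: scaleR_L2_def cinner_scale_left scaleR_conv_of_real)
  show "cmod (cinner_L2 x g) \<le> norm x * norm g" for x
    by (rule norm_cinner_le)
qed (simp_all add: cinner_add_left)

lemma norm_abs_L2_square:
  assumes "square_integrable f"
  shows "(norm (abs_L2 f))\<^sup>2 = (\<integral>x. (cmod (f x))\<^sup>2 \<partial>lborel)"
proof -
  have "complex_of_real ((norm (abs_L2 f))\<^sup>2) = (\<integral>x. complex_of_real ((cmod (f x))\<^sup>2) \<partial>lborel)"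
    unfolding cinner_self_square[symmetric] cinner_abs_L2[OF assms assms] complex_norm_square ..
  then show ?thesis
    by (simp del: of_real_power)
qed

lemma nn_integral_norm_abs_L2:
  assumes "square_integrable f"
  shows "(\<integral>\<^sup>+x. ennreal ((cmod (f x))\<^sup>2) \<partial>lborel) = ennreal ((norm (abs_L2 f))\<^sup>2)"
  using assms by (simp add: norm_abs_L2_square square_integrable_def nn_integral_eq_integral)

lemma square_integrable_diff:
  "square_integrable f \<Longrightarrow> square_integrable g \<Longrightarrow> square_integrable (\<lambda>x. f x - g x)"
  using square_integrable_add[OF _ square_integrable_scale[of g "-1"], of f] by simp

lemma minus_abs_L2:
  "square_integrable f \<Longrightarrow> square_integrable g \<Longrightarrow>
    abs_L2 f - abs_L2 g = abs_L2 (\<lambda>x. f x - g x)"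
  unfolding diff_conv_add_uminus uminus_L2_eq
  by (simp add: cscale_abs_L2 plus_abs_L2 square_integrable_scale[of g "-1", simplified])

lemma nn_integral_norm_diff_rep_L2:
  assumes "square_integrable u"
  shows "(\<integral>\<^sup>+x. ennreal ((cmod (u x - rep_L2 h x))\<^sup>2) \<partial>lborel) = ennreal ((norm (abs_L2 u - h))\<^sup>2)"
proof -
  note si = assms square_integrable_rep_L2[of h]
  show ?thesis
    using minus_abs_L2[OF si] by (simp add: abs_rep_L2 nn_integral_norm_abs_L2[OF square_integrable_diff[OF si]])
qed

lemma square_integrable_norm: "square_integrable f \<Longrightarrow> square_integrable (\<lambda>x. complex_of_real (cmod (f x)))"
  unfolding square_integrable_def by auto

lemma norm_abs_L2_norm:
  "square_integrable f \<Longrightarrow> norm (abs_L2 (\<lambda>x. complex_of_real (cmod (f x)))) = norm (abs_L2 f)"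
  using norm_abs_L2_square[OF square_integrable_norm, of f] norm_abs_L2_square[of f]
  by (metis (no_types, lifting) Bochner_Integration.integral_cong norm_ge_zero norm_of_real
      power2_eq_iff_nonneg abs_norm_cancel)

lemma integral_norm_mult_le:
  assumes f: "square_integrable f" and g: "square_integrable g"
  shows "integrable lborel (\<lambda>x. cmod (f x) * cmod (g x))"
    and "(\<integral>x. cmod (f x) * cmod (g x) \<partial>lborel) \<le> norm (abs_L2 f) * norm (abs_L2 g)"
proof -
  let ?f = "\<lambda>x. complex_of_real (cmod (f x))" and ?g = "\<lambda>x. complex_of_real (cmod (g x))"
  show i: "integrable lborel (\<lambda>x. cmod (f x) * cmod (g x))"
    using integrable_norm[OF square_integrable_mult_integrable[OF f g]] by (simp add: norm_mult)
  have "cinner_L2 (abs_L2 ?f) (abs_L2 ?g) = (\<integral>x. complex_of_real (cmod (f x) * cmod (g x)) \<partial>lborel)"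
    by (subst cinner_abs_L2) (simp_all add: square_integrable_norm f g)
  also have "\<dots> = complex_of_real (\<integral>x. cmod (f x) * cmod (g x) \<partial>lborel)"
    by (rule integral_complex_of_real)
  finally have "(\<integral>x. cmod (f x) * cmod (g x) \<partial>lborel) = Re (cinner_L2 (abs_L2 ?f) (abs_L2 ?g))"
    by simp
  also have "\<dots> \<le> norm (abs_L2 ?f) * norm (abs_L2 ?g)"
    by (rule order_trans[OF complex_Re_le_cmod norm_cinner_le])
  finally show "(\<integral>x. cmod (f x) * cmod (g x) \<partial>lborel) \<le> norm (abs_L2 f) * norm (abs_L2 g)"
    by (simp add: norm_abs_L2_norm f g)
qed

section \<open>Fatou's lemma and completeness of the space of square-integrable functions\<close>

lemma square_integrable_Fatou:
  assumes u: "\<And>n. square_integrable (u n)" and g: "g \<in> borel_measurable lborel"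
    and lim: "AE x in lborel. (\<lambda>n. u n x) \<longlonglongrightarrow> g x"
    and bound: "\<And>n::nat. norm (abs_L2 (u n)) \<le> C"
  shows "square_integrable g" "norm (abs_L2 g) \<le> C"
proof -
  have [measurable]: "u n \<in> borel_measurable lborel" for n
    using u by (simp add: square_integrable_def)
  have "0 \<le> C" using bound[of 0] norm_ge_zero order_trans by blast
  have "(\<integral>\<^sup>+x. ennreal ((cmod (g x))\<^sup>2) \<partial>lborel)
      = (\<integral>\<^sup>+x. liminf (\<lambda>n. ennreal ((cmod (u n x))\<^sup>2)) \<partial>lborel)"
  proof (rule nn_integral_cong_AE)
    show "AE x in lborel. ennreal ((cmod (g x))\<^sup>2) = liminf (\<lambda>n. ennreal ((cmod (u n x))\<^sup>2))"
      using lim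
    proof eventually_elim
      case (elim x)
      then have "(\<lambda>n. ennreal ((cmod (u n x))\<^sup>2)) \<longlonglongrightarrow> ennreal ((cmod (g x))\<^sup>2)"
        by (intro tendsto_intros)
      then show ?case by (intro lim_imp_Liminf[symmetric]) simp_all
    qed
  qed
  also have "\<dots> \<le> liminf (\<lambda>n. \<integral>\<^sup>+x. ennreal ((cmod (u n x))\<^sup>2) \<partial>lborel)"
    by (rule nn_integral_liminf) simp
  also have "\<dots> \<le> ennreal (C\<^sup>2)"
  proof (rule Liminf_le)
    show "\<forall>\<^sub>F n in sequentially. (\<integral>\<^sup>+x. ennreal ((cmod (u n x))\<^sup>2) \<partial>lborel) \<le> ennreal (C\<^sup>2)"
      using bound by (simp add: nn_integral_norm_abs_L2[OF u] ennreal_leI power_mono)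
  qed simp
  finally have le: "(\<integral>\<^sup>+x. ennreal ((cmod (g x))\<^sup>2) \<partial>lborel) \<le> ennreal (C\<^sup>2)" .
  have "integrable lborel (\<lambda>x. (cmod (g x))\<^sup>2)"
    by (rule integrableI_bounded)
       (use le g in \<open>auto simp: le_less_trans\<close>)
  then show si: "square_integrable g"
    using g by (simp add: square_integrable_def)
  have "(norm (abs_L2 g))\<^sup>2 \<le> C\<^sup>2"
    using le unfolding nn_integral_norm_abs_L2[OF si] by (simp add: ennreal_le_iff)
  then show "norm (abs_L2 g) \<le> C"
    using \<open>0 \<le> C\<close> by (simp add: power2_le_iff_abs_le)
qed

lemma has_bochner_integral_inverse_1_plus_square:
  "has_bochner_integral lborel (\<lambda>x::real. inverse (1 + x\<^sup>2)) pi"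
proof -
  have "(\<integral>\<^sup>+x. ennreal (inverse (1 + x\<^sup>2)) * indicator {0..} x \<partial>lborel) = ennreal (pi / 2 - arctan 0)"
    by (rule nn_integral_FTC_atLeast)
       (auto intro!: derivative_eq_intros tendsto_arctan_at_top simp: add_pos_nonneg)
  moreover have "(\<integral>\<^sup>+x. ennreal (inverse (1 + x\<^sup>2)) * indicator {..0} x \<partial>lborel)
      = (\<integral>\<^sup>+x. ennreal (inverse (1 + x\<^sup>2)) * indicator {0..} x \<partial>lborel)"
    by (subst nn_integral_real_affine[where c="-1" and t=0])
       (auto intro!: nn_integral_cong simp: indicator_def)
  moreover have "(\<integral>\<^sup>+x. ennreal (inverse (1 + x\<^sup>2)) \<partial>lborel)
    = (\<integral>\<^sup>+x. ennreal (inverse (1 + x\<^sup>2)) * indicator {0..} x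
         + ennreal (inverse (1 + x\<^sup>2)) * indicator {..0} x \<partial>lborel)"
    using AE_lborel_singleton[of 0]
    by (intro nn_integral_cong_AE) (auto elim!: eventually_mono simp: indicator_def)
  ultimately have "(\<integral>\<^sup>+x. ennreal (inverse (1 + x\<^sup>2)) \<partial>lborel) = ennreal pi"
    by (simp add: nn_integral_add flip: ennreal_plus)
  then show ?thesis
    by (intro has_bochner_integral_nn_integral) auto
qed

instance L2 :: complete_space
proof
  fix X :: "nat \<Rightarrow> L2" assume "Cauchy X"
  \<comment> \<open>A square-integrable weight without zeros: multiplication by \<open>w\<close>
    turns an \<open>L2\<close>-Cauchy sequence into an L1-Cauchy one, which has an almost everywhere
    Cauchy subsequence, and division by \<open>w\<close> removes the weight again.\<close>
  define w where "w = (\<lambda>x::real. complex_of_real (inverse (1 + x\<^sup>2)))"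
  have w: "square_integrable w"
    unfolding square_integrable_def
  proof
    show "integrable lborel (\<lambda>x. (cmod (w x))\<^sup>2)"
    proof (rule Bochner_Integration.integrable_bound)
      show "integrable lborel (\<lambda>x::real. inverse (1 + x\<^sup>2))"
        using has_bochner_integral_inverse_1_plus_square by (simp add: has_bochner_integral_iff)
      have "(inverse (1 + x\<^sup>2))\<^sup>2 \<le> inverse (1 + x\<^sup>2)" for x :: real
        using power_decreasing[of 1 2 "inverse (1 + x\<^sup>2)"] by (simp add: inverse_le_1_iff)
      then show "AE x in lborel. norm ((cmod (w x))\<^sup>2) \<le> norm (inverse (1 + x\<^sup>2))"
        unfolding w_def norm_of_real by (intro AE_I2) (simp add: power2_abs)
    qed (simp add: w_def)
  qed (simp add: w_def)
  have X: "square_integrable (rep_L2 (X n))" for n by (rule square_integrable_rep_L2)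
  have [measurable]: "rep_L2 (X n) \<in> borel_measurable lborel" for n
    using X by (simp add: square_integrable_def)
  have cnj_w: "cnj (w x) = w x" for x by (simp add: w_def)
  define s where "s = (\<lambda>n x. rep_L2 (X n) x * w x)"
  have s: "integrable lborel (s n)" for n
    using square_integrable_mult_integrable[OF X w, of n] by (simp add: s_def cnj_w)
  obtain r where r: "strict_mono r" and "AE x in lborel. Cauchy (\<lambda>i. s (r i) x)"
  proof (rule cauchy_L1_AE_cauchy_subseq[OF s])
    fix e :: real assume "e > 0"
    then obtain N where N: "\<And>i j. i \<ge> N \<Longrightarrow> j \<ge> N \<Longrightarrow> norm (X i - X j) < e / (norm (abs_L2 w) + 1)"
      using \<open>Cauchy X\<close> unfolding Cauchy_iff
      by (metis add_nonneg_pos divide_pos_pos norm_ge_zero zero_less_one)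
    have "(LINT x|lborel. norm (s i x - s j x)) < e" if "i \<ge> N" "j \<ge> N" for i j
    proof -
      have "(LINT x|lborel. norm (s i x - s j x))
          = (LINT x|lborel. cmod (rep_L2 (X i) x - rep_L2 (X j) x) * cmod (w x))"
        by (simp add: s_def norm_mult flip: left_diff_distrib)
      also have "\<dots> \<le> norm (abs_L2 (\<lambda>x. rep_L2 (X i) x - rep_L2 (X j) x)) * norm (abs_L2 w)"
        by (intro integral_norm_mult_le square_integrable_diff X w)
      also have "\<dots> = norm (X i - X j) * norm (abs_L2 w)"
        by (simp add: minus_abs_L2[OF X X, symmetric] abs_rep_L2)
      also have "\<dots> \<le> norm (X i - X j) * (norm (abs_L2 w) + 1)"
        by (intro mult_left_mono) auto
      also have "\<dots> < e"
        using N[OF that] by (simp add: pos_less_divide_eq add_nonneg_pos)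
      finally show ?thesis .
    qed
    then show "\<exists>N. \<forall>i\<ge>N. \<forall>j\<ge>N. (LINT x|lborel. norm (s i x - s j x)) < e" by blast
  qed
  define g where "g = (\<lambda>x. lim (\<lambda>i. rep_L2 (X (r i)) x))"
  have g: "g \<in> borel_measurable lborel" unfolding g_def by measurable
  have lim: "AE x in lborel. (\<lambda>i. rep_L2 (X (r i)) x) \<longlonglongrightarrow> g x"
    using \<open>AE x in lborel. Cauchy (\<lambda>i. s (r i) x)\<close>
  proof eventually_elim
    case (elim x)
    have "w x \<noteq> 0" unfolding w_def
      by (smt (verit) inverse_nonzero_iff_nonzero of_real_eq_0_iff zero_le_power2)
    from elim have "convergent (\<lambda>i. s (r i) x * inverse (w x))"
      by (intro convergent_mult convergent_const) (simp add: Cauchy_convergent_iff)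
    then have "convergent (\<lambda>i. rep_L2 (X (r i)) x)"
      using \<open>w x \<noteq> 0\<close> by (simp add: s_def mult.assoc)
    then show ?case by (simp add: g_def convergent_LIMSEQ_iff)
  qed
  \<comment> \<open>Fatou's lemma with \<open>j\<close> fixed and the other index tending to
    infinity: the Cauchy estimate passes to the pointwise limit \<open>g\<close>.\<close>
  have close: "\<exists>N. \<forall>j\<ge>N. square_integrable (\<lambda>x. g x - rep_L2 (X (r j)) x)
      \<and> norm (abs_L2 (\<lambda>x. g x - rep_L2 (X (r j)) x)) \<le> e" if "e > 0" for e
  proof -
    obtain N where N: "\<And>i j. i \<ge> N \<Longrightarrow> j \<ge> N \<Longrightarrow> norm (X i - X j) < e"
      using \<open>Cauchy X\<close> \<open>e > 0\<close> unfolding Cauchy_iff by metis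
    have "square_integrable (\<lambda>x. g x - rep_L2 (X (r j)) x)"
      "norm (abs_L2 (\<lambda>x. g x - rep_L2 (X (r j)) x)) \<le> e" if "j \<ge> N" for j
    proof -
      let ?u = "\<lambda>i x. rep_L2 (X (r (i + N))) x - rep_L2 (X (r j)) x"
      have 1: "square_integrable (?u i)" for i by (intro square_integrable_diff X)
      have 2: "(\<lambda>x. g x - rep_L2 (X (r j)) x) \<in> borel_measurable lborel" using g by measurable
      have 3: "AE x in lborel. (\<lambda>i. ?u i x) \<longlonglongrightarrow> g x - rep_L2 (X (r j)) x"
        using lim by eventually_elim (intro tendsto_intros LIMSEQ_ignore_initial_segment)
      have 4: "norm (abs_L2 (?u i)) \<le> e" for i
        using N[of "r (i + N)" "r j"] seq_suble[OF r, of "i + N"] seq_suble[OF r, of j] that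
        by (simp add: minus_abs_L2[OF X X, symmetric] abs_rep_L2)
      show "square_integrable (\<lambda>x. g x - rep_L2 (X (r j)) x)"
        "norm (abs_L2 (\<lambda>x. g x - rep_L2 (X (r j)) x)) \<le> e"
        using square_integrable_Fatou[OF 1 2 3 4] by auto
    qed
    then show ?thesis by blast
  qed
  have "square_integrable g"
  proof -
    obtain j where "square_integrable (\<lambda>x. g x - rep_L2 (X (r j)) x)"
      using close[of 1] by auto
    from square_integrable_add[OF this X[of "r j"]] show ?thesis by simp
  qed
  have "(\<lambda>j. X (r j)) \<longlonglongrightarrow> abs_L2 g"
  proof (rule LIMSEQ_I)
    fix e :: real assume "e > 0"
    then obtain N where N: "\<And>j. j \<ge> N \<Longrightarrow> norm (abs_L2 (\<lambda>x. g x - rep_L2 (X (r j)) x)) \<le> e / 2"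
      using close[of "e / 2"] by auto
    have "norm (X (r j) - abs_L2 g) < e" if "j \<ge> N" for j
    proof -
      have "norm (X (r j) - abs_L2 g) \<le> e / 2"
        using N[OF that] minus_abs_L2[OF \<open>square_integrable g\<close> X[of "r j"]]
        by (simp add: abs_rep_L2 norm_minus_commute)
      then show ?thesis using \<open>e > 0\<close> by linarith
    qed
    then show "\<exists>no. \<forall>n\<ge>no. norm (X (r n) - abs_L2 g) < e" by blast
  qed
  then have "X \<longlonglongrightarrow> abs_L2 g"
    using Cauchy_converges_subseq[OF \<open>Cauchy X\<close> r] by (simp add: o_def)
  then show "convergent X" by (rule convergentI)
qed


section \<open>Orthogonal projections onto closed subspaces, first real, then complex\<close>

lemma orthogonal_projection_exists:
  fixes S :: "'a::{real_inner, complete_space} set"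
  assumes "closed S" "subspace S"
  shows "\<exists>y\<in>S. \<forall>s\<in>S. inner (x - y) s = 0"
proof -
  have "S \<noteq> {}" using subspace_0[OF assms(2)] by auto
  define d where "d = infdist x S"
  have d_le: "d \<le> norm (x - y)" if "y \<in> S" for y
    using infdist_le[OF that, of x] by (simp add: d_def dist_norm)
  have "0 \<le> d" by (simp add: d_def infdist_nonneg)
  have "\<exists>y\<in>S. norm (x - y) < d + inverse (real (Suc n))" for n
  proof -
    have "(INF y\<in>S. dist x y) < d + inverse (real (Suc n))"
      using \<open>S \<noteq> {}\<close> by (simp add: d_def infdist_def)
    then show ?thesis
      using \<open>S \<noteq> {}\<close>
      by (subst (asm) cINF_less_iff) (auto simp: dist_norm intro!: bdd_belowI2[of _ 0])
  qed
  then obtain u where u: "\<And>n. u n \<in> S" "\<And>n. norm (x - u n) < d + inverse (real (Suc n))"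
    by metis
  have lim_u: "(\<lambda>n. norm (x - u n)) \<longlonglongrightarrow> d"
  proof (rule tendsto_sandwich[OF _ _ tendsto_const])
    show "(\<lambda>n. d + inverse (real (Suc n))) \<longlonglongrightarrow> d"
      using tendsto_add[OF tendsto_const LIMSEQ_inverse_real_of_nat] by auto
    show "\<forall>\<^sub>F n in sequentially. d \<le> norm (x - u n)"
      using d_le u(1) by (intro always_eventually) auto
    show "\<forall>\<^sub>F n in sequentially. norm (x - u n) \<le> d + inverse (real (Suc n))"
      using u(2) by (intro always_eventually allI less_imp_le)
  qed
  \<comment> \<open>Parallelogram law: the midpoint of \<open>u m\<close> and \<open>u n\<close>
    lies in \<open>S\<close>, hence has distance at least \<open>d\<close> from \<open>x\<close>.
    This makes every minimising sequence Cauchy.\<close>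
  have dist_le: "(norm (u m - u n))\<^sup>2 \<le> 2 * ((norm (x - u m))\<^sup>2 - d\<^sup>2) + 2 * ((norm (x - u n))\<^sup>2 - d\<^sup>2)" for m n
  proof -
    have "(1/2) *\<^sub>R (u m + u n) \<in> S"
      using u assms(2) by (intro subspace_scale subspace_add)
    then have "d\<^sup>2 \<le> (norm (x - (1/2) *\<^sub>R (u m + u n)))\<^sup>2"
      using d_le \<open>0 \<le> d\<close> by (intro power_mono) auto
    moreover have "x - (1/2) *\<^sub>R (u m + u n) = (1/2) *\<^sub>R ((x - u m) + (x - u n))"
      by (simp add: algebra_simps flip: scaleR_add_left)
    ultimately have "4 * d\<^sup>2 \<le> (norm ((x - u m) + (x - u n)))\<^sup>2"
      by (simp add: power_divide)
    moreover have "(norm (b - a))\<^sup>2 + (norm (a + b))\<^sup>2 = 2 * (norm a)\<^sup>2 + 2 * (norm b)\<^sup>2" for a b :: 'a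
      unfolding power2_norm_eq_inner by (simp add: inner_diff_left inner_diff_right
          inner_add_left inner_add_right)
    from this[of "x - u n" "x - u m"] have "(norm (u m - u n))\<^sup>2 + (norm ((x - u m) + (x - u n)))\<^sup>2
        = 2 * (norm (x - u m))\<^sup>2 + 2 * (norm (x - u n))\<^sup>2"
      by (simp add: norm_minus_commute)
    ultimately show ?thesis by argo
  qed
  have "Cauchy u"
  proof (rule CauchyI)
    fix e :: real assume "0 < e"
    have "(\<lambda>n. (norm (x - u n))\<^sup>2 - d\<^sup>2) \<longlonglongrightarrow> d\<^sup>2 - d\<^sup>2"
      by (intro tendsto_intros lim_u)
    then have "\<forall>\<^sub>F n in sequentially. (norm (x - u n))\<^sup>2 - d\<^sup>2 < e\<^sup>2 / 4"
      using \<open>0 < e\<close> by (intro order_tendstoD) auto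
    then obtain M where M: "\<And>n. n \<ge> M \<Longrightarrow> (norm (x - u n))\<^sup>2 - d\<^sup>2 < e\<^sup>2 / 4"
      by (auto simp: eventually_sequentially)
    have "norm (u m - u n) < e" if "m \<ge> M" "n \<ge> M" for m n
    proof -
      have "(norm (u m - u n))\<^sup>2 < e\<^sup>2"
      proof -
        have "p < q" if "p \<le> 2 * r + 2 * t" "r < q / 4" "t < q / 4" for p q r t :: real
          using that by linarith
        from this[OF dist_le M[OF that(1)] M[OF that(2)]] show ?thesis .
      qed
      then show ?thesis using \<open>0 < e\<close> by (simp add: power_less_imp_less_base)
    qed
    then show "\<exists>M. \<forall>m\<ge>M. \<forall>n\<ge>M. norm (u m - u n) < e" by blast
  qed
  then obtain y where y: "u \<longlonglongrightarrow> y"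
    using Cauchy_convergent convergent_def by blast
  have "y \<in> S"
    using closed_sequentially[OF assms(1) u(1) y] .
  have norm_y: "norm (x - y) = d"
    by (rule LIMSEQ_unique[OF _ lim_u]) (intro tendsto_intros y)
  have "inner (x - y) s = 0" if "s \<in> S" for s
  proof (rule ccontr)
    assume ne: "inner (x - y) s \<noteq> 0"
    then have s: "0 < inner s s" by auto
    \<comment> \<open>The minimiser of the quadratic polynomial
      \<open>norm ((x - y) - t *\<^sub>R s)\<close> squared; a nonzero inner product would make
      \<open>y + t *\<^sub>R s\<close> closer to \<open>x\<close> than \<open>y\<close>.\<close>
    define t where "t = inner (x - y) s / inner s s"
    have "y + t *\<^sub>R s \<in> S"
      using \<open>y \<in> S\<close> that assms(2) by (intro subspace_add subspace_scale)
    then have "(norm (x - y))\<^sup>2 \<le> (norm ((x - y) - t *\<^sub>R s))\<^sup>2"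
      using d_le[of "y + t *\<^sub>R s"] norm_y by (intro power_mono) (auto simp: algebra_simps)
    also have "\<dots> = (norm (x - y))\<^sup>2 - 2 * t * inner (x - y) s + t * t * inner s s"
    proof -
      have "(norm (v - t *\<^sub>R s))\<^sup>2 = (norm v)\<^sup>2 - 2 * t * inner v s + t * t * inner s s" for v
        using inner_commute[of s v]
        by (simp add: power2_norm_eq_inner inner_diff_left inner_diff_right) (simp add: algebra_simps)
      then show ?thesis .
    qed
    finally have "2 * t * inner (x - y) s \<le> t * t * inner s s" by simp
    moreover have "t * t * inner s s = t * inner (x - y) s"
      using s by (simp add: t_def)
    moreover have "0 < t * inner (x - y) s"
      using ne s by (simp add: t_def zero_less_mult_iff zero_less_divide_iff) linarith
    ultimately show False by linarith
  qed
  with \<open>y \<in> S\<close> show ?thesis by blast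
qed

definition complex_subspace :: "L2 set \<Rightarrow> bool" where
  "complex_subspace S \<longleftrightarrow> 0 \<in> S \<and> (\<forall>f\<in>S. \<forall>g\<in>S. f + g \<in> S) \<and> (\<forall>c. \<forall>f\<in>S. cscale_L2 c f \<in> S)"

lemma complex_subspace_diff:
  "complex_subspace S \<Longrightarrow> f \<in> S \<Longrightarrow> g \<in> S \<Longrightarrow> f - g \<in> S"
  unfolding diff_conv_add_uminus uminus_L2_eq by (auto simp: complex_subspace_def)

lemma complex_orthogonal_projection_exists:
  assumes "closed S" "complex_subspace S"
  shows "\<exists>y\<in>S. \<forall>s\<in>S. cinner_L2 (x - y) s = 0"
proof -
  have "subspace S"
    using assms(2) unfolding subspace_def complex_subspace_def scaleR_L2_def by auto
  from orthogonal_projection_exists[OF assms(1) this] obtain y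
    where y: "y \<in> S" "\<And>s. s \<in> S \<Longrightarrow> inner (x - y) s = 0" by blast
  have "cinner_L2 (x - y) s = 0" if "s \<in> S" for s
  proof -
    \<comment> \<open>Real orthogonality to \<open>s\<close> and to its multiple by the imaginary
      unit gives the real and the imaginary part of complex orthogonality.\<close>
    have "cscale_L2 \<i> s \<in> S" using assms(2) that by (auto simp: complex_subspace_def)
    from y(2)[OF this] y(2)[OF that] show ?thesis
      by (simp add: inner_L2_def cinner_scale_right complex_eq_iff)
  qed
  with y(1) show ?thesis by blast
qed

lemma complex_subspace_dense:
  assumes "closed S" "complex_subspace S"
    and "\<And>f. (\<And>s. s \<in> S \<Longrightarrow> cinner_L2 f s = 0) \<Longrightarrow> f = 0"
  shows "S = UNIV"
proof -
  have "x \<in> S" for x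
    using complex_orthogonal_projection_exists[OF assms(1,2), of x] assms(3)
    by (metis eq_iff_diff_eq_0)
  then show ?thesis by auto
qed

lemma projections_scale: "P \<in> projections \<Longrightarrow> P (cscale_L2 c f) = cscale_L2 c (P f)"
  and projections_idem: "P \<in> projections \<Longrightarrow> P (P f) = P f"
  and projections_adjoint: "P \<in> projections \<Longrightarrow> cinner_L2 (P f) g = cinner_L2 f (P g)"
  by (auto simp: projections_def)

lemma norm_le_of_cinner_eq:
  assumes "cinner_L2 p p = cinner_L2 f p"
  shows "norm p \<le> norm f"
proof -
  have "(norm p)\<^sup>2 = cmod (cinner_L2 f p)"
    unfolding assms[symmetric] cinner_self_square norm_of_real by simp
  also have "\<dots> \<le> norm f * norm p" by (rule norm_cinner_le)
  finally show ?thesis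
    by (cases "p = 0") (simp_all add: power2_eq_square)
qed

lemma projections_norm_le: "P \<in> projections \<Longrightarrow> norm (P f) \<le> norm f"
  by (rule norm_le_of_cinner_eq) (metis projections_adjoint projections_idem)

lemma projections_fixed: "P \<in> projections \<Longrightarrow> f \<in> range (blinfun_apply P) \<Longrightarrow> P f = f"
  by (auto simp: projections_idem)

lemma cinner_eq_zeroI: "cinner_L2 f f = 0 \<Longrightarrow> f = 0"
  by (simp add: cinner_self_square)

text \<open>This uniqueness gives the definite description in \<open>projection_onto\<close> its
  meaning. Equal ranges yield P Q = Q and Q P = P, and self-adjointness turns these into P =
  Q.\<close>

lemma projections_eqI:
  assumes P: "P \<in> projections" and Q: "Q \<in> projections"
    and PQ: "range (blinfun_apply P) = range (blinfun_apply Q)"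
  shows "P = Q"
proof (rule blinfun_eqI)
  fix f
  have "P (Q g) = Q g" "Q (P g) = P g" for g
    using projections_fixed[OF P, of "Q g"] projections_fixed[OF Q, of "P g"] PQ by auto
  then have "cinner_L2 (P f - Q f) g = 0" for g
    by (metis P Q cinner_diff_left eq_iff_diff_eq_0 projections_adjoint)
  then show "P f = Q f"
    using cinner_eq_zeroI by (metis eq_iff_diff_eq_0)
qed

lemma projection_onto_eqI:
  "P \<in> projections \<Longrightarrow> range (blinfun_apply P) = K \<Longrightarrow> projection_onto K = P"
  unfolding projection_onto_def by (rule the_equality) (auto intro: projections_eqI)

lemma closed_complex_subspace_projection:
  assumes "closed S" "complex_subspace S"
  obtains P where "P \<in> projections" "range (blinfun_apply P) = S"
proof -
  obtain p where p: "\<And>x. p x \<in> S" "\<And>x s. s \<in> S \<Longrightarrow> cinner_L2 (x - p x) s = 0"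
    using complex_orthogonal_projection_exists[OF assms] by metis
  have uniq: "p x = y" if "y \<in> S" "\<And>s. s \<in> S \<Longrightarrow> cinner_L2 (x - y) s = 0" for x y
  proof -
    have "p x - y \<in> S" using p(1) that(1) by (rule complex_subspace_diff[OF assms(2)])
    from that(2)[OF this] p(2)[OF this, of x] have "cinner_L2 (p x - y) (p x - y) = 0"
      by (simp add: cinner_diff_left)
    then show ?thesis using cinner_eq_zeroI by (metis eq_iff_diff_eq_0)
  qed
  have S: "f + g \<in> S" "cscale_L2 c f \<in> S" if "f \<in> S" "g \<in> S" for f g c
    using assms(2) that by (auto simp: complex_subspace_def)
  have add: "p (x + y) = p x + p y" for x y
  proof (rule uniq)
    show "p x + p y \<in> S" by (rule S(1)[OF p(1) p(1)])
    show "cinner_L2 (x + y - (p x + p y)) s = 0" if "s \<in> S" for s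
      using p(2)[OF that, of x] p(2)[OF that, of y] by (simp add: cinner_diff_left cinner_add_left)
  qed
  have scale: "p (cscale_L2 c x) = cscale_L2 c (p x)" for c x
  proof (rule uniq)
    show "cscale_L2 c (p x) \<in> S" by (rule S(2)[OF p(1) p(1)])
    show "cinner_L2 (cscale_L2 c x - cscale_L2 c (p x)) s = 0" if "s \<in> S" for s
      using p(2)[OF that, of x] by (simp add: cinner_scale_left flip: cscale_diff_right)
  qed
  have fixed: "p x = x" if "x \<in> S" for x
    using that by (intro uniq) auto
  have adj: "cinner_L2 (p f) g = cinner_L2 f (p g)" for f g
  proof -
    have "cinner_L2 (f - p f) (p g) = 0" "cinner_L2 (g - p g) (p f) = 0"
      by (rule p(2) p(1))+
    moreover have "cinner_L2 (p f) (g - p g) = cnj (cinner_L2 (g - p g) (p f))"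
      by (rule cinner_commute)
    ultimately show ?thesis
      by (simp add: cinner_diff_left cinner_diff_right)
  qed
  have norm_le: "norm (p f) \<le> norm f" for f
    by (rule norm_le_of_cinner_eq) (metis adj fixed p(1))
  have "bounded_linear p"
    using scale[of "complex_of_real _"] norm_le
    by (intro bounded_linear_intro[of _ 1]) (auto simp: add cscale_of_real)
  then have ap: "blinfun_apply (Blinfun p) = p" by (rule bounded_linear_Blinfun_apply)
  show thesis
  proof
    show "Blinfun p \<in> projections"
      unfolding projections_def ap mem_Collect_eq by (simp only: scale fixed p(1) adj simp_thms)
    show "range (blinfun_apply (Blinfun p)) = S"
      unfolding ap using p(1) fixed by (metis image_subset_iff rangeI subsetI subset_antisym)
  qed
qed

section \<open>Conjugation and integrals over horizontal lines\<close>

lemma cnj_measurable: "f \<in> borel_measurable lborel \<Longrightarrow> (\<lambda>x. cnj (f x)) \<in> borel_measurable lborel"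
  by (rule measurable_compose[of _ _ borel])
     (auto intro!: borel_measurable_continuous_onI continuous_intros)

lemma square_integrable_cnj: "square_integrable f \<Longrightarrow> square_integrable (\<lambda>x. cnj (f x))"
  using cnj_measurable[of f] by (simp add: square_integrable_def)

lift_definition conj_L2 :: "L2 \<Rightarrow> L2" is "\<lambda>f x. cnj (f x)"
  by (auto simp: square_integrable_cnj)

lemma conj_abs_L2: "square_integrable f \<Longrightarrow> conj_L2 (abs_L2 f) = abs_L2 (\<lambda>x. cnj (f x))"
  by (rule conj_L2.abs_eq) auto

lemma conj_conj_L2 [simp]: "conj_L2 (conj_L2 f) = f"
  by transfer auto

lemma conj_add: "conj_L2 (f + g) = conj_L2 f + conj_L2 g"
  by transfer (auto simp: square_integrable_cnj square_integrable_add
      simp flip: complex_cnj_add)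

lemma conj_cscale: "conj_L2 (cscale_L2 c f) = cscale_L2 (cnj c) (conj_L2 f)"
  by transfer (auto simp: square_integrable_cnj square_integrable_scale simp flip: complex_cnj_mult)

lemma cinner_conj_conj: "cinner_L2 (conj_L2 f) (conj_L2 g) = cnj (cinner_L2 f g)"
  by transfer (simp flip: Bochner_Integration.integral_cnj)

lemma cinner_conj_left: "cinner_L2 (conj_L2 f) g = cnj (cinner_L2 f (conj_L2 g))"
  using cinner_conj_conj[of f "conj_L2 g"] by simp

lemma norm_conj_L2 [simp]: "norm (conj_L2 f) = norm f"
  unfolding norm_L2_def by (simp add: cinner_conj_conj)

lemma bounded_linear_conj_L2: "bounded_linear conj_L2"
  by (rule bounded_linear_intro[of _ 1])
     (auto simp: conj_add conj_cscale simp flip: cscale_of_real)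

section \<open>Hardy functions through the norms of their horizontal slices, and Stokes' theorem in
  strips\<close>

lemma H2D:
  assumes "h \<in> H2"
  obtains F A where "F holomorphic_on {z. 0 < Im z}"
    "\<And>y. y > 0 \<Longrightarrow> square_integrable (\<lambda>x. F (Complex x y))"
    "\<And>y. y > 0 \<Longrightarrow> norm (abs_L2 (\<lambda>x. F (Complex x y))) \<le> A"
    "((\<lambda>y. abs_L2 (\<lambda>x. F (Complex x y))) \<longlongrightarrow> h) (at_right 0)"
proof -
  obtain F where F: "F holomorphic_on {z. 0 < Im z}"
    and fin: "(SUP y\<in>{0<..}. \<integral>\<^sup>+x. ennreal ((cmod (F (Complex x y)))\<^sup>2) \<partial>lborel) < \<infinity>"
    and lim: "((\<lambda>y. \<integral>\<^sup>+x. ennreal ((cmod (F (Complex x y) - rep_L2 h x))\<^sup>2) \<partial>lborel) \<longlongrightarrow> 0) (at_right 0)"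
    using assms unfolding H2_def by auto
  define M where "M = (SUP y\<in>{0<..}. \<integral>\<^sup>+x. ennreal ((cmod (F (Complex x y)))\<^sup>2) \<partial>lborel)"
  have le: "(\<integral>\<^sup>+x. ennreal ((cmod (F (Complex x y)))\<^sup>2) \<partial>lborel) \<le> M" if "y > 0" for y
    unfolding M_def using that by (intro SUP_upper) auto
  have si: "square_integrable (\<lambda>x. F (Complex x y))" if "y > 0" for y
  proof -
    have "continuous_on UNIV (\<lambda>x. F (Complex x y))"
      by (rule continuous_on_compose2[OF holomorphic_on_imp_continuous_on[OF F]])
         (use that in \<open>auto simp: Complex_eq intro!: continuous_intros\<close>)
    then have m: "(\<lambda>x. F (Complex x y)) \<in> borel_measurable lborel"
      using borel_measurable_continuous_onI by simp
    show ?thesis unfolding square_integrable_def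
      using le[OF that] fin m
      by (auto intro!: integrableI_bounded simp: M_def[symmetric] le_less_trans)
  qed
  have norm_le: "norm (abs_L2 (\<lambda>x. F (Complex x y))) \<le> sqrt (enn2real M)" if "y > 0" for y
  proof (rule real_le_rsqrt)
    have "ennreal ((norm (abs_L2 (\<lambda>x. F (Complex x y))))\<^sup>2) \<le> M"
      using le[OF that] by (simp add: nn_integral_norm_abs_L2[OF si[OF that]])
    then show "(norm (abs_L2 (\<lambda>x. F (Complex x y))))\<^sup>2 \<le> enn2real M"
      using fin enn2real_mono[of "ennreal ((norm (abs_L2 (\<lambda>x. F (Complex x y))))\<^sup>2)" M]
      by (simp add: M_def[symmetric])
  qed
  have "((\<lambda>y. ennreal ((norm (abs_L2 (\<lambda>x. F (Complex x y)) - h))\<^sup>2)) \<longlongrightarrow> ennreal 0) (at_right 0)"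
  proof (rule Lim_transform_eventually)
    show "\<forall>\<^sub>F y in at_right 0. (\<integral>\<^sup>+x. ennreal ((cmod (F (Complex x y) - rep_L2 h x))\<^sup>2) \<partial>lborel)
        = ennreal ((norm (abs_L2 (\<lambda>x. F (Complex x y)) - h))\<^sup>2)"
      using eventually_at_right_less[of 0] by eventually_elim (rule nn_integral_norm_diff_rep_L2[OF si])
  qed (use lim in simp)
  then have "((\<lambda>y. (norm (abs_L2 (\<lambda>x. F (Complex x y)) - h))\<^sup>2) \<longlongrightarrow> 0) (at_right 0)"
    by (subst (asm) tendsto_ennreal_iff) auto
  then have "((\<lambda>y. sqrt ((norm (abs_L2 (\<lambda>x. F (Complex x y)) - h))\<^sup>2)) \<longlongrightarrow> sqrt 0) (at_right 0)"
    by (rule tendsto_real_sqrt)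
  then have "((\<lambda>y. abs_L2 (\<lambda>x. F (Complex x y))) \<longlongrightarrow> h) (at_right 0)"
    by (simp add: tendsto_norm_zero_iff LIM_zero_iff)
  with F si norm_le show thesis by (rule that)
qed

lemma H2I:
  assumes F: "F holomorphic_on {z. 0 < Im z}"
    and si: "\<And>y. y > 0 \<Longrightarrow> square_integrable (\<lambda>x. F (Complex x y))"
    and le: "\<And>y. y > 0 \<Longrightarrow> norm (abs_L2 (\<lambda>x. F (Complex x y))) \<le> A"
    and lim: "((\<lambda>y. abs_L2 (\<lambda>x. F (Complex x y))) \<longlongrightarrow> h) (at_right 0)"
  shows "h \<in> H2"
proof -
  have "(SUP y\<in>{0<..}. \<integral>\<^sup>+x. ennreal ((cmod (F (Complex x y)))\<^sup>2) \<partial>lborel) \<le> ennreal (A\<^sup>2)"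
    using le by (intro SUP_least) (auto simp: nn_integral_norm_abs_L2 si intro!: ennreal_leI power_mono)
  also have "\<dots> < \<infinity>" by simp
  finally have fin: "(SUP y\<in>{0<..}. \<integral>\<^sup>+x. ennreal ((cmod (F (Complex x y)))\<^sup>2) \<partial>lborel) < \<infinity>" .
  have "((\<lambda>y. \<integral>\<^sup>+x. ennreal ((cmod (F (Complex x y) - rep_L2 h x))\<^sup>2) \<partial>lborel) \<longlongrightarrow> ennreal (0\<^sup>2)) (at_right 0)"
  proof (rule Lim_transform_eventually)
    show "((\<lambda>y. ennreal ((norm (abs_L2 (\<lambda>x. F (Complex x y)) - h))\<^sup>2)) \<longlongrightarrow> ennreal (0\<^sup>2)) (at_right 0)"
      using lim by (intro tendsto_intros) (simp add: tendsto_norm_zero_iff LIM_zero_iff)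
    show "\<forall>\<^sub>F y in at_right 0. ennreal ((norm (abs_L2 (\<lambda>x. F (Complex x y)) - h))\<^sup>2)
      = (\<integral>\<^sup>+x. ennreal ((cmod (F (Complex x y) - rep_L2 h x))\<^sup>2) \<partial>lborel)"
      using eventually_at_right_less[of 0] by eventually_elim (rule nn_integral_norm_diff_rep_L2[OF si, symmetric])
  qed
  with F fin show ?thesis unfolding H2_def by auto
qed

text \<open>Stokes' theorem in differential form. Since \<open>F\<close> is holomorphic, its
  y-derivative is \<i> times its x-derivative, and integration by parts moves the latter onto
  \<open>G\<close>. What remains is the boundary term and \<open>Gy - \<i> * Gx\<close>, which is -2
  \<i> times the d-bar derivative of \<open>G\<close> and measures how far \<open>G\<close> is from
  being holomorphic. The lemma serves both a cutoff function and an almost analytic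
  extension.\<close>

lemma strip_integral_derivative:
  fixes F :: "complex \<Rightarrow> complex" and G Gx Gy :: "real \<Rightarrow> real \<Rightarrow> complex"
  assumes F: "F holomorphic_on S" "open S"
    and S: "\<And>x y. x \<in> {a..b} \<Longrightarrow> y \<in> U \<Longrightarrow> Complex x y \<in> S"
    and ab: "a \<le> b" and U: "convex U" "y \<in> U"
    and Gx: "\<And>x y. x \<in> {a..b} \<Longrightarrow> y \<in> U \<Longrightarrow>
      ((\<lambda>x. G x y) has_vector_derivative Gx x y) (at x within {a..b})"
    and Gy: "\<And>x y. x \<in> {a..b} \<Longrightarrow> y \<in> U \<Longrightarrow>
      ((\<lambda>y. G x y) has_vector_derivative Gy x y) (at y within U)"
    and cont: "continuous_on (U \<times> {a..b}) (\<lambda>(y, x). G x y)"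
      "continuous_on (U \<times> {a..b}) (\<lambda>(y, x). Gx x y)"
      "continuous_on (U \<times> {a..b}) (\<lambda>(y, x). Gy x y)"
  shows "((\<lambda>y. integral {a..b} (\<lambda>x. F (Complex x y) * G x y)) has_vector_derivative
      (\<i> * (F (Complex b y) * G b y - F (Complex a y) * G a y)
        + integral {a..b} (\<lambda>x. F (Complex x y) * (Gy x y - \<i> * Gx x y)))) (at y within U)"
proof -
  have dF: "(F has_field_derivative deriv F (Complex x y)) (at (Complex x y))"
    if "x \<in> {a..b}" "y \<in> U" for x y
    using holomorphic_derivI[OF F S[OF that]] .
  have contF: "continuous_on S F" "continuous_on S (deriv F)"
    using F by (auto intro: holomorphic_on_imp_continuous_on holomorphic_deriv)
  have cont_comp: "continuous_on (U \<times> {a..b}) (\<lambda>(y, x). H (Complex x y))"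
    if "continuous_on S H" for H :: "complex \<Rightarrow> complex"
    unfolding split_beta
    by (rule continuous_on_compose2[OF that])
       (use S in \<open>auto simp: Complex_eq intro!: continuous_intros\<close>)
  note c2 = cont_comp[OF contF(1)] cont_comp[OF contF(2)]
  have slice: "continuous_on {a..b} (\<lambda>x. H x y)" if "continuous_on (U \<times> {a..b}) (\<lambda>(y, x). H x y)" "y \<in> U"
    for H :: "real \<Rightarrow> real \<Rightarrow> complex" and y
    using continuous_on_compose2[OF that(1) continuous_on_Pair[OF continuous_on_const continuous_on_id],
        of y "{a..b}"] that(2) by auto
  note slices = slice[OF cont(1)] slice[OF cont(2)] slice[OF cont(3)]
    slice[OF c2(1)] slice[OF c2(2)]
  have dFy: "((\<lambda>y. F (Complex x y)) has_vector_derivative \<i> * deriv F (Complex x y)) (at y within U)"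
    if "x \<in> {a..b}" "y \<in> U" for x y
  proof -
    have "((\<lambda>y. Complex x y) has_vector_derivative \<i>) (at y within U)"
      unfolding Complex_eq by (auto intro!: derivative_eq_intros)
    from field_vector_diff_chain_within[OF this DERIV_subset[OF dF[OF that]]]
    show ?thesis by (simp add: o_def)
  qed
  have dFx: "((\<lambda>x. F (Complex x y)) has_vector_derivative deriv F (Complex x y)) (at x within {a..b})"
    if "x \<in> {a..b}" "y \<in> U" for x y
  proof -
    have "((\<lambda>x. Complex x y) has_vector_derivative 1) (at x within {a..b})"
      unfolding Complex_eq by (auto intro!: derivative_eq_intros)
    from field_vector_diff_chain_within[OF this DERIV_subset[OF dF[OF that]]]
    show ?thesis by (simp add: o_def)
  qed
  let ?D = "\<lambda>x y. F (Complex x y) * Gy x y + \<i> * deriv F (Complex x y) * G x y"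
  have *: "((\<lambda>y. integral (cbox a b) (\<lambda>x. F (Complex x y) * G x y)) has_vector_derivative
      integral (cbox a b) (\<lambda>x. ?D x y)) (at y within U)"
  proof (rule leibniz_rule_vector_derivative[OF _ _ _ U(2,1)])
    show "((\<lambda>y. F (Complex x y) * G x y) has_vector_derivative ?D x y) (at y within U)"
      if "y \<in> U" "x \<in> cbox a b" for x y
      using has_vector_derivative_mult[OF dFy Gy, of x y] that by simp
    show "(\<lambda>x. F (Complex x y) * G x y) integrable_on cbox a b" if "y \<in> U" for y
      using slices that by (auto intro!: integrable_continuous_real continuous_intros)
    show "continuous_on (U \<times> cbox a b) (\<lambda>(y, x). ?D x y)"
      using cont c2 unfolding split_beta cbox_interval by (intro continuous_intros) auto
  qed
  have ftc: "((\<lambda>x. F (Complex x y) * Gx x y + deriv F (Complex x y) * G x y) has_integral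
      (F (Complex b y) * G b y - F (Complex a y) * G a y)) {a..b}"
    by (rule fundamental_theorem_of_calculus[OF ab])
       (use has_vector_derivative_mult[OF dFx Gx] U in auto)
  have "integral {a..b} (\<lambda>x. ?D x y) = integral {a..b} (\<lambda>x.
      \<i> * (F (Complex x y) * Gx x y + deriv F (Complex x y) * G x y) + F (Complex x y) * (Gy x y - \<i> * Gx x y))"
    by (simp add: algebra_simps)
  also have "\<dots> = \<i> * (F (Complex b y) * G b y - F (Complex a y) * G a y)
      + integral {a..b} (\<lambda>x. F (Complex x y) * (Gy x y - \<i> * Gx x y))"
    by (subst integral_add)
       (use slices U integral_unique[OF ftc] ftc in
         \<open>auto intro!: integrable_continuous_real continuous_intros simp: integral_mult_right\<close>)
  finally show ?thesis using * by simp
qed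


text \<open>Cauchy's theorem for two horizontal lines. The hypotheses give no pointwise decay on the
  vertical sides of a rectangle, so the integrand is multiplied by a cutoff that vanishes there. The
  price is an area term, controlled by the integral bound \<open>B\<close> and the small slope of
  the cutoff.\<close>

lemma upper_half_plane_integral_const:
  assumes Q: "Q holomorphic_on {z. 0 < Im z}"
    and int: "\<And>y. y > 0 \<Longrightarrow> integrable lborel (\<lambda>x. Q (Complex x y))"
    and B: "\<And>y. y > 0 \<Longrightarrow> (\<integral>x. cmod (Q (Complex x y)) \<partial>lborel) \<le> B"
    and y: "0 < y1" "y1 < y2"
  shows "(\<integral>x. Q (Complex x y1) \<partial>lborel) = (\<integral>x. Q (Complex x y2) \<partial>lborel)"
proof -
  \<comment> \<open>A cutoff in x alone: it vanishes at both ends of \<open>?J n\<close>, tends to 1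
    pointwise, and has slope at most 4 / (n + 1), so the area term is at most 4 B / (n + 1) at every
    height.\<close>
  define chi where "chi = (\<lambda>(n::nat) (x::real). (1 - (x / Suc n)\<^sup>2)\<^sup>2)"
  define chi' where "chi' = (\<lambda>(n::nat) (x::real). - 4 * x / (real (Suc n))\<^sup>2 * (1 - (x / Suc n)\<^sup>2))"
  let ?J = "\<lambda>n. {- real (Suc n)..real (Suc n)}"
  define I where "I = (\<lambda>n y. integral (?J n) (\<lambda>x. Q (Complex x y) * complex_of_real (chi n x)))"
  have open_upper: "open {z. 0 < Im z}" by (rule open_halfspace_Im_gt)
  have contQ: "continuous_on A (\<lambda>x. Q (Complex x y))" if "y > 0" for y A
    by (rule continuous_on_compose2[OF holomorphic_on_imp_continuous_on[OF Q]])
       (use that in \<open>auto simp: Complex_eq intro!: continuous_intros\<close>)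
  have unit: "(x / real (Suc n))\<^sup>2 \<le> 1" if "x \<in> ?J n" for x n
    using that by (intro power2_le_iff_abs_le[THEN iffD2, of 1, simplified]) (auto simp: field_simps abs_le_iff)
  have dI: "(I n has_vector_derivative integral (?J n) (\<lambda>x. Q (Complex x y) * (0 - \<i> * complex_of_real (chi' n x))))
      (at y)" if "y > 0" for n y
  proof -
    have *: "((\<lambda>x. complex_of_real (chi n x)) has_vector_derivative complex_of_real (chi' n x)) (at x within A)"
      for x A
    proof -
      have "(chi n has_real_derivative chi' n x) (at x within A)"
      proof -
        have "((\<lambda>x. (1 - (x / N)\<^sup>2)\<^sup>2) has_real_derivative - 4 * x / N\<^sup>2 * (1 - (x / N)\<^sup>2)) (at x within A)"
          if "N \<noteq> 0" for N
          using that by (auto intro!: derivative_eq_intros simp: power2_eq_square)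
        then show ?thesis unfolding chi_def chi'_def by simp
      qed
      then show ?thesis
        by (rule has_vector_derivative_of_real)
    qed
    have cont: "continuous_on A (\<lambda>(y, x). complex_of_real (chi n x))"
      "continuous_on A (\<lambda>(y, x). complex_of_real (chi' n x))" for A :: "(real \<times> real) set"
      unfolding split_beta chi_def chi'_def by (intro continuous_intros; simp)+
    have "(I n has_vector_derivative
        (\<i> * (Q (Complex (real (Suc n)) y) * complex_of_real (chi n (real (Suc n)))
            - Q (Complex (- real (Suc n)) y) * complex_of_real (chi n (- real (Suc n))))
        + integral (?J n) (\<lambda>x. Q (Complex x y) * (0 - \<i> * complex_of_real (chi' n x))))) (at y within {0<..})"
      unfolding I_def using that cont *
      by (intro strip_integral_derivative[OF Q open_upper]) auto
    moreover have "chi n (real (Suc n)) = 0" "chi n (- real (Suc n)) = 0"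
      by (simp_all add: chi_def power_divide del: of_nat_Suc)
    ultimately show ?thesis
      using that by (simp add: at_within_open[of y "{0<..}"])
  qed
  have dI_le: "norm (integral (?J n) (\<lambda>x. Q (Complex x y) * (0 - \<i> * complex_of_real (chi' n x))))
      \<le> 4 * B / Suc n" if "y > 0" for n y
  proof -
    have int_on: "set_integrable lborel (?J n) (\<lambda>x. cmod (Q (Complex x y)))"
      unfolding set_integrable_def using int[OF that] by (intro integrable_mult_indicator) auto
    have "norm (integral (?J n) (\<lambda>x. Q (Complex x y) * (0 - \<i> * complex_of_real (chi' n x))))
      \<le> integral (?J n) (\<lambda>x. 4 / Suc n * cmod (Q (Complex x y)))"
    proof (rule integral_norm_bound_integral)
      show "norm (Q (Complex x y) * (0 - \<i> * complex_of_real (chi' n x))) \<le> 4 / Suc n * cmod (Q (Complex x y))"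
        if "x \<in> ?J n" for x
      proof -
        have "\<bar>chi' n x\<bar> = 4 * (\<bar>x\<bar> / Suc n) * \<bar>1 - (x / Suc n)\<^sup>2\<bar> / Suc n"
          unfolding chi'_def by (simp add: abs_mult power2_eq_square del: of_nat_Suc)
        also have "\<dots> \<le> 4 * 1 * 1 / Suc n"
          using that unit[OF that] by (intro divide_right_mono mult_mono) (auto simp: abs_le_iff field_simps)
        finally have "cmod (Q (Complex x y)) * \<bar>chi' n x\<bar> \<le> cmod (Q (Complex x y)) * (4 / Suc n)"
          by (intro mult_left_mono) auto
        then show ?thesis by (simp add: norm_mult mult.commute)
      qed
    qed (use contQ[OF that] in \<open>auto intro!: integrable_continuous_real continuous_intros simp: chi'_def
          simp del: of_nat_Suc\<close>)
    also have "\<dots> = 4 / Suc n * (LINT x:?J n|lborel. cmod (Q (Complex x y)))"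
      by (simp only: set_borel_integral_eq_integral(2)[OF int_on] integral_mult_right)
    also have "\<dots> \<le> 4 / Suc n * B"
    proof (intro mult_left_mono order_trans[OF _ B[OF that]])
      show "(LINT x:?J n|lborel. cmod (Q (Complex x y))) \<le> (\<integral>x. cmod (Q (Complex x y)) \<partial>lborel)"
        using int[OF that] int_on unfolding set_lebesgue_integral_def set_integrable_def
        by (intro integral_mono) (auto simp: indicator_def)
    qed simp
    finally show ?thesis by simp
  qed
  have diff: "norm (I n y2 - I n y1) \<le> 4 * B / Suc n * y2 - 4 * B / Suc n * y1" for n
  proof (rule differentiable_bound_general[OF y(2), where f' = "\<lambda>y. integral (?J n) (\<lambda>x. Q (Complex x y) *
        (0 - \<i> * complex_of_real (chi' n x)))" and \<phi>' = "\<lambda>_. 4 * B / Suc n"])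
    show "continuous_on {y1..y2} (I n)"
      by (rule continuous_on_vector_derivative, rule has_vector_derivative_at_within, rule dI) (use y in auto)
    show "((*) (4 * B / real (Suc n)) has_vector_derivative 4 * B / real (Suc n)) (at x)" for x
      by (auto intro!: derivative_eq_intros)
  qed (use dI dI_le y in \<open>auto intro!: continuous_intros\<close>)
  have lim: "(\<lambda>n. I n y) \<longlonglongrightarrow> (\<integral>x. Q (Complex x y) \<partial>lborel)" if "y > 0" for y
  proof -
    have I_eq: "I n y = (\<integral>x. indicator (?J n) x *\<^sub>R (Q (Complex x y) * complex_of_real (chi n x)) \<partial>lborel)" for n
      unfolding I_def set_lebesgue_integral_def[symmetric]
      by (rule set_borel_integral_eq_integral(2)[symmetric], rule borel_integrable_atLeastAtMost')
         (use contQ[OF that] in \<open>auto intro!: continuous_intros simp: chi_def simp del: of_nat_Suc\<close>)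
    have meas: "(\<lambda>x. Q (Complex x y)) \<in> borel_measurable borel"
      using int[OF that] borel_measurable_integrable by fastforce
    show ?thesis unfolding I_eq
    proof (rule integral_dominated_convergence[where w = "\<lambda>x. cmod (Q (Complex x y))"])
      show "AE x in lborel. (\<lambda>n. indicator (?J n) x *\<^sub>R (Q (Complex x y) * complex_of_real (chi n x)))
          \<longlonglongrightarrow> Q (Complex x y)"
      proof (rule AE_I2)
        fix x :: real
        have "(\<lambda>n. x / real (Suc n)) \<longlonglongrightarrow> 0"
          using tendsto_mult[OF tendsto_const[of x] LIMSEQ_inverse_real_of_nat] by (simp add: divide_inverse)
        then have "(\<lambda>n. (1 - (x / real (Suc n))\<^sup>2)\<^sup>2) \<longlonglongrightarrow> (1 - 0\<^sup>2)\<^sup>2"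
          by (intro tendsto_intros)
        then have "(\<lambda>n. Q (Complex x y) * complex_of_real (chi n x)) \<longlonglongrightarrow> Q (Complex x y) * complex_of_real 1"
          unfolding chi_def by (intro tendsto_intros) simp
        moreover have "\<forall>\<^sub>F n in sequentially. Q (Complex x y) * complex_of_real (chi n x)
            = indicator (?J n) x *\<^sub>R (Q (Complex x y) * complex_of_real (chi n x))"
          using eventually_ge_at_top[of "nat \<lceil>\<bar>x\<bar>\<rceil>"]
          by eventually_elim (auto simp: indicator_def abs_le_iff nat_le_iff ceiling_le_iff; linarith)
        ultimately show "(\<lambda>n. indicator (?J n) x *\<^sub>R (Q (Complex x y) * complex_of_real (chi n x)))
            \<longlonglongrightarrow> Q (Complex x y)"
          using Lim_transform_eventually by fastforce
      qed
      have "\<bar>chi n x\<bar> \<le> 1" if "x \<in> ?J n" for n x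
        unfolding chi_def using unit[OF that] by (auto intro!: power_le_one)
      then have "norm (indicator (?J n) x *\<^sub>R (Q (Complex x y) * complex_of_real (chi n x))) \<le> cmod (Q (Complex x y))"
        for n x
        by (cases "x \<in> ?J n") (auto simp: norm_mult mult_left_le)
      then show "AE x in lborel. norm (indicator (?J n) x *\<^sub>R (Q (Complex x y) * complex_of_real (chi n x)))
          \<le> cmod (Q (Complex x y))" for n by simp
    qed (use int[OF that] meas in \<open>auto simp: chi_def\<close>)
  qed
  have "(\<lambda>n. I n y2 - I n y1) \<longlonglongrightarrow> 0"
  proof (rule Lim_null_comparison)
    show "\<forall>\<^sub>F n in sequentially. norm (I n y2 - I n y1) \<le> (4 * B * (y2 - y1)) * inverse (Suc n)"
    proof (intro always_eventually allI)
      fix n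
      have "4 * B / Suc n * y2 - 4 * B / Suc n * y1 = (4 * B * (y2 - y1)) * inverse (Suc n)"
        by (simp add: divide_inverse algebra_simps del: of_nat_Suc)
      with diff[of n] show "norm (I n y2 - I n y1) \<le> (4 * B * (y2 - y1)) * inverse (Suc n)"
        by (simp only:)
    qed
    show "(\<lambda>n. (4 * B * (y2 - y1)) * inverse (real (Suc n))) \<longlonglongrightarrow> 0"
      using tendsto_mult[OF tendsto_const LIMSEQ_inverse_real_of_nat] by fastforce
  qed
  moreover have "(\<lambda>n. I n y2 - I n y1) \<longlonglongrightarrow> (\<integral>x. Q (Complex x y2) \<partial>lborel) - (\<integral>x. Q (Complex x y1) \<partial>lborel)"
    using y by (intro tendsto_diff lim) auto
  ultimately show ?thesis
    using LIMSEQ_unique by fastforce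
qed

section \<open>The Cauchy kernel\<close>

lemma bounded_bilinear_cinner: "bounded_bilinear cinner_L2"
proof
  show "cinner_L2 (r *\<^sub>R f) g = r *\<^sub>R cinner_L2 f g" "cinner_L2 f (r *\<^sub>R g) = r *\<^sub>R cinner_L2 f g" for r f g
    by (simp_all add: scaleR_L2_def cinner_scale_left cinner_scale_right scaleR_conv_of_real)
  show "\<exists>K. \<forall>f g. norm (cinner_L2 f g) \<le> norm f * norm g * K"
    using norm_cinner_le by (intro exI[of _ 1]) auto
qed (simp_all add: cinner_add_left cinner_add_right)

lemma norm_abs_L2_mono:
  assumes f: "square_integrable f" and g: "square_integrable g"
    and "AE x in lborel. cmod (f x) \<le> cmod (g x)"
  shows "norm (abs_L2 f) \<le> norm (abs_L2 g)"
proof -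
  have "(norm (abs_L2 f))\<^sup>2 \<le> (norm (abs_L2 g))\<^sup>2"
    unfolding norm_abs_L2_square[OF f] norm_abs_L2_square[OF g]
    using f g assms(3) by (intro integral_mono_AE) (auto simp: square_integrable_def elim!: eventually_mono intro!: power_mono)
  then show ?thesis by simp
qed

lemma has_bochner_integral_poisson:
  fixes a b :: real
  assumes "b > 0"
  shows "has_bochner_integral lborel (\<lambda>x. inverse ((x - a)\<^sup>2 + b\<^sup>2)) (pi / b)"
proof -
  have eq: "inverse ((a + b * x - a)\<^sup>2 + b\<^sup>2) = inverse (b\<^sup>2) * inverse (1 + x\<^sup>2)" for x
    unfolding inverse_mult_distrib[symmetric] by (rule arg_cong[of _ _ inverse]) algebra
  have "has_bochner_integral lborel (\<lambda>x. inverse (b\<^sup>2) * inverse (1 + x\<^sup>2)) (inverse (b\<^sup>2) * pi)"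
    by (intro has_bochner_integral_mult_right has_bochner_integral_inverse_1_plus_square)
  moreover have "inverse (b\<^sup>2) * pi = (pi / b) /\<^sub>R \<bar>b\<bar>"
    using assms by (simp add: power2_eq_square field_simps)
  ultimately have "has_bochner_integral lborel (\<lambda>x. inverse ((a + b * x - a)\<^sup>2 + b\<^sup>2)) ((pi / b) /\<^sub>R \<bar>b\<bar>)"
    unfolding eq by (rule back_subst)
  then show ?thesis
    using lborel_has_bochner_integral_real_affine_iff[of b "\<lambda>x. inverse ((x - a)\<^sup>2 + b\<^sup>2)" "pi / b" a] assms
    by blast
qed

text \<open>The Szego kernel of the upper half plane, the reproducing kernel of the Hardy space. For
  \<open>w\<close> in the upper half plane its only pole \<open>cnj w\<close> lies in the lower
  one.\<close>

definition szego :: "complex \<Rightarrow> complex \<Rightarrow> complex" where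
  "szego w z = (\<i> / complex_of_real (2 * pi)) / (z - cnj w)"

definition kappa :: "complex \<Rightarrow> L2" where
  "kappa w = abs_L2 (\<lambda>x. szego w (complex_of_real x))"

text \<open>Raising the line and raising the parameter have the same effect on
  \<open>z - cnj w\<close>, so every slice of a kernel is the boundary function of another
  kernel.\<close>

lemma szego_Complex: "szego w (Complex x y) = szego (w + \<i> * complex_of_real y) (complex_of_real x)"
  by (simp add: szego_def Complex_eq algebra_simps)

lemma szego_cmod_square:
  "(cmod (szego w (complex_of_real x)))\<^sup>2 = 1 / (4 * pi\<^sup>2) * inverse ((x - Re w)\<^sup>2 + (Im w)\<^sup>2)"
proof -
  have 1: "(cmod (complex_of_real x - cnj w))\<^sup>2 = (x - Re w)\<^sup>2 + (Im w)\<^sup>2"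
    by (simp add: cmod_power2)
  have 2: "cmod (\<i> / complex_of_real (2 * pi)) = 1 / (2 * pi)"
    by (simp add: norm_divide norm_mult)
  show ?thesis
    unfolding szego_def norm_divide[of _ "_ - _"] power_divide 1 2
    by (simp add: power_mult_distrib inverse_eq_divide)
qed

lemma square_integrable_szego:
  assumes "Im w > 0"
  shows "square_integrable (\<lambda>x. szego w (complex_of_real x))"
  unfolding square_integrable_def
proof
  show "integrable lborel (\<lambda>x. (cmod (szego w (complex_of_real x)))\<^sup>2)"
    unfolding szego_cmod_square
    using has_bochner_integral_poisson[OF assms] by (simp add: has_bochner_integral_iff)
  have "continuous_on UNIV (\<lambda>x. szego w (complex_of_real x))"
    unfolding szego_def
    by (intro continuous_intros) (use assms in \<open>auto simp: complex_eq_iff\<close>)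
  then show "(\<lambda>x. szego w (complex_of_real x)) \<in> borel_measurable lborel"
    using borel_measurable_continuous_onI by simp
qed

lemma norm_kappa_square:
  assumes "Im w > 0"
  shows "(norm (kappa w))\<^sup>2 = 1 / (4 * pi * Im w)"
  unfolding kappa_def norm_abs_L2_square[OF square_integrable_szego[OF assms]] szego_cmod_square
  using has_bochner_integral_poisson[OF assms, of "Re w"] assms
  by (simp add: has_bochner_integral_iff power2_eq_square)

lemma norm_kappa:
  "Im w > 0 \<Longrightarrow> norm (kappa w) = sqrt (1 / (4 * pi * Im w))"
  using norm_kappa_square[of w] by (metis norm_ge_zero real_sqrt_unique)

lemma norm_kappa_shift_le:
  "Im w > 0 \<Longrightarrow> 0 \<le> y \<Longrightarrow> norm (kappa (w + \<i> * complex_of_real y)) \<le> norm (kappa w)"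
  by (simp add: norm_kappa frac_le)

text \<open>Pointwise the difference is the kernel times
  \<open>- \<i> * y / (x - cnj w + \<i> * y)\<close>, whose denominator has imaginary part at least
  \<open>Im w\<close>.\<close>

lemma norm_kappa_shift_diff:
  assumes "Im w > 0" "0 \<le> y"
  shows "norm (kappa (w + \<i> * complex_of_real y) - kappa w) \<le> y / Im w * norm (kappa w)"
proof -
  let ?w = "w + \<i> * complex_of_real y"
  have w: "Im ?w > 0" using assms by simp
  note si = square_integrable_szego[OF assms(1)] square_integrable_szego[OF w]
  have "cmod (szego ?w (complex_of_real x) - szego w (complex_of_real x))
      \<le> cmod (complex_of_real (y / Im w) * szego w (complex_of_real x))" for x
  proof -
    let ?p = "complex_of_real x - cnj w"
    have ne: "?p \<noteq> 0" "?p + \<i> * y \<noteq> 0"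
      using assms by (auto simp: complex_eq_iff)
    have "szego ?w (complex_of_real x) - szego w (complex_of_real x)
        = - (\<i> * y / (?p + \<i> * y)) * szego w (complex_of_real x)"
    proof -
      have "k / (p + q) - k / p = - (q / (p + q)) * (k / p)" if "p \<noteq> 0" "p + q \<noteq> 0" for k p q :: complex
        using that by (simp add: field_simps)
      moreover have "complex_of_real x - cnj ?w = ?p + \<i> * y" by simp
      ultimately show ?thesis unfolding szego_def using ne by metis
    qed
    moreover have "cmod (\<i> * y / (?p + \<i> * y)) \<le> y / Im w"
    proof -
      have "Im w \<le> \<bar>Im (?p + \<i> * y)\<bar>" using assms by simp
      also have "\<dots> \<le> cmod (?p + \<i> * y)" by (rule abs_Im_le_cmod)
      finally show ?thesis using assms by (simp add: norm_divide norm_mult frac_le)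
    qed
    ultimately show ?thesis
      using assms by (simp only: norm_mult norm_minus_cancel norm_of_real abs_of_nonneg[of "y / Im w"]
          divide_nonneg_pos mult_right_mono norm_ge_zero)
  qed
  then have "norm (abs_L2 (\<lambda>x. szego ?w (complex_of_real x) - szego w (complex_of_real x)))
      \<le> norm (abs_L2 (\<lambda>x. complex_of_real (y / Im w) * szego w (complex_of_real x)))"
    by (intro norm_abs_L2_mono square_integrable_diff square_integrable_scale si AE_I2)
  also have "abs_L2 (\<lambda>x. complex_of_real (y / Im w) * szego w (complex_of_real x)) = cscale_L2 (complex_of_real (y / Im w)) (kappa w)"
    unfolding kappa_def by (rule cscale_abs_L2[OF si(1), symmetric])
  also have "norm \<dots> = y / Im w * norm (kappa w)"
    using assms unfolding norm_cscale norm_of_real by (simp only: abs_of_nonneg divide_nonneg_pos)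
  finally show ?thesis
    unfolding kappa_def minus_abs_L2[OF si(2,1)] .
qed

lemma tendsto_kappa_shift:
  assumes "Im w > 0"
  shows "((\<lambda>y. kappa (w + \<i> * complex_of_real y)) \<longlongrightarrow> kappa w) (at_right 0)"
proof -
  have "((\<lambda>y. kappa (w + \<i> * complex_of_real y) - kappa w) \<longlongrightarrow> 0) (at_right 0)"
  proof (rule Lim_null_comparison)
    show "\<forall>\<^sub>F y in at_right 0. norm (kappa (w + \<i> * complex_of_real y) - kappa w) \<le> y / Im w * norm (kappa w)"
      using eventually_at_right_less[of 0]
      by eventually_elim (use assms norm_kappa_shift_diff in auto)
    show "((\<lambda>y. y / Im w * norm (kappa w)) \<longlongrightarrow> 0) (at_right 0)"
      using assms by (auto intro!: tendsto_eq_intros)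
  qed
  then show ?thesis by (simp add: LIM_zero_iff)
qed

text \<open>The integral of \<open>F z * szego w z\<close> over the line at height y does not depend
  on y, since the product is holomorphic with uniformly bounded integrals of its modulus. By
  Cauchy-Schwarz it is at most \<open>A\<close> times the norm of a kernel that tends to 0 as y
  grows. So it is 0 at every height, and the limit y \<rightarrow> 0 gives the claim.\<close>

lemma H2_orthogonal_conj_kappa:
  assumes "h \<in> H2" "Im w > 0"
  shows "cinner_L2 h (conj_L2 (kappa w)) = 0"
proof -
  obtain F A where F: "F holomorphic_on {z. 0 < Im z}"
    and si: "\<And>y. y > 0 \<Longrightarrow> square_integrable (\<lambda>x. F (Complex x y))"
    and A: "\<And>y. y > 0 \<Longrightarrow> norm (abs_L2 (\<lambda>x. F (Complex x y))) \<le> A"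
    and lim: "((\<lambda>y. abs_L2 (\<lambda>x. F (Complex x y))) \<longlongrightarrow> h) (at_right 0)"
    by (rule H2D[OF assms(1)]) (rule that)
  have "0 \<le> A" by (rule order_trans[OF norm_ge_zero A[of 1]]) simp
  define Q where "Q = (\<lambda>z. F z * szego w z)"
  define I where "I = (\<lambda>y. \<integral>x. Q (Complex x y) \<partial>lborel)"
  let ?w = "\<lambda>y. w + \<i> * complex_of_real y"
  have w: "Im (?w y) > 0" if "y \<ge> 0" for y using assms that by simp
  have Q_eq: "Q (Complex x y) = F (Complex x y) * szego (?w y) (complex_of_real x)" for x y
    by (simp add: Q_def szego_Complex)
  have si': "square_integrable (\<lambda>x. szego (?w y) (complex_of_real x))" if "y \<ge> 0" for y
    using square_integrable_szego[OF w[OF that]] .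
  have I_eq: "I y = cinner_L2 (abs_L2 (\<lambda>x. F (Complex x y))) (conj_L2 (kappa (?w y)))" if "y > 0" for y
    using that unfolding I_def Q_eq kappa_def
    by (simp add: conj_abs_L2 si' cinner_abs_L2 si square_integrable_cnj)
  have norm_I: "(\<integral>x. cmod (Q (Complex x y)) \<partial>lborel) \<le> A * norm (kappa (?w y))" if "y > 0" for y
  proof -
    have "(\<integral>x. cmod (Q (Complex x y)) \<partial>lborel) \<le> norm (abs_L2 (\<lambda>x. F (Complex x y))) * norm (kappa (?w y))"
      using integral_norm_mult_le(2)[OF si si', of y y] that by (simp add: Q_eq norm_mult kappa_def)
    also have "\<dots> \<le> A * norm (kappa (?w y))"
      using A[OF that] by (intro mult_right_mono) auto
    finally show ?thesis .
  qed
  have const: "I y1 = I y2" if "0 < y1" "y1 < y2" for y1 y2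
    unfolding I_def
  proof (rule upper_half_plane_integral_const[OF _ _ _ that])
    show "Q holomorphic_on {z. 0 < Im z}"
      unfolding Q_def szego_def using assms(2)
      by (intro holomorphic_intros F) (auto simp: complex_eq_iff)
    show "integrable lborel (\<lambda>x. Q (Complex x y))" if "y > 0" for y
      using square_integrable_mult_integrable[OF si[OF that] square_integrable_cnj[OF si'[of y]]] that
      by (simp add: Q_eq)
    show "(\<integral>x. cmod (Q (Complex x y)) \<partial>lborel) \<le> A * norm (kappa w)" if "y > 0" for y
      using norm_I[OF that] norm_kappa_shift_le[OF assms(2), of y] that \<open>0 \<le> A\<close>
      by (meson less_imp_le mult_left_mono order_trans)
  qed
  have I0: "I y = 0" if "y > 0" for y
  proof -
    have "norm (I y) \<le> 0"
    proof (rule tendsto_lowerbound)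
      have "((\<lambda>t. A * sqrt (1 / (4 * pi * (Im w + t)))) \<longlongrightarrow> A * sqrt 0) at_top"
        by (intro tendsto_intros tendsto_divide_0[OF tendsto_const] filterlim_at_top_imp_at_infinity
            filterlim_tendsto_pos_mult_at_top[OF tendsto_const]
            filterlim_tendsto_add_at_top[OF tendsto_const] filterlim_ident) auto
      then show "((\<lambda>t. A * sqrt (1 / (4 * pi * (Im w + t)))) \<longlongrightarrow> 0) at_top" by simp
      show "\<forall>\<^sub>F t in at_top. norm (I y) \<le> A * sqrt (1 / (4 * pi * (Im w + t)))"
        using eventually_gt_at_top[of y]
      proof eventually_elim
        case (elim t)
        then have "0 < t" using that by simp
        have "norm (I t) \<le> (\<integral>x. cmod (Q (Complex x t)) \<partial>lborel)"
          unfolding I_def by (rule integral_norm_bound)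
        also have "\<dots> \<le> A * norm (kappa (?w t))" by (rule norm_I) fact
        finally show ?case
          using const[OF that elim] w[of t] \<open>0 < t\<close> by (simp add: norm_kappa)
      qed
    qed simp
    then show ?thesis by simp
  qed
  have "\<forall>\<^sub>F y in at_right 0. 0 = cinner_L2 (abs_L2 (\<lambda>x. F (Complex x y))) (conj_L2 (kappa (?w y)))"
    using eventually_at_right_less[of 0] by (rule eventually_mono) (simp add: I_eq[symmetric] I0)
  then have "((\<lambda>y. cinner_L2 (abs_L2 (\<lambda>x. F (Complex x y))) (conj_L2 (kappa (?w y)))) \<longlongrightarrow> 0) (at_right 0)"
    using tendsto_cong tendsto_const by force
  note lim0 = this
  show ?thesis
  proof (rule tendsto_unique[OF _ _ lim0])
    show "((\<lambda>y. cinner_L2 (abs_L2 (\<lambda>x. F (Complex x y))) (conj_L2 (kappa (?w y))))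
      \<longlongrightarrow> cinner_L2 h (conj_L2 (kappa w))) (at_right 0)"
      by (intro bounded_bilinear.tendsto[OF bounded_bilinear_cinner] lim
        bounded_linear.tendsto[OF bounded_linear_conj_L2] tendsto_kappa_shift assms)
  qed simp
qed

lemma kappa_in_H2:
  assumes "Im w > 0"
  shows "kappa w \<in> H2"
proof (rule H2I[where F = "szego w" and A = "norm (kappa w)"])
  have eq: "(\<lambda>x. szego w (Complex x y)) = (\<lambda>x. szego (w + \<i> * complex_of_real y) (complex_of_real x))" for y
    by (simp add: szego_Complex)
  show "szego w holomorphic_on {z. 0 < Im z}"
    unfolding szego_def using assms by (intro holomorphic_intros) (auto simp: complex_eq_iff)
  show "square_integrable (\<lambda>x. szego w (Complex x y))" if "0 < y" for y
    unfolding eq using assms that by (intro square_integrable_szego) simp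
  show "norm (abs_L2 (\<lambda>x. szego w (Complex x y))) \<le> norm (kappa w)" if "0 < y" for y
    unfolding eq kappa_def[symmetric] using assms that by (intro norm_kappa_shift_le) auto
  show "((\<lambda>y. abs_L2 (\<lambda>x. szego w (Complex x y))) \<longlongrightarrow> kappa w) (at_right 0)"
    unfolding eq kappa_def[symmetric] by (rule tendsto_kappa_shift[OF assms])
qed

lemma cinner_kappa_conj_kappa:
  "Im w > 0 \<Longrightarrow> Im z > 0 \<Longrightarrow> cinner_L2 (kappa w) (conj_L2 (kappa z)) = 0"
  by (rule H2_orthogonal_conj_kappa[OF kappa_in_H2])

text \<open>Partial fractions reduce the inner product to the norm of \<^term>\<open>kappa w\<close> and a product that
  vanishes by orthogonality.\<close>

lemma cinner_kappa:
  assumes w: "Im w > 0" and z: "Im z > 0"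
  shows "cinner_L2 (kappa w) (kappa z) = szego w z"
proof -
  define W Z where "W = (\<lambda>x::real. szego w (complex_of_real x))" and "Z = (\<lambda>x::real. szego z (complex_of_real x))"
  have W: "square_integrable W" and Z: "square_integrable Z"
    unfolding W_def Z_def by (intro square_integrable_szego w z)+
  let ?c = "z - cnj w"
  have c: "?c \<noteq> 0" using w z by (auto simp: complex_eq_iff)
  have pt: "?c * (W x * cnj (Z x)) = - (z - w) * (cnj (Z x) * cnj (W x)) + (w - cnj w) * (W x * cnj (W x))" for x
  proof -
    define p q r where "p = complex_of_real x - cnj w" and "q = complex_of_real x - z" and "r = complex_of_real x - w"
    have ne: "p \<noteq> 0" "q \<noteq> 0" "r \<noteq> 0"
      using w z by (auto simp: complex_eq_iff p_def q_def r_def)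
    define k where "k = \<i> / complex_of_real (2 * pi)"
    have k: "cnj k = - k" by (simp add: k_def)
    have cnj: "cnj p = r" "cnj (complex_of_real x - cnj z) = q" by (simp_all add: p_def q_def r_def)
    have WZ: "W x = k / p" "Z x = k / (complex_of_real x - cnj z)"
      unfolding W_def Z_def szego_def k_def p_def by (rule refl)+
    have cWZ: "cnj (W x) = - k / r" "cnj (Z x) = - k / q"
      unfolding WZ complex_cnj_divide cnj k by (rule refl)+
    have e: "?c = p - q" "z - w = r - q" "w - cnj w = p - r" by (simp_all add: p_def q_def r_def)
    have "(p - q) * (1 / p * (1 / q)) = 1 / q - 1 / p" "(r - q) * (1 / q * (1 / r)) = 1 / q - 1 / r"
      "(p - r) * (1 / p * (1 / r)) = 1 / r - 1 / p"
      using ne by (simp_all add: field_simps)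
    moreover have "(Q - P) * t = (Q - R) * t + (R - P) * t" for P Q R t :: complex
      by (simp add: algebra_simps)
    ultimately have "(p - q) * (1 / p * (1 / q)) * (- k * k)
        = (r - q) * (1 / q * (1 / r)) * (- k * k) + (p - r) * (1 / p * (1 / r)) * (- k * k)"
      by presburger
    moreover have "u * (k / a * (- k / b)) = u * (1 / a * (1 / b)) * (- k * k)"
      "- u * (- k / a * (- k / b)) = u * (1 / a * (1 / b)) * (- k * k)" for u a b
      by simp_all
    ultimately show ?thesis unfolding cWZ unfolding WZ(1) e by presburger
  qed
  have "?c * cinner_L2 (kappa w) (kappa z) = (\<integral>x. ?c * (W x * cnj (Z x)) \<partial>lborel)"
    unfolding kappa_def W_def[symmetric] Z_def[symmetric] by (simp add: cinner_abs_L2 W Z)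
  also have "\<dots> = - (z - w) * (\<integral>x. cnj (Z x) * cnj (W x) \<partial>lborel) + (w - cnj w) * (\<integral>x. W x * cnj (W x) \<partial>lborel)"
    unfolding pt using square_integrable_mult_integrable[OF square_integrable_cnj[OF Z] W]
      square_integrable_mult_integrable[OF W W]
    by (subst Bochner_Integration.integral_add) (simp_all del: mult_minus_left minus_diff_eq)
  also have "(\<integral>x. cnj (Z x) * cnj (W x) \<partial>lborel) = cinner_L2 (conj_L2 (kappa z)) (kappa w)"
    unfolding kappa_def W_def[symmetric] Z_def[symmetric]
    by (simp add: cinner_abs_L2 W Z conj_abs_L2 square_integrable_cnj)
  also have "\<dots> = 0"
    using cinner_kappa_conj_kappa[OF w z] by (subst cinner_commute) simp
  also have "(\<integral>x. W x * cnj (W x) \<partial>lborel) = cinner_L2 (kappa w) (kappa w)"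
    unfolding kappa_def W_def[symmetric] by (simp add: cinner_abs_L2 W)
  also have "\<dots> = 1 / (4 * pi * Im w)"
    by (simp only: cinner_self_square norm_kappa_square[OF w])
  also have "- (z - w) * 0 + (w - cnj w) * complex_of_real (1 / (4 * pi * Im w)) = \<i> / (2 * pi)"
    using w by (simp add: complex_eq_iff)
  finally show ?thesis
    using c by (simp add: szego_def field_simps)
qed

section \<open>Completeness of the Cauchy kernels\<close>

lemma square_integrable_indicator: "square_integrable (indicator {a..b::real})"
  unfolding square_integrable_def
proof
  have "(\<lambda>x. (cmod (indicator {a..b} x))\<^sup>2) = (indicator {a..b} :: real \<Rightarrow> real)"
    by (auto simp: indicator_def)
  then show "integrable lborel (\<lambda>x. (cmod (indicator {a..b} x))\<^sup>2)"
    by (simp only:) (rule integrable_real_indicator, auto simp: emeasure_lborel_Icc_eq)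
qed simp

lemma integrable_indicator_mult:
  assumes "square_integrable g"
  shows "integrable lborel (\<lambda>x. indicator {a..b::real} x *\<^sub>R g x)"
proof -
  have "(\<lambda>x. indicator {a..b} x *\<^sub>R g x) = (\<lambda>x. g x * cnj (indicator {a..b} x))"
    by (auto simp: indicator_def)
  then show ?thesis
    using square_integrable_mult_integrable[OF assms square_integrable_indicator] by simp
qed

text \<open>Compact intervals form an intersection-stable generator of the Borel sets, so the
  vanishing of the integrals extends to all Borel sets, and a density with zero integrals vanishes
  almost everywhere.\<close>

lemma AE_zero_on_interval:
  fixes g :: "real \<Rightarrow> complex"
  assumes g: "square_integrable g"
    and zero: "\<And>a b. p \<le> a \<Longrightarrow> a < b \<Longrightarrow> b \<le> q \<Longrightarrow> (\<integral>x. indicator {a..b} x *\<^sub>R g x \<partial>lborel) = 0"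
  shows "AE x in lborel. x \<in> {p..q} \<longrightarrow> g x = 0"
proof -
  define G where "G = (\<lambda>x. indicator {p..q} x *\<^sub>R g x)"
  have G: "integrable lborel G"
    unfolding G_def by (rule integrable_indicator_mult[OF g])
  \<comment> \<open>Intersecting a generator with \<open>{p..q}\<close> may leave an empty set or a
    single point; these null cases have to be included.\<close>
  have zero': "(\<integral>x. indicator {a..b} x *\<^sub>R g x \<partial>lborel) = 0" if "p \<le> a" "b \<le> q" for a b
  proof (cases "a < b")
    case False
    have "AE x in lborel. indicator {a..b} x *\<^sub>R g x = 0"
      using AE_lborel_singleton[of a] by eventually_elim (use False in \<open>auto simp: indicator_def\<close>)
    then show ?thesis by (rule integral_eq_zero_AE)
  qed (use zero that in blast)
  have inter: "indicator A x *\<^sub>R G x = indicator (A \<inter> {p..q}) x *\<^sub>R g x" for A x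
    by (simp add: G_def indicator_def)
  have sets_eq: "sets lborel = sigma_sets UNIV (range (\<lambda>(a, b). {a..b::real}))"
    by (simp add: borel_eq_atLeastAtMost sets_measure_of_conv)
  have "set_lebesgue_integral lborel A G = 0" if "A \<in> sets lborel" for A
  proof -
    have G_on: "set_integrable lborel A G" if "A \<in> sets lborel" for A
      unfolding set_integrable_def using that G by (rule integrable_mult_indicator)
    have total: "(\<integral>x. G x \<partial>lborel) = 0"
      using zero'[of p q] by (simp add: G_def)
    have "Int_stable (range (\<lambda>(a, b). {a..b::real}))"
      by (auto simp: Int_stable_def)
    moreover have "range (\<lambda>(a, b). {a..b::real}) \<subseteq> Pow UNIV" by simp
    ultimately show ?thesis
      using that[unfolded sets_eq]
    proof (induction rule: sigma_sets_induct_disjoint)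
      case (basic A)
      then obtain a b where A: "A = {a..b}" by auto
      show ?case
        unfolding set_lebesgue_integral_def inter A
        using zero'[of "max a p" "min b q"] by (simp add: Int_atLeastAtMost)
    next
      case (compl A)
      then have A: "A \<in> sets lborel" by (simp only: sets_eq)
      have "set_lebesgue_integral lborel (A \<union> (UNIV - A)) G
          = set_lebesgue_integral lborel A G + set_lebesgue_integral lborel (UNIV - A) G"
        using A by (intro set_integral_Un G_on) auto
      then show ?case
        using compl total by (simp add: set_lebesgue_integral_def)
    next
      case (union A)
      then have "A i \<in> sets lborel" for i unfolding sets_eq by blast
      then have "set_lebesgue_integral lborel (\<Union>i. A i) G = (\<Sum>i. set_lebesgue_integral lborel (A i) G)"
        using union(1) by (intro lebesgue_integral_countable_add G_on)
          (auto simp: disjoint_family_on_def)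
      then show ?case using union by simp
    qed (auto simp: set_lebesgue_integral_def)
  qed
  then have "AE x in lborel. G x = 0"
    by (rule sigma_finite_measure.density_zero[OF lborel.sigma_finite_measure_axioms G])
  then show ?thesis
    by eventually_elim (auto simp: G_def)
qed

text \<open>Compact intervals with rational endpoints cover \<open>U\<close>, so only countably many
  exceptional null sets are collected. The set \<open>U\<close> leaves room to avoid the singular
  points of a phase.\<close>

lemma AE_zero_of_interval_integrals:
  fixes g :: "real \<Rightarrow> complex"
  assumes g: "square_integrable g" and U: "open U" "AE x in lborel. x \<in> U"
    and zero: "\<And>a b. a < b \<Longrightarrow> {a..b} \<subseteq> U \<Longrightarrow> (\<integral>x. indicator {a..b} x *\<^sub>R g x \<partial>lborel) = 0"
  shows "AE x in lborel. g x = 0"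
proof -
  have "AE x in lborel. {of_rat p..of_rat q} \<subseteq> U \<longrightarrow> x \<in> {of_rat p..of_rat q} \<longrightarrow> g x = 0" for p q :: rat
  proof (cases "{of_rat p..of_rat q} \<subseteq> U")
    case True
    have "AE x in lborel. x \<in> {of_rat p..of_rat q} \<longrightarrow> g x = 0"
      by (rule AE_zero_on_interval[OF g], rule zero) (use True in auto)
    then show ?thesis by eventually_elim auto
  qed simp
  then have "AE x in lborel. \<forall>p q::rat. {of_rat p..of_rat q} \<subseteq> U \<longrightarrow> x \<in> {of_rat p..of_rat q} \<longrightarrow> g x = 0"
    by (simp add: AE_all_countable)
  with U(2) show ?thesis
  proof eventually_elim
    case (elim x)
    then obtain e where e: "e > 0" "ball x e \<subseteq> U"
      using U(1) openE by blast
    obtain p q :: rat where "x - e < of_rat p" "of_rat p < x" "x < of_rat q" "of_rat q < x + e"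
      using of_rat_dense[of "x - e" x] of_rat_dense[of x "x + e"] e(1) by auto
    then have "{of_rat p..of_rat q} \<subseteq> ball x e" "x \<in> {of_rat p..of_rat q}"
      by (auto simp: dist_real_def)
    then show ?case using elim e(2) by blast
  qed
qed

text \<open>Twice the real part of the Szego kernel is the Poisson kernel y / (pi ((t - x)^2 +
  y^2)), so orthogonality to a kernel and to its conjugate makes the Poisson integral
  vanish.\<close>

lemma poisson_orthogonal:
  assumes z: "y > 0" and f: "square_integrable f"
    and orth: "cinner_L2 (abs_L2 f) (kappa (Complex x y)) = 0"
      "cinner_L2 (abs_L2 f) (conj_L2 (kappa (Complex x y))) = 0"
  shows "integrable lborel (\<lambda>t. f t * complex_of_real (inverse ((t - x)\<^sup>2 + y\<^sup>2)))" (is ?i)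
    and "(\<integral>t. f t * complex_of_real (inverse ((t - x)\<^sup>2 + y\<^sup>2)) \<partial>lborel) = 0" (is ?z)
proof -
  define S where "S = (\<lambda>t. szego (Complex x y) (complex_of_real t))"
  have S: "square_integrable S"
    unfolding S_def using z by (intro square_integrable_szego) simp
  have eq: "f t * complex_of_real (inverse ((t - x)\<^sup>2 + y\<^sup>2))
      = complex_of_real (pi / y) * (f t * cnj (S t) + f t * cnj (cnj (S t)))" for t
  proof -
    have ne: "(t - x)\<^sup>2 + y\<^sup>2 \<noteq> 0"
      using z by (simp add: sum_power2_eq_zero_iff)
    define p d where "p = Complex (t - x) y" and "d = (t - x)\<^sup>2 + y\<^sup>2"
    have pd: "p * cnj p = complex_of_real d"
      by (simp add: complex_eq_iff p_def d_def power2_eq_square)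
    have "p \<noteq> 0" "d \<noteq> 0"
      using z ne by (auto simp: p_def d_def complex_eq_iff)
    have "S t = (\<i> / complex_of_real (2 * pi)) / p"
      by (simp add: S_def szego_def p_def Complex_eq algebra_simps)
    also have "\<dots> = (\<i> / complex_of_real (2 * pi)) * cnj p * complex_of_real (inverse d)"
      using \<open>p \<noteq> 0\<close> \<open>d \<noteq> 0\<close> pd by (simp add: field_simps)
    also have "\<dots> = complex_of_real (inverse d / (2 * pi)) * (\<i> * cnj p)"
      by simp
    finally have "S t = complex_of_real (inverse d / (2 * pi)) * (\<i> * cnj p)" .
    moreover have "Re (complex_of_real r * (\<i> * cnj p)) = r * y" for r
      by (simp add: p_def)
    ultimately have "Re (S t) = inverse d / (2 * pi) * y"
      by (simp only:)
    then have "Re (S t) = y / (2 * pi) * inverse d"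
      by (simp only: divide_inverse mult_ac)
    then have "pi / y * (2 * Re (S t)) = inverse d"
      using z by simp
    then have "complex_of_real (pi / y) * (cnj (S t) + S t) = complex_of_real (inverse d)"
      by (metis add.commute complex_add_cnj of_real_mult)
    moreover have "F * (c * (u + v)) = c * (F * u + F * v)" for F c u v :: complex
      by (simp add: algebra_simps)
    ultimately show ?thesis
      unfolding complex_cnj_cnj d_def by metis
  qed
  note i = square_integrable_mult_integrable[OF f S] square_integrable_mult_integrable[OF f square_integrable_cnj[OF S]]
  show ?i unfolding eq
    by (intro integrable_mult_right Bochner_Integration.integrable_add i)
  have "(\<integral>t. f t * cnj (S t) \<partial>lborel) = 0" "(\<integral>t. f t * cnj (cnj (S t)) \<partial>lborel) = 0"
    using orth unfolding kappa_def S_def[symmetric]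
    by (simp_all add: cinner_abs_L2[OF f S] conj_abs_L2[OF S] cinner_abs_L2[OF f square_integrable_cnj[OF S]])
  then show ?z unfolding eq
    by (simp add: Bochner_Integration.integral_add[OF i] del: complex_cnj_cnj)
qed

text \<open>Integrating the Poisson kernel at height 1/n over x in [a, b] produces these arctangent
  differences. Dominated convergence needs a bound uniform in n that is square integrable in t,
  hence decay like 1/(1 + |t - a|). Away from [a, b] both terms are near the same limit, because
  arctan (n s) differs from pi/2 by at most 1/s; near [a, b] the trivial bound pi suffices.\<close>

lemma arctan_difference_bound:
  assumes n: "n \<ge> 1" and ab: "a < b"
  shows "0 \<le> arctan (n * (b - t)) - arctan (n * (a - t))"
    and "(arctan (n * (b - t)) - arctan (n * (a - t))) * (1 + \<bar>t - a\<bar>) \<le> pi * (2 + (b - a))"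
proof -
  let ?w = "arctan (n * (b - t)) - arctan (n * (a - t))"
  have "n * (a - t) \<le> n * (b - t)" using n ab by (intro mult_left_mono) auto
  then show w0: "0 \<le> ?w" by (simp add: arctan_le_iff)
  have wpi: "?w \<le> pi"
    using arctan_ubound[of "n * (b - t)"] arctan_lbound[of "n * (a - t)"] by simp
  have inv: "pi / 2 - arctan (n * s) \<le> 1 / s" if "s > 0" for s
  proof -
    have "n * s > 0" using n that by simp
    then have "pi / 2 - arctan (n * s) = arctan (1 / (n * s))"
      using arctan_inverse[of "n * s"] by (simp add: inverse_eq_divide)
    also have "\<dots> \<le> 1 / (n * s)" using \<open>n * s > 0\<close> by (intro arctan_le_self) simp
    also have "\<dots> \<le> 1 / s" using n that by (intro divide_left_mono) auto
    finally show ?thesis .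
  qed
  have far: "u * (1 + v) \<le> pi * (2 + (b - a))" if "u \<le> 1 / s" "s \<ge> 1" "0 \<le> v" "v \<le> s + (b - a)" for u s v
  proof -
    have "u * (1 + v) \<le> 1 / s * (1 + (s + (b - a)))"
      using that ab by (intro mult_mono) auto
    also have "\<dots> = 1 + (1 + (b - a)) / s" using that by (simp add: field_simps)
    also have "\<dots> \<le> 1 + (1 + (b - a)) / 1"
      using that ab by (intro add_left_mono divide_left_mono) auto
    also have "\<dots> \<le> pi * (2 + (b - a))"
      using pi_gt3 ab mult_right_mono[of 1 pi "2 + (b - a)"] by simp
    finally show ?thesis .
  qed
  consider "t \<ge> b + 1" | "t \<le> a - 1" | "a - 1 < t" "t < b + 1" by linarith
  then show "?w * (1 + \<bar>t - a\<bar>) \<le> pi * (2 + (b - a))"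
  proof cases
    case 1
    have "arctan (n * (b - t)) = - arctan (n * (t - b))"
      by (metis arctan_minus minus_diff_eq mult_minus_right)
    then have "?w \<le> 1 / (t - b)"
      using inv[of "t - b"] arctan_lbound[of "n * (a - t)"] 1 by linarith
    then show ?thesis using 1 ab by (intro far) auto
  next
    case 2
    have "?w \<le> 1 / (a - t)"
      using inv[of "a - t"] arctan_ubound[of "n * (b - t)"] 2 by linarith
    then show ?thesis using 2 ab by (intro far) auto
  next
    case 3
    then have "?w * (1 + \<bar>t - a\<bar>) \<le> pi * (1 + (1 + (b - a)))"
      using w0 wpi ab by (intro mult_mono) auto
    then show ?thesis by simp
  qed
qed

text \<open>All Poisson integrals of h vanish. Integrating them over x in [a, b] and exchanging the
  integrals leaves h paired with arctangent differences, which tend to pi times the indicator of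
  [a, b] as the height 1/n tends to 0. Thus h has vanishing integrals over all compact
  intervals.\<close>

lemma kappa_conj_kappa_complete:
  assumes orth: "\<And>z. Im z > 0 \<Longrightarrow> cinner_L2 h (kappa z) = 0"
      "\<And>z. Im z > 0 \<Longrightarrow> cinner_L2 h (conj_L2 (kappa z)) = 0"
  shows "h = 0"
proof -
  define f where "f = rep_L2 h"
  have f: "square_integrable f" unfolding f_def by (rule square_integrable_rep_L2)
  have h: "h = abs_L2 f" by (simp add: f_def abs_rep_L2)
  have [measurable]: "f \<in> borel_measurable borel"
    using f by (simp add: square_integrable_def)
  have P: "integrable lborel (\<lambda>t. f t * complex_of_real (inverse ((t - x)\<^sup>2 + y\<^sup>2)))"
    "(\<integral>t. f t * complex_of_real (inverse ((t - x)\<^sup>2 + y\<^sup>2)) \<partial>lborel) = 0" if "y > 0" for x y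
    using poisson_orthogonal[OF that f, of x] orth[of "Complex x y"] that by (auto simp: h)
  have arctan_zero: "(\<integral>t. f t * complex_of_real (arctan (n * (b - t)) - arctan (n * (a - t))) \<partial>lborel) = 0"
    if n: "n > 0" and ab: "a < b" for a b n :: real
  proof -
    define y where "y = inverse n"
    have y: "y > 0" "n = inverse y" using n by (simp_all add: y_def)
    define k where "k = (\<lambda>x t. indicator {a..b} x *\<^sub>R (f t * complex_of_real (inverse ((t - x)\<^sup>2 + y\<^sup>2))))"
    have prim: "(\<integral>x. indicator {a..b} x *\<^sub>R inverse ((t - x)\<^sup>2 + y\<^sup>2) \<partial>lborel)
        = n * (arctan (n * (b - t)) - arctan (n * (a - t)))" for t
    proof -
      have "(\<integral>x. inverse ((t - x)\<^sup>2 + y\<^sup>2) * indicator {a..b} x \<partial>lborel)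
          = n * arctan (n * (b - t)) - n * arctan (n * (a - t))"
      proof (rule integral_FTC_Icc_real)
        show "((\<lambda>x. n * arctan (n * (x - t))) has_real_derivative inverse ((t - x)\<^sup>2 + y\<^sup>2)) (at x)" for x
        proof -
          have "n * (inverse (1 + (n * (x - t))\<^sup>2) * n) = inverse ((t - x)\<^sup>2 + y\<^sup>2)"
          proof -
            have "n\<^sup>2 * ((t - x)\<^sup>2 + y\<^sup>2) = 1 + (n * (x - t))\<^sup>2"
            proof -
              have "n * y = 1" using n by (simp add: y_def)
              then show ?thesis by algebra
            qed
            moreover have "(t - x)\<^sup>2 + y\<^sup>2 \<noteq> 0"
              using y by (simp add: sum_power2_eq_zero_iff)
            ultimately show ?thesis using n by (simp add: power2_eq_square[of n] flip: \<open>_ = 1 + _\<close>)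
          qed
          then show ?thesis
            by (auto intro!: derivative_eq_intros simp: mult_ac)
        qed
        have "(t - x)\<^sup>2 + y\<^sup>2 \<noteq> 0" for x using y by (simp add: sum_power2_eq_zero_iff)
        then show "isCont (\<lambda>x. inverse ((t - x)\<^sup>2 + y\<^sup>2)) x" for x
          by (intro continuous_intros)
      qed (use ab in auto)
      then show ?thesis by (simp add: mult.commute right_diff_distrib)
    qed
    have k_int: "integrable (lborel \<Otimes>\<^sub>M lborel) (\<lambda>(x, t). k x t)"
    proof (rule lborel_pair.Fubini_integrable)
      show "(\<lambda>(x, t). k x t) \<in> borel_measurable (lborel \<Otimes>\<^sub>M lborel)"
        unfolding k_def by measurable
      show "AE x in lborel. integrable lborel (\<lambda>t. case (x, t) of (x, t) \<Rightarrow> k x t)"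
        using P(1)[OF y(1)] by (auto simp: k_def)
      show "integrable lborel (\<lambda>x. \<integral>t. norm (case (x, t) of (x, t) \<Rightarrow> k x t) \<partial>lborel)"
      proof (rule Bochner_Integration.integrable_bound)
        let ?C = "2 * pi * (norm h * sqrt (1 / (4 * pi * y))) / y"
        show "integrable lborel (\<lambda>x. indicator {a..b} x *\<^sub>R ?C)"
          using borel_integrable_atLeastAtMost'[OF continuous_on_const, of a b ?C]
          by (simp only: set_integrable_def)
        show "(\<lambda>x. \<integral>t. norm (case (x, t) of (x, t) \<Rightarrow> k x t) \<partial>lborel) \<in> borel_measurable lborel"
          unfolding k_def by measurable
        show "AE x in lborel. norm (\<integral>t. norm (case (x, t) of (x, t) \<Rightarrow> k x t) \<partial>lborel)
            \<le> norm (indicator {a..b} x *\<^sub>R ?C)"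
        proof (rule AE_I2)
          fix x :: real
          let ?S = "\<lambda>t. szego (Complex x y) (complex_of_real t)"
          have S: "square_integrable ?S" using y by (intro square_integrable_szego) simp
          \<comment> \<open>The left side is the square of \<open>2 * pi * cmod (?S t)\<close>, and
            one of the two factors is at most \<open>1 / y\<close>. The other is left in place so
            that Cauchy-Schwarz bounds the inner integral uniformly in x, as Fubini
            requires.\<close>
          have inv_le: "inverse ((t - x)\<^sup>2 + y\<^sup>2) \<le> 2 * pi / y * cmod (?S t)" for t
          proof -
            have eq: "inverse ((t - x)\<^sup>2 + y\<^sup>2) = (2 * pi * cmod (?S t)) * (2 * pi * cmod (?S t))"
            proof -
              have "(2 * pi * cmod (?S t)) * (2 * pi * cmod (?S t)) = 4 * pi\<^sup>2 * (cmod (?S t))\<^sup>2"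
                by (simp add: power2_eq_square)
              also have "\<dots> = inverse ((t - x)\<^sup>2 + y\<^sup>2)"
                unfolding szego_cmod_square by simp
              finally show ?thesis by simp
            qed
            have "(2 * pi * cmod (?S t))\<^sup>2 \<le> (1 / y)\<^sup>2"
            proof -
              have "inverse ((t - x)\<^sup>2 + y\<^sup>2) \<le> inverse (y\<^sup>2)"
                using y by (intro le_imp_inverse_le) auto
              then show ?thesis unfolding eq by (simp add: power2_eq_square inverse_eq_divide)
            qed
            then have "2 * pi * cmod (?S t) \<le> 1 / y"
              by (rule power2_le_imp_le) (use y in simp)
            then have "(2 * pi * cmod (?S t)) * (2 * pi * cmod (?S t)) \<le> 1 / y * (2 * pi * cmod (?S t))"
              by (intro mult_right_mono) auto
            then show ?thesis unfolding eq by (simp add: mult_ac)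
          qed
          have "(\<integral>t. norm (f t * complex_of_real (inverse ((t - x)\<^sup>2 + y\<^sup>2))) \<partial>lborel)
              \<le> (\<integral>t. 2 * pi / y * (cmod (f t) * cmod (?S t)) \<partial>lborel)"
          proof (rule integral_mono)
            show "norm (f t * complex_of_real (inverse ((t - x)\<^sup>2 + y\<^sup>2))) \<le> 2 * pi / y * (cmod (f t) * cmod (?S t))" for t
            proof -
              have "\<bar>inverse ((t - x)\<^sup>2 + y\<^sup>2)\<bar> = inverse ((t - x)\<^sup>2 + y\<^sup>2)" by simp
              then have "norm (f t * complex_of_real (inverse ((t - x)\<^sup>2 + y\<^sup>2)))
                  = cmod (f t) * inverse ((t - x)\<^sup>2 + y\<^sup>2)"
                by (simp only: norm_mult norm_of_real)
              also have "\<dots> \<le> cmod (f t) * (2 * pi / y * cmod (?S t))"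
                by (intro mult_left_mono inv_le) simp
              also have "\<dots> = 2 * pi / y * (cmod (f t) * cmod (?S t))"
                by (simp only: mult_ac)
              finally show ?thesis .
            qed
          qed (use P(1)[OF y(1)] integral_norm_mult_le(1)[OF f S] in \<open>auto intro!: integrable_norm integrable_mult_right\<close>)
          also have "\<dots> = 2 * pi / y * (\<integral>t. cmod (f t) * cmod (?S t) \<partial>lborel)"
            by (rule integral_mult_right_zero)
          also have "\<dots> \<le> 2 * pi / y * (norm h * norm (kappa (Complex x y)))"
            using integral_norm_mult_le(2)[OF f S] y unfolding h kappa_def by (intro mult_left_mono) auto
          also have "\<dots> = ?C" using y by (simp add: norm_kappa)
          finally have le: "(\<integral>t. norm (f t * complex_of_real (inverse ((t - x)\<^sup>2 + y\<^sup>2))) \<partial>lborel) \<le> ?C" .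
          have nonneg: "0 \<le> (\<integral>t. norm (f t * complex_of_real (inverse ((t - x)\<^sup>2 + y\<^sup>2))) \<partial>lborel)"
            by (intro integral_nonneg_AE AE_I2) simp
          show "norm (\<integral>t. norm (case (x, t) of (x, t) \<Rightarrow> k x t) \<partial>lborel) \<le> norm (indicator {a..b} x *\<^sub>R ?C)"
          proof (cases "x \<in> {a..b}")
            case True
            then have "k x = (\<lambda>t. f t * complex_of_real (inverse ((t - x)\<^sup>2 + y\<^sup>2)))"
              by (simp add: k_def fun_eq_iff)
            moreover have "0 \<le> ?C" using y by simp
            ultimately show ?thesis using True le nonneg
              by (simp only: prod.case indicator_simps scaleR_one real_norm_def abs_of_nonneg)
          qed (simp add: k_def)
        qed
      qed
    qed
    have "(\<integral>t. \<integral>x. k x t \<partial>lborel \<partial>lborel) = (\<integral>x. \<integral>t. k x t \<partial>lborel \<partial>lborel)"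
      using lborel_pair.Fubini_integral[OF k_int] by simp
    also have "\<dots> = 0"
      using P(2)[OF y(1)] by (simp add: k_def)
    also have "(\<lambda>t. \<integral>x. k x t \<partial>lborel) = (\<lambda>t. complex_of_real n *
        (f t * complex_of_real (arctan (n * (b - t)) - arctan (n * (a - t)))))"
    proof
      fix t
      have "(\<integral>x. k x t \<partial>lborel) = (\<integral>x. f t * complex_of_real (indicator {a..b} x *\<^sub>R inverse ((t - x)\<^sup>2 + y\<^sup>2)) \<partial>lborel)"
        unfolding k_def by (intro Bochner_Integration.integral_cong) (auto simp: scaleR_conv_of_real)
      also have "\<dots> = f t * complex_of_real (n * (arctan (n * (b - t)) - arctan (n * (a - t))))"
        unfolding prim[symmetric] by (subst integral_mult_right_zero) (simp only: integral_complex_of_real)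
      finally show "(\<integral>x. k x t \<partial>lborel) = complex_of_real n *
        (f t * complex_of_real (arctan (n * (b - t)) - arctan (n * (a - t))))" by simp
    qed
    finally show ?thesis using n by simp
  qed
  have "(\<integral>x. indicator {a..b} x *\<^sub>R f x \<partial>lborel) = 0" if ab: "a < b" for a b
  proof -
    \<comment> \<open>The majorant 1 / sqrt((t - a)^2 + 1) is written as a multiple of the modulus
      of the Szego kernel at a + i, whose square integrability is already known.\<close>
    define W where "W = (\<lambda>t. pi * (2 + (b - a)) * (2 * pi * cmod (szego (Complex a 1) (complex_of_real t))))"
    let ?w = "\<lambda>n t. arctan (real (Suc n) * (b - t)) - arctan (real (Suc n) * (a - t))"
    have w_le: "\<bar>?w n t\<bar> \<le> W t" for n t
    proof -
      have "inverse (1 + \<bar>t - a\<bar>) \<le> inverse (sqrt ((t - a)\<^sup>2 + 1))"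
      proof (rule le_imp_inverse_le)
        have "(t - a)\<^sup>2 + 1 \<le> (1 + \<bar>t - a\<bar>)\<^sup>2" by (simp add: power2_sum)
        then show "sqrt ((t - a)\<^sup>2 + 1) \<le> 1 + \<bar>t - a\<bar>" by (simp add: real_le_lsqrt)
        show "0 < sqrt ((t - a)\<^sup>2 + 1)" by (simp add: add_nonneg_pos)
      qed
      also have "inverse (sqrt ((t - a)\<^sup>2 + 1)) = 2 * pi * cmod (szego (Complex a 1) (complex_of_real t))"
      proof -
        have "cmod (szego (Complex a 1) (complex_of_real t)) = sqrt (1 / (4 * pi\<^sup>2) * inverse ((t - a)\<^sup>2 + 1))"
          using szego_cmod_square[of "Complex a 1" t] by (simp add: real_sqrt_unique)
        also have "\<dots> = 1 / (2 * pi) * inverse (sqrt ((t - a)\<^sup>2 + 1))"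
        proof -
          have "sqrt (4 * pi\<^sup>2) = 2 * pi"
            by (rule real_sqrt_unique) (auto simp: power_mult_distrib)
          then show ?thesis by (simp only: real_sqrt_mult real_sqrt_inverse real_sqrt_divide real_sqrt_one)
        qed
        finally show ?thesis by simp
      qed
      finally have le: "inverse (1 + \<bar>t - a\<bar>) \<le> 2 * pi * cmod (szego (Complex a 1) (complex_of_real t))" .
      have "\<bar>?w n t\<bar> \<le> pi * (2 + (b - a)) * inverse (1 + \<bar>t - a\<bar>)"
      proof -
        have "?w n t \<le> pi * (2 + (b - a)) / (1 + \<bar>t - a\<bar>)"
          using arctan_difference_bound(2)[of "real (Suc n)" a b t] ab
          by (subst pos_le_divide_eq) auto
        then show ?thesis
          using arctan_difference_bound(1)[of "real (Suc n)" a b t] ab by (simp add: divide_inverse)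
      qed
      also have "\<dots> \<le> W t"
        unfolding W_def using ab by (intro mult_left_mono le) auto
      finally show ?thesis .
    qed
    have "(\<lambda>n. \<integral>t. f t * complex_of_real (?w n t) \<partial>lborel)
        \<longlonglongrightarrow> (\<integral>t. complex_of_real pi * (indicator {a..b} t *\<^sub>R f t) \<partial>lborel)"
    proof (rule integral_dominated_convergence[where w = "\<lambda>t. cmod (f t) * W t"])
      have "(\<lambda>t. cmod (f t) * W t)
          = (\<lambda>t. (pi * (2 + (b - a)) * (2 * pi)) * (cmod (f t) * cmod (szego (Complex a 1) (complex_of_real t))))"
        by (simp only: W_def mult_ac)
      moreover have "integrable lborel (\<lambda>t. (pi * (2 + (b - a)) * (2 * pi)) * (cmod (f t) * cmod (szego (Complex a 1) (complex_of_real t))))"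
        by (intro integrable_mult_right integral_norm_mult_le(1)[OF f] square_integrable_szego) simp
      ultimately show "integrable lborel (\<lambda>t. cmod (f t) * W t)"
        by (simp only:)
      show "AE t in lborel. norm (f t * complex_of_real (?w n t)) \<le> cmod (f t) * W t" for n
        using w_le by (intro AE_I2) (simp only: norm_mult norm_of_real mult_left_mono norm_ge_zero)
      show "AE t in lborel. (\<lambda>n. f t * complex_of_real (?w n t)) \<longlonglongrightarrow> complex_of_real pi * (indicator {a..b} t *\<^sub>R f t)"
        using AE_lborel_singleton[of a] AE_lborel_singleton[of b]
      proof eventually_elim
        case (elim t)
        have pos: "(\<lambda>n. arctan (real (Suc n) * s)) \<longlonglongrightarrow> pi / 2" if "s > 0" for s
          by (intro filterlim_compose[OF tendsto_arctan_at_top]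
              filterlim_at_top_mult_tendsto_pos[OF tendsto_const that]
              filterlim_compose[OF filterlim_real_sequentially filterlim_Suc])
        have neg: "(\<lambda>n. arctan (real (Suc n) * s)) \<longlonglongrightarrow> - (pi / 2)" if "s < 0" for s
          using tendsto_minus[OF pos[of "- s"]] that by (simp only: mult_minus_right arctan_minus) simp
        have "(\<lambda>n. ?w n t) \<longlonglongrightarrow> pi * indicator {a..b} t"
        proof -
          consider "t < a" | "a < t" "t < b" | "b < t" using elim by linarith
          then show ?thesis
          proof cases
            case 1
            then show ?thesis using tendsto_diff[OF pos[of "b - t"] pos[of "a - t"]] ab by simp
          next
            case 2
            then show ?thesis using tendsto_diff[OF pos[of "b - t"] neg[of "a - t"]] by simp
          next
            case 3
            then show ?thesis using tendsto_diff[OF neg[of "b - t"] neg[of "a - t"]] ab by simp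
          qed
        qed
        then have "(\<lambda>n. f t * complex_of_real (?w n t)) \<longlonglongrightarrow> f t * complex_of_real (pi * indicator {a..b} t)"
          by (intro tendsto_intros)
        moreover have "f t * complex_of_real (pi * indicator {a..b} t) = complex_of_real pi * (indicator {a..b} t *\<^sub>R f t)"
          by (simp add: indicator_def)
        ultimately show ?case by (simp only:)
      qed
    qed simp_all
    moreover have "(\<integral>t. f t * complex_of_real (?w n t) \<partial>lborel) = 0" for n
      by (rule arctan_zero[OF _ ab]) simp
    ultimately have "(\<lambda>n::nat. 0::complex) \<longlonglongrightarrow> (\<integral>t. complex_of_real pi * (indicator {a..b} t *\<^sub>R f t) \<partial>lborel)"
      by (simp only:)
    from LIMSEQ_unique[OF tendsto_const this]
    have "complex_of_real pi * (\<integral>t. indicator {a..b} t *\<^sub>R f t \<partial>lborel) = 0"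
      by (simp only: integral_mult_right_zero)
    then show ?thesis by simp
  qed
  then have "AE x in lborel. f x = 0"
    by (intro AE_zero_of_interval_integrals[OF f open_UNIV]) auto
  then show ?thesis
    unfolding h zero_L2_def by (intro abs_L2_eqI f square_integrable_zero)
qed

section \<open>The projection onto the Hardy space\<close>

text \<open>The boundary function of a finite kernel combination after translation by
  \<open>y\<close>, that is, the slice of the rational function \<open>kfun xs\<close> at height
  \<open>y\<close>. Lists admit repeated poles, so sums become concatenations.\<close>

definition ksum :: "(complex \<times> complex) list \<Rightarrow> real \<Rightarrow> L2" where
  "ksum xs y = (\<Sum>(c, w)\<leftarrow>xs. cscale_L2 c (kappa (w + \<i> * complex_of_real y)))"

definition kfun :: "(complex \<times> complex) list \<Rightarrow> complex \<Rightarrow> complex" where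
  "kfun xs z = (\<Sum>(c, w)\<leftarrow>xs. c * szego w z)"

definition kpoles :: "(complex \<times> complex) list \<Rightarrow> bool" where
  "kpoles xs \<longleftrightarrow> (\<forall>(c, w)\<in>set xs. 0 < Im w)"

lemma ksum_simps [simp]:
  "ksum [] y = 0" "ksum ((c, w) # xs) y = cscale_L2 c (kappa (w + \<i> * complex_of_real y)) + ksum xs y"
  by (simp_all add: ksum_def)

lemma kfun_simps [simp]: "kfun [] z = 0" "kfun ((c, w) # xs) z = c * szego w z + kfun xs z"
  by (simp_all add: kfun_def)

lemma kpoles_simps [simp]: "kpoles []" "kpoles ((c, w) # xs) \<longleftrightarrow> 0 < Im w \<and> kpoles xs"
  by (simp_all add: kpoles_def)

lemma kfun_slice:
  assumes "kpoles xs" "0 \<le> y"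
  shows "square_integrable (\<lambda>x. kfun xs (Complex x y)) \<and> abs_L2 (\<lambda>x. kfun xs (Complex x y)) = ksum xs y"
  using assms(1)
proof (induction xs)
  case (Cons cw xs)
  obtain c w where cw: "cw = (c, w)" by fastforce
  have w: "0 < Im (w + \<i> * complex_of_real y)" using Cons.prems assms(2) by (simp add: cw)
  note si = square_integrable_szego[OF w] square_integrable_scale[OF square_integrable_szego[OF w], of c]
  show ?case
    using Cons si by (simp add: cw szego_Complex square_integrable_add plus_abs_L2[symmetric]
        cscale_abs_L2[symmetric] kappa_def)
qed (simp add: square_integrable_zero zero_L2_def)

lemma cinner_ksum_kappa:
  assumes "kpoles xs" "0 \<le> y" "Im z > 0"
  shows "cinner_L2 (ksum xs y) (kappa z) = kfun xs (z + \<i> * complex_of_real y)"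
  using assms(1)
proof (induction xs)
  case (Cons cw xs)
  obtain c w where cw: "cw = (c, w)" by fastforce
  have "cinner_L2 (kappa (w + \<i> * complex_of_real y)) (kappa z) = szego w (z + \<i> * complex_of_real y)"
    using Cons.prems assms by (subst cinner_kappa) (auto simp: cw szego_def algebra_simps)
  then show ?case using Cons by (simp add: cw cinner_add_left cinner_scale_left)
qed simp

text \<open>\<open>szego w z\<close> depends only on \<open>z - cnj w\<close>, so translating either
  argument of the inner product upwards has the same effect: the translations are symmetric
  operators.\<close>

lemma cinner_ksum_ksum:
  assumes "kpoles xs" "kpoles zs" "0 \<le> y" "0 \<le> y'"
  shows "cinner_L2 (ksum xs y) (ksum zs y') = cinner_L2 (ksum xs (y + y')) (ksum zs 0)"
proof -
  have single: "cinner_L2 (kappa z) (ksum zs y') = cinner_L2 (kappa (z + \<i> * complex_of_real y')) (ksum zs 0)"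
    if z: "0 < Im z" for z
    using assms(2)
  proof (induction zs)
    case (Cons cw zs)
    obtain c w where cw: "cw = (c, w)" by fastforce
    have "cinner_L2 (kappa z) (kappa (w + \<i> * complex_of_real y'))
        = cinner_L2 (kappa (z + \<i> * complex_of_real y')) (kappa w)"
      using Cons.prems z assms by (subst (1 2) cinner_kappa) (auto simp: cw szego_def algebra_simps)
    then show ?case using Cons by (simp add: cw cinner_add_right cinner_scale_right)
  qed simp
  from assms(1) show ?thesis
  proof (induction xs)
    case (Cons cw xs)
    obtain c w where cw: "cw = (c, w)" by fastforce
    have "cinner_L2 (kappa (w + \<i> * complex_of_real y)) (ksum zs y')
        = cinner_L2 (kappa (w + \<i> * complex_of_real (y + y'))) (ksum zs 0)"
      using single[of "w + \<i> * complex_of_real y"] Cons.prems assms(3)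
      by (simp add: cw algebra_simps)
    then show ?case using Cons by (simp add: cw cinner_add_left cinner_scale_left)
  qed simp
qed

text \<open>The translation semigroup is symmetric, so \<open>\<parallel>K\<^sub>y u\<parallel>\<^sup>2 = \<langle>K\<^sub>2\<^sub>y u, u\<rangle>\<close>; a bounded
  symmetric semigroup is therefore contractive.\<close>

lemma norm_ksum_le:
  assumes xs: "kpoles xs" and y: "0 \<le> y"
  shows "norm (ksum xs y) \<le> norm (ksum xs 0)"
proof -
  define M where "M = (\<Sum>(c, w)\<leftarrow>xs. cmod c * norm (kappa w))"
  have M: "norm (ksum xs y) \<le> M" if "0 \<le> y" for y
    using xs unfolding M_def
  proof (induction xs)
    case (Cons cw xs)
    obtain c w where cw: "cw = (c, w)" by fastforce
    have "norm (ksum (cw # xs) y) \<le> norm (cscale_L2 c (kappa (w + \<i> * complex_of_real y))) + norm (ksum xs y)"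
      by (simp add: cw norm_triangle_ineq)
    also have "\<dots> \<le> cmod c * norm (kappa w) + (\<Sum>(c, w)\<leftarrow>xs. cmod c * norm (kappa w))"
      using Cons that by (intro add_mono) (auto simp: cw norm_cscale intro!: mult_left_mono norm_kappa_shift_le)
    finally show ?case by (simp add: cw)
  qed simp
  \<comment> \<open>The crude bound \<open>M\<close> serves only to make this supremum finite;
    otherwise the inequality between \<open>s\<close> squared and
    \<open>s * norm (ksum xs 0)\<close> could not be divided by \<open>s\<close>.\<close>
  define s where "s = (SUP y\<in>{0..}. norm (ksum xs y))"
  have bdd: "bdd_above ((\<lambda>y. norm (ksum xs y)) ` {0..})"
    using M by (intro bdd_aboveI[of _ M]) auto
  have s: "norm (ksum xs y) \<le> s" if "0 \<le> y" for y
    unfolding s_def using bdd that by (intro cSUP_upper) auto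
  have "0 \<le> s" using s[of 0] norm_ge_zero order_trans by (metis order_refl)
  have "norm (ksum xs y) \<le> sqrt (s * norm (ksum xs 0))" if "0 \<le> y" for y
  proof (rule real_le_rsqrt)
    have "(norm (ksum xs y))\<^sup>2 = cmod (cinner_L2 (ksum xs y) (ksum xs y))"
      unfolding cinner_self_square norm_of_real by simp
    also have "\<dots> \<le> norm (ksum xs (y + y)) * norm (ksum xs 0)"
      unfolding cinner_ksum_ksum[OF xs xs that that] by (rule norm_cinner_le)
    also have "\<dots> \<le> s * norm (ksum xs 0)"
      using s[of "y + y"] that by (intro mult_right_mono) auto
    finally show "(norm (ksum xs y))\<^sup>2 \<le> s * norm (ksum xs 0)" .
  qed
  then have "s \<le> sqrt (s * norm (ksum xs 0))"
    unfolding s_def by (intro cSUP_least) auto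
  then have "s\<^sup>2 \<le> s * norm (ksum xs 0)"
    using \<open>0 \<le> s\<close> by (metis norm_ge_zero mult_nonneg_nonneg power_mono real_sqrt_pow2)
  then have "s \<le> norm (ksum xs 0)"
    using \<open>0 \<le> s\<close> by (cases "s = 0") (auto simp: power2_eq_square)
  with s[OF y] show ?thesis by linarith
qed

lemma tendsto_ksum:
  assumes "kpoles xs"
  shows "((\<lambda>y. ksum xs y) \<longlongrightarrow> ksum xs 0) (at_right 0)"
  using assms
proof (induction xs)
  case (Cons cw xs)
  obtain c w where cw: "cw = (c, w)" by fastforce
  show ?case using Cons
    by (auto simp: cw intro!: tendsto_add bounded_linear.tendsto[OF bounded_linear_cscale] tendsto_kappa_shift)
next
  case Nil
  have "ksum [] = (\<lambda>_. 0)" by (simp add: fun_eq_iff)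
  then show ?case by simp
qed

lemma kfun_holomorphic:
  "(\<And>c w z. (c, w) \<in> set xs \<Longrightarrow> z \<in> S \<Longrightarrow> z \<noteq> cnj w) \<Longrightarrow> kfun xs holomorphic_on S"
proof (induction xs)
  case Nil
  have "kfun [] = (\<lambda>z. 0)" by (simp add: fun_eq_iff)
  then show ?case by simp
next
  case (Cons cw xs)
  obtain c w where cw: "cw = (c, w)" by fastforce
  have "kfun (cw # xs) = (\<lambda>z. c * szego w z + kfun xs z)" by (simp add: cw fun_eq_iff)
  moreover have "szego w holomorphic_on S"
    unfolding szego_def using Cons.prems[of c w] by (intro holomorphic_intros) (auto simp: cw)
  moreover have "kfun xs holomorphic_on S"
    using Cons.prems by (intro Cons.IH) auto
  ultimately show ?case by (auto intro!: holomorphic_intros)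
qed

section \<open>The Hardy space as the closed span of the Cauchy kernels\<close>

definition kspan :: "L2 set" where
  "kspan = {ksum xs 0 |xs. kpoles xs}"

lemma complex_subspace_kspan: "complex_subspace kspan"
proof -
  have 1: "ksum (xs @ zs) 0 = ksum xs 0 + ksum zs 0" for xs zs
    by (induction xs) (auto simp: add.assoc)
  have 2: "ksum (map (\<lambda>(d, w). (c * d, w)) xs) 0 = cscale_L2 c (ksum xs 0)" for c xs
    by (induction xs) (auto simp: cscale_add_right cscale_cscale linear_0[OF bounded_linear.linear[OF bounded_linear_cscale]])
  have 3: "kpoles (xs @ zs) \<longleftrightarrow> kpoles xs \<and> kpoles zs" "kpoles (map (\<lambda>(d, w). (c * d, w)) xs) \<longleftrightarrow> kpoles xs"
    for c xs zs
    by (auto simp: kpoles_def)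
  have "ksum [] 0 \<in> kspan" unfolding kspan_def using kpoles_simps(1) by blast
  moreover have "ksum xs 0 + ksum zs 0 \<in> kspan" if "kpoles xs" "kpoles zs" for xs zs
    unfolding kspan_def 1[symmetric] using 3 that by blast
  moreover have "cscale_L2 c (ksum xs 0) \<in> kspan" if "kpoles xs" for c xs
    unfolding kspan_def 2[symmetric] using 3 that by blast
  ultimately show ?thesis
    unfolding complex_subspace_def by (auto simp: kspan_def)
qed

lemma complex_subspace_closure:
  assumes "complex_subspace S"
  shows "complex_subspace (closure S)"
  unfolding complex_subspace_def
proof (intro conjI ballI allI)
  show "0 \<in> closure S"
    using assms closure_subset by (auto simp: complex_subspace_def)
next
  fix f g assume "f \<in> closure S" "g \<in> closure S"
  then obtain u v where "\<And>n. u n \<in> S" "u \<longlonglongrightarrow> f" "\<And>n. v n \<in> S" "v \<longlonglongrightarrow> g"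
    unfolding closure_sequential by metis
  then show "f + g \<in> closure S"
    using assms unfolding closure_sequential complex_subspace_def
    by (intro exI[of _ "\<lambda>n. u n + v n"]) (auto intro: tendsto_add)
next
  fix c f assume "f \<in> closure S"
  then obtain u where "\<And>n. u n \<in> S" "u \<longlonglongrightarrow> f"
    unfolding closure_sequential by metis
  then show "cscale_L2 c f \<in> closure S"
    using assms unfolding closure_sequential complex_subspace_def
    by (intro exI[of _ "\<lambda>n. cscale_L2 c (u n)"])
       (auto intro: bounded_linear.tendsto[OF bounded_linear_cscale])
qed

text \<open>The reproducing property. Its right side is meaningful for every element of
  \<open>L2\<close>, and so supplies the holomorphic extension of limits of kernel sums.\<close>

lemma kfun_eq_cinner:
  "kpoles xs \<Longrightarrow> Im z > 0 \<Longrightarrow> kfun xs z = cinner_L2 (ksum xs 0) (kappa z)"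
  using cinner_ksum_kappa[of xs 0 z] by simp

text \<open>The slices of the approximating kernel sums converge pointwise, and the contractivity of
  translations on kernel sums passes to the limit by Fatou's lemma.\<close>

lemma closure_kspan_slice:
  assumes h: "h \<in> closure kspan" and y: "0 < y"
  shows "square_integrable (\<lambda>x. cinner_L2 h (kappa (Complex x y)))"
    and "norm (abs_L2 (\<lambda>x. cinner_L2 h (kappa (Complex x y)))) \<le> norm h"
proof -
  obtain u where u: "\<And>n. u n \<in> kspan" "u \<longlonglongrightarrow> h"
    using h unfolding closure_sequential by metis
  then obtain xs where xs: "\<And>n. kpoles (xs n)" "\<And>n. u n = ksum (xs n) 0"
    unfolding kspan_def mem_Collect_eq by metis
  let ?v = "\<lambda>n x. kfun (xs n) (Complex x y)" and ?g = "\<lambda>x. cinner_L2 h (kappa (Complex x y))"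
  have v_eq: "?v n x = cinner_L2 (u n) (kappa (Complex x y))" for n x
    using kfun_eq_cinner[OF xs(1), of "Complex x y"] y by (simp add: xs(2))
  have v: "square_integrable (?v n)" "norm (abs_L2 (?v n)) \<le> norm (u n)" for n
    using kfun_slice[OF xs(1), of y n] norm_ksum_le[OF xs(1), of y n] y by (auto simp: xs(2))
  have lim: "(\<lambda>n. ?v n x) \<longlonglongrightarrow> ?g x" for x
    unfolding v_eq by (intro tendsto_cinner_left u)
  have meas: "?g \<in> borel_measurable lborel"
    by (rule borel_measurable_LIMSEQ_metric[OF _ lim])
       (use v(1) in \<open>auto simp: square_integrable_def\<close>)
  \<comment> \<open>Fatou's lemma needs one bound for all indices; \<open>norm h + e\<close> is such
    a bound only for a tail of the sequence, hence the shift by \<open>N\<close>.\<close>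
  have *: "square_integrable ?g \<and> norm (abs_L2 ?g) \<le> norm h + e" if "e > 0" for e
  proof -
    have "(\<lambda>n. norm (u n)) \<longlonglongrightarrow> norm h" by (intro tendsto_norm u)
    then have "\<forall>\<^sub>F n in sequentially. norm (u n) < norm h + e"
      using that by (intro order_tendstoD) auto
    then obtain N where N: "\<And>n. n \<ge> N \<Longrightarrow> norm (u n) < norm h + e"
      by (auto simp: eventually_sequentially)
    have 1: "square_integrable (?v (n + N))" for n by (rule v)
    have 2: "AE x in lborel. (\<lambda>n. ?v (n + N) x) \<longlonglongrightarrow> ?g x"
      using LIMSEQ_ignore_initial_segment[OF lim] by (intro AE_I2)
    have 3: "norm (abs_L2 (?v (n + N))) \<le> norm h + e" for n
      using v(2)[of "n + N"] N[of "n + N"] by linarith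
    show ?thesis using square_integrable_Fatou[OF 1 meas 2 3] by simp
  qed
  from *[of 1] show "square_integrable ?g" by simp
  show "norm (abs_L2 ?g) \<le> norm h"
    by (rule field_le_epsilon) (use * in simp)
qed

text \<open>Convergence in norm is locally uniform convergence of the extensions, because the norm
  of \<open>kappa w\<close> stays bounded while \<open>Im w\<close> stays away from 0.\<close>

lemma closure_kspan_holomorphic:
  assumes h: "h \<in> closure kspan"
  shows "(\<lambda>z. cinner_L2 h (kappa z)) holomorphic_on {z. 0 < Im z}"
proof -
  obtain u where u: "\<And>n. u n \<in> kspan" "u \<longlonglongrightarrow> h"
    using h unfolding closure_sequential by metis
  then obtain xs where xs: "\<And>n. kpoles (xs n)" "\<And>n. u n = ksum (xs n) 0"
    unfolding kspan_def mem_Collect_eq by metis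
  show ?thesis
  proof (rule holomorphic_uniform_sequence)
    show "open {z. 0 < Im z}" by (rule open_halfspace_Im_gt)
    show "kfun (xs n) holomorphic_on {z. 0 < Im z}" for n
      using xs(1)[of n] by (intro kfun_holomorphic) (fastforce simp: kpoles_def)
    fix z assume "z \<in> {z. 0 < Im z}"
    then have z: "0 < Im z" by simp
    have Im_le: "Im z / 2 \<le> Im w" if "w \<in> cball z (Im z / 2)" for w
      using that abs_Im_le_cmod[of "z - w"] by (simp add: dist_norm)
    have "uniform_limit (cball z (Im z / 2)) (\<lambda>n. kfun (xs n)) (\<lambda>z. cinner_L2 h (kappa z)) sequentially"
    proof (rule uniform_limitI)
      fix e :: real assume "0 < e"
      define C where "C = sqrt (1 / (4 * pi * (Im z / 2)))"
      have "C > 0" using z by (simp add: C_def)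
      then have "\<forall>\<^sub>F n in sequentially. dist (u n) h < e / C"
        using u(2) \<open>0 < e\<close> by (intro tendstoD) auto
      then show "\<forall>\<^sub>F n in sequentially. \<forall>w\<in>cball z (Im z / 2). dist (kfun (xs n) w) (cinner_L2 h (kappa w)) < e"
      proof eventually_elim
        case (elim n)
        show ?case
        proof
          fix w assume "w \<in> cball z (Im z / 2)"
          then have w: "Im z / 2 \<le> Im w" by (rule Im_le)
          then have w0: "0 < Im w" using z by linarith
          have "dist (kfun (xs n) w) (cinner_L2 h (kappa w)) = cmod (cinner_L2 (u n - h) (kappa w))"
            using kfun_eq_cinner[OF xs(1) w0] by (simp add: dist_norm xs(2) cinner_diff_left)
          also have "\<dots> \<le> norm (u n - h) * norm (kappa w)" by (rule norm_cinner_le)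
          also have "\<dots> \<le> norm (u n - h) * C"
            unfolding C_def norm_kappa[OF w0] using w z
            by (intro mult_left_mono real_sqrt_le_mono divide_left_mono mult_pos_pos) auto
          also have "\<dots> < e"
            using elim \<open>C > 0\<close> by (simp add: dist_norm pos_less_divide_eq)
          finally show "dist (kfun (xs n) w) (cinner_L2 h (kappa w)) < e" .
        qed
      qed
    qed
    moreover have "cball z (Im z / 2) \<subseteq> {z. 0 < Im z}"
      using Im_le z by fastforce
    ultimately show "\<exists>d>0. cball z d \<subseteq> {z. 0 < Im z} \<and>
        uniform_limit (cball z d) (\<lambda>n. kfun (xs n)) (\<lambda>z. cinner_L2 h (kappa z)) sequentially"
      using z by (intro exI[of _ "Im z / 2"]) simp
  qed
qed

text \<open>Convergence of slices to the boundary function is known for kernel sums. Since taking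
  slices does not increase the norm, an approximation by a kernel sum carries it over to the
  closure.\<close>

lemma closure_kspan_subset_H2: "closure kspan \<subseteq> H2"
proof
  fix h assume h: "h \<in> closure kspan"
  let ?S = "\<lambda>h y. abs_L2 (\<lambda>x. cinner_L2 h (kappa (Complex x y)))"
  note closed = complex_subspace_closure[OF complex_subspace_kspan]
  have lim: "((\<lambda>y. ?S h y) \<longlongrightarrow> h) (at_right 0)"
  proof (rule tendstoI)
    fix e :: real assume "0 < e"
    obtain g where g: "g \<in> kspan" "dist g h < e / 3"
      using h \<open>0 < e\<close> unfolding closure_approachable by (meson divide_pos_pos zero_less_numeral)
    then obtain xs where xs: "kpoles xs" "g = ksum xs 0" by (auto simp: kspan_def)
    have g': "g \<in> closure kspan" using g closure_subset by blast
    have "\<forall>\<^sub>F y in at_right 0. dist (ksum xs y) g < e / 3"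
      using tendsto_ksum[OF xs(1)] \<open>0 < e\<close> unfolding xs(2) by (intro tendstoD) auto
    moreover have "\<forall>\<^sub>F y in at_right (0::real). 0 < y" by (rule eventually_at_right_less)
    ultimately show "\<forall>\<^sub>F y in at_right 0. dist (?S h y) h < e"
    proof eventually_elim
      case (elim y)
      have "(\<lambda>x. cinner_L2 g (kappa (Complex x y))) = (\<lambda>x. kfun xs (Complex x y))"
        using kfun_eq_cinner[OF xs(1)] elim by (simp add: xs(2))
      then have Sg: "?S g y = ksum xs y" using kfun_slice[OF xs(1), of y] elim by simp
      have "?S h y - ?S g y = ?S (h - g) y"
        by (simp add: minus_abs_L2 closure_kspan_slice(1)[OF h elim(2)] closure_kspan_slice(1)[OF g' elim(2)]
            cinner_diff_left)
      then have "norm (?S h y - ?S g y) \<le> norm (h - g)"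
        using closure_kspan_slice(2)[OF complex_subspace_diff[OF closed h g'] elim(2)] by simp
      then have "dist (?S h y) (ksum xs y) < e / 3"
        using g(2) by (simp add: Sg dist_norm norm_minus_commute)
      then show ?case
        using elim(1) g(2) dist_triangle[of "?S h y" h "ksum xs y"] dist_triangle[of "ksum xs y" h g]
        by linarith
    qed
  qed
  show "h \<in> H2"
    by (rule H2I[OF closure_kspan_holomorphic[OF h] closure_kspan_slice[OF h] lim])
qed

lemma kappa_in_kspan: "Im w > 0 \<Longrightarrow> kappa w \<in> kspan"
  unfolding kspan_def by (intro CollectI exI[of _ "[(1, w)]"]) simp

text \<open>This shows that \<open>H2\<close> is a closed complex subspace. The difference between h
  and its projection onto the closed span is orthogonal to the kernels by construction, and to their
  conjugates because both terms lie in \<open>H2\<close>; completeness makes it zero.\<close>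

lemma H2_eq_closure_kspan: "H2 = closure kspan"
proof
  show "closure kspan \<subseteq> H2" by (rule closure_kspan_subset_H2)
  show "H2 \<subseteq> closure kspan"
  proof
    fix h assume h: "h \<in> H2"
    obtain k where k: "k \<in> closure kspan" "\<And>s. s \<in> closure kspan \<Longrightarrow> cinner_L2 (h - k) s = 0"
      using complex_orthogonal_projection_exists[OF closed_closure complex_subspace_closure[OF complex_subspace_kspan]]
      by metis
    have "h - k = 0"
    proof (rule kappa_conj_kappa_complete)
      fix z :: complex assume z: "Im z > 0"
      show "cinner_L2 (h - k) (kappa z) = 0"
        using k(2) kappa_in_kspan[OF z] closure_subset by blast
      show "cinner_L2 (h - k) (conj_L2 (kappa z)) = 0"
        using H2_orthogonal_conj_kappa[OF h z] H2_orthogonal_conj_kappa[OF _ z, of k] k(1)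
          closure_kspan_subset_H2 by (auto simp: cinner_diff_left)
    qed
    then show "h \<in> closure kspan" using k(1) by simp
  qed
qed

section \<open>The Szego projection and its behaviour under conjugation\<close>

definition szego_projection :: "L2 \<Rightarrow>\<^sub>L L2" where
  "szego_projection = projection_onto H2"

lemma szego_projection: "szego_projection \<in> projections" "range (blinfun_apply szego_projection) = H2"
proof -
  obtain P where P: "P \<in> projections" "range (blinfun_apply P) = H2"
    using closed_complex_subspace_projection[OF closed_closure complex_subspace_closure[OF complex_subspace_kspan]]
    unfolding H2_eq_closure_kspan by metis
  then have "szego_projection = P"
    unfolding szego_projection_def by (rule projection_onto_eqI)
  with P show "szego_projection \<in> projections" "range (blinfun_apply szego_projection) = H2" by auto
qed

text \<open>The squared norm of the projected vector is its inner product with \<open>u\<close>, and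
  it is a limit of kernel sums. So the estimate may be tested on functions that are holomorphic
  across the real line.\<close>

lemma norm_szego_projection_le:
  assumes bound: "\<And>xs. kpoles xs \<Longrightarrow> cmod (cinner_L2 (ksum xs 0) u) \<le> C * norm (ksum xs 0)"
  shows "norm (szego_projection u) \<le> C"
proof -
  let ?p = "szego_projection u"
  have "?p \<in> closure kspan"
    using szego_projection(2) H2_eq_closure_kspan by blast
  then obtain v where v: "\<And>n. v n \<in> kspan" "v \<longlonglongrightarrow> ?p"
    unfolding closure_sequential by metis
  have "cmod (cinner_L2 ?p u) \<le> C * norm ?p"
  proof (rule LIMSEQ_le)
    show "(\<lambda>n. cmod (cinner_L2 (v n) u)) \<longlonglongrightarrow> cmod (cinner_L2 ?p u)"
      by (intro tendsto_norm tendsto_cinner_left v)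
    show "(\<lambda>n. C * norm (v n)) \<longlonglongrightarrow> C * norm ?p"
      by (intro tendsto_intros v)
    show "\<exists>N. \<forall>n\<ge>N. cmod (cinner_L2 (v n) u) \<le> C * norm (v n)"
      using v(1) bound unfolding kspan_def mem_Collect_eq by metis
  qed
  moreover have "cinner_L2 ?p u = complex_of_real ((norm ?p)\<^sup>2)"
    by (metis cinner_self_square projections_adjoint projections_idem szego_projection(1))
  ultimately have "(norm ?p)\<^sup>2 \<le> C * norm ?p"
    by (simp only: norm_of_real abs_power2)
  \<comment> \<open>The case of a vanishing projection still requires a nonnegative constant; the
    hypothesis for the single kernel at \<i>, which has positive norm, provides it.\<close>
  moreover have "0 \<le> C"
    using bound[of "[(1, \<i>)]"] norm_kappa[of \<i>]
    by (simp add: pos_divide_le_eq) (smt (verit) norm_ge_zero mult_neg_pos real_sqrt_gt_zero pi_gt_zero zero_less_divide_1_iff)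
  ultimately show ?thesis
    by (cases "?p = 0") (auto simp: power2_eq_square)
qed

lemma H2_orthogonal_conj_H2:
  assumes h: "h \<in> H2" and g: "g \<in> H2"
  shows "cinner_L2 h (conj_L2 g) = 0"
proof -
  obtain v where v: "\<And>n. v n \<in> kspan" "v \<longlonglongrightarrow> g"
    using g unfolding H2_eq_closure_kspan closure_sequential by metis
  have "cinner_L2 h (conj_L2 (ksum xs 0)) = 0" if "kpoles xs" for xs
    using that
    by (induction xs)
       (auto simp: conj_add conj_cscale cinner_add_right cinner_scale_right H2_orthogonal_conj_kappa[OF h]
          linear_0[OF bounded_linear.linear[OF bounded_linear_conj_L2]])
  then have "cinner_L2 h (conj_L2 (v n)) = 0" for n
    using v(1)[of n] by (auto simp: kspan_def)
  then have "(\<lambda>n. cinner_L2 h (conj_L2 (v n))) \<longlonglongrightarrow> 0" by simp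
  moreover have "(\<lambda>n. cinner_L2 h (conj_L2 (v n))) \<longlonglongrightarrow> cinner_L2 h (conj_L2 g)"
    by (intro bounded_bilinear.tendsto[OF bounded_bilinear_cinner] tendsto_const
        bounded_linear.tendsto[OF bounded_linear_conj_L2] v)
  ultimately show ?thesis using LIMSEQ_unique by blast
qed

text \<open>Conjugation exchanges \<open>H2\<close> and its orthogonal complement. Every estimate
  for the projection thereby becomes one for its complement, which is how phases with negative slope
  are treated.\<close>

lemma szego_projection_conj: "conj_L2 (u - szego_projection u) = szego_projection (conj_L2 u)"
proof -
  let ?P = "blinfun_apply szego_projection"
  have PH2: "?P v \<in> H2" for v using szego_projection(2) by blast
  have orth: "cinner_L2 (v - ?P v) s = 0" if "s \<in> H2" for v s
  proof -
    have "?P s = s" using projections_fixed[OF szego_projection(1)] that szego_projection(2) by blast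
    then show ?thesis
      using projections_adjoint[OF szego_projection(1), of v s] by (simp add: cinner_diff_left)
  qed
  have "conj_L2 (u - ?P u) - ?P (conj_L2 u) = 0"
  proof (rule kappa_conj_kappa_complete)
    fix z :: complex assume z: "Im z > 0"
    have kz: "kappa z \<in> H2" by (rule kappa_in_H2[OF z])
    have "conj_L2 (u - ?P u) - ?P (conj_L2 u) = (conj_L2 u - ?P (conj_L2 u)) - conj_L2 (?P u)"
      by (simp add: linear_diff[OF bounded_linear.linear[OF bounded_linear_conj_L2]])
    then show "cinner_L2 (conj_L2 (u - ?P u) - ?P (conj_L2 u)) (kappa z) = 0"
      using orth[OF kz, of "conj_L2 u"] H2_orthogonal_conj_H2[OF PH2 kz, of u]
      by (simp add: cinner_diff_left cinner_conj_left)
    show "cinner_L2 (conj_L2 (u - ?P u) - ?P (conj_L2 u)) (conj_L2 (kappa z)) = 0"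
      using orth[OF kz, of u] H2_orthogonal_conj_H2[OF PH2 kz, of "conj_L2 u"]
      by (simp add: cinner_diff_left cinner_conj_conj)
  qed
  then show ?thesis by simp
qed

section \<open>Oscillatory integrals\<close>

lemma square_integrable_indicator_unimodular:
  assumes "continuous_on {a..b::real} u" "\<And>x. x \<in> {a..b} \<Longrightarrow> cmod (u x) = 1"
  shows "square_integrable (\<lambda>x. indicator {a..b} x *\<^sub>R u x)"
  unfolding square_integrable_def
proof
  show "(\<lambda>x. indicator {a..b} x *\<^sub>R u x) \<in> borel_measurable lborel"
    using borel_measurable_continuous_on_indicator[OF _ assms(1)] by simp
  have "(\<lambda>x. (cmod (indicator {a..b} x *\<^sub>R u x))\<^sup>2) = (\<lambda>x. (cmod (indicator {a..b} x))\<^sup>2)"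
    using assms(2) by (auto simp: indicator_def fun_eq_iff)
  then show "integrable lborel (\<lambda>x. (cmod (indicator {a..b} x *\<^sub>R u x))\<^sup>2)"
    using square_integrable_indicator[of a b] by (simp only: square_integrable_def)
qed

text \<open>The integrand is extended to the upper half plane by \<open>e\<^sup>i\<^sup>\<phi> \<mapsto> exp (i \<phi> - y \<phi>')\<close>, which is
  holomorphic up to the error \<open>y \<phi>''\<close> and decays as \<open>exp (- m y)\<close>.\<close>

lemma cinner_ksum_oscillation:
  fixes p p' p'' :: "real \<Rightarrow> real"
  assumes ab: "a < b" and m: "0 < m" and R: "0 \<le> R" and xs: "kpoles xs"
    and p: "\<And>x. x \<in> {a..b} \<Longrightarrow> (p has_real_derivative p' x) (at x within {a..b})"
    and p': "\<And>x. x \<in> {a..b} \<Longrightarrow> (p' has_real_derivative p'' x) (at x within {a..b})"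
    and cont: "continuous_on {a..b} p''"
    and lower: "\<And>x. x \<in> {a..b} \<Longrightarrow> m \<le> p' x"
    and upper: "\<And>x. x \<in> {a..b} \<Longrightarrow> \<bar>p'' x\<bar> \<le> R * m"
  shows "cmod (cinner_L2 (ksum xs 0) (abs_L2 (\<lambda>x. indicator {a..b} x *\<^sub>R exp (- (\<i> * complex_of_real (p x))))))
    \<le> ((b - a) + pi * (2 + 2 * R * (b - a))) / sqrt m * norm (ksum xs 0)"
proof -
  define N where "N = norm (ksum xs 0)"
  define F where "F = kfun xs"
  \<comment> \<open>First-order Taylor expansion of the phase in the imaginary direction: \<i> p(x +
    \<i> y) is replaced by \<i> p(x) - y p'(x). One differentiation of \<open>G\<close> then
    involves p'' and no higher derivative.\<close>
  define G where "G = (\<lambda>x y. exp (\<i> * complex_of_real (p x) - complex_of_real y * complex_of_real (p' x)))"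
  define Gx where "Gx = (\<lambda>x y. (\<i> * complex_of_real (p' x) - complex_of_real y * complex_of_real (p'' x)) * G x y)"
  define Gy where "Gy = (\<lambda>x y. - complex_of_real (p' x) * G x y)"
  define J where "J = (\<lambda>y. integral {a..b} (\<lambda>x. F (Complex x y) * G x y))"
  define J' where "J' = (\<lambda>y. \<i> * (F (Complex b y) * G b y - F (Complex a y) * G a y)
        + integral {a..b} (\<lambda>x. F (Complex x y) * (Gy x y - \<i> * Gx x y)))"
  define K where "K = N * (2 + 2 * R * (b - a))"
  have contp: "continuous_on {a..b} p" "continuous_on {a..b} p'"
    using DERIV_continuous_on[OF p] DERIV_continuous_on[OF p'] by blast+
  \<comment> \<open>The complement of the poles is open and contains the closed upper half plane, so
    Stokes' theorem can be used on heights in [0, 1] with 0 included.\<close>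
  define S where "S = - ((\<lambda>(c, w). cnj w) ` set xs)"
  have S: "Complex x y \<in> S" if "0 \<le> y" for x y
    using xs that by (auto simp: S_def kpoles_def complex_eq_iff)
  have F_hol: "F holomorphic_on S"
    unfolding F_def S_def by (rule kfun_holomorphic) force
  have "open S" unfolding S_def by (intro open_Compl finite_imp_closed) simp
  have pair: "continuous_on ({0..1} \<times> {a..b}) (\<lambda>z. q (snd z))" if "continuous_on {a..b} q" for q :: "real \<Rightarrow> real"
    by (rule continuous_on_compose2[OF that continuous_on_snd[OF continuous_on_id]]) auto
  have contG: "continuous_on ({0..1} \<times> {a..b}) (\<lambda>(y, x). G x y)"
    "continuous_on ({0..1} \<times> {a..b}) (\<lambda>(y, x). Gx x y)"
    "continuous_on ({0..1} \<times> {a..b}) (\<lambda>(y, x). Gy x y)"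
    unfolding Gx_def Gy_def G_def split_beta
    by (intro continuous_intros pair contp cont)+
  have dGx: "((\<lambda>x. G x y) has_vector_derivative Gx x y) (at x within {a..b})" if "x \<in> {a..b}" for x y
  proof -
    have "((\<lambda>x. \<i> * complex_of_real (p x) - complex_of_real y * complex_of_real (p' x)) has_vector_derivative
        (\<i> * complex_of_real (p' x) - complex_of_real y * complex_of_real (p'' x))) (at x within {a..b})"
      by (intro has_vector_derivative_diff has_vector_derivative_mult_right has_vector_derivative_of_real p p' that)
    from field_vector_diff_chain_within[OF this DERIV_subset[OF DERIV_exp]]
    show ?thesis by (simp add: o_def Gx_def G_def)
  qed
  have dGy: "((\<lambda>y. G x y) has_vector_derivative Gy x y) (at y within U)" for x y U
  proof -
    have "((\<lambda>y. \<i> * complex_of_real (p x) - complex_of_real y * complex_of_real (p' x)) has_vector_derivative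
        - complex_of_real (p' x)) (at y within U)"
      by (auto intro!: derivative_eq_intros)
    from field_vector_diff_chain_within[OF this DERIV_subset[OF DERIV_exp]]
    show ?thesis by (simp add: o_def Gy_def G_def)
  qed
  have dJ: "(J has_vector_derivative J' y) (at y within {0..1})" if "y \<in> {0..1}" for y
    unfolding J_def J'_def
    by (rule strip_integral_derivative[OF F_hol \<open>open S\<close> _ less_imp_le[OF ab]])
       (use S contG dGx dGy that in auto)
  have normG: "cmod (G x y) \<le> exp (- (m * y))" if "x \<in> {a..b}" "0 \<le> y" for x y
    using mult_left_mono[OF lower[OF that(1)] that(2)] by (simp add: G_def mult.commute)
  \<comment> \<open>Exponential decay is weakened to 1/(1 + s) so that the final majorant in y has
    an elementary primitive, an arctangent of sqrt(m y). In \<open>exp2\<close> the extra factor s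
    comes from the area term.\<close>
  have exp1: "exp (- s) \<le> 1 / (1 + s)" if "0 \<le> s" for s :: real
    using exp_ge_add_one_self[of s] that by (simp add: exp_minus inverse_eq_divide frac_le)
  have exp2: "s * exp (- s) \<le> 2 / (1 + s)" if "0 \<le> s" for s :: real
  proof -
    have "s * (1 + s) \<le> 2 * exp s"
      using exp_lower_Taylor_quadratic[OF that] that by (simp add: power2_eq_square algebra_simps)
    then show ?thesis using that by (simp add: exp_minus field_simps)
  qed
  \<comment> \<open>Evaluation at x + \<i> y is the inner product with a kernel of norm at most
    1/sqrt y. The singularity at y = 0 is integrable.\<close>
  have normF: "cmod (F (Complex x y)) \<le> N / sqrt y" if "0 < y" for x y
  proof -
    have "cmod (F (Complex x y)) \<le> N * norm (kappa (Complex x y))"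
      using kfun_eq_cinner[OF xs, of "Complex x y"] norm_cinner_le[of "ksum xs 0" "kappa (Complex x y)"] that
      by (simp add: F_def N_def)
    also have "\<dots> \<le> N * sqrt (1 / y)"
    proof (intro mult_left_mono)
      have "1 * y \<le> 4 * pi * y" using that pi_gt3 by (intro mult_right_mono) auto
      then show "norm (kappa (Complex x y)) \<le> sqrt (1 / y)"
        using that by (simp add: norm_kappa frac_le)
    qed (simp add: N_def)
    finally show ?thesis by (simp add: real_sqrt_divide)
  qed
  have contF: "continuous_on {a..b} (\<lambda>x. F (Complex x y))" if "0 \<le> y" for y
    by (rule continuous_on_compose2[OF holomorphic_on_imp_continuous_on[OF F_hol]])
       (use S that in \<open>auto simp: Complex_eq intro!: continuous_intros\<close>)
  have contGs: "continuous_on {a..b} (\<lambda>x. G x y)" for y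
    unfolding G_def by (intro continuous_intros contp)
  \<comment> \<open>The terms with p' cancel. The remaining factor y p'' vanishes on the real line
    and is at most R times m y, which the decay of \<open>G\<close> absorbs.\<close>
  have G_eq: "Gy x y - \<i> * Gx x y = \<i> * complex_of_real (y * p'' x) * G x y" for x y
    by (simp add: Gx_def Gy_def algebra_simps)
  have J'_le: "norm (J' y) \<le> K / (sqrt y * (1 + m * y))" if y: "0 < y" "y \<le> 1" for y
  proof -
    have edge: "norm (F (Complex x y) * G x y) \<le> N / sqrt y * (1 / (1 + m * y))" if "x \<in> {a..b}" for x
      unfolding norm_mult using normF[OF y(1), of x] normG[OF that, of y] exp1[of "m * y"] y m
      by (intro mult_mono) (auto simp: N_def)
    have "norm (integral {a..b} (\<lambda>x. F (Complex x y) * (\<i> * complex_of_real (y * p'' x) * G x y)))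
        \<le> N / sqrt y * (R * (2 / (1 + m * y))) * (b - a)"
    proof (rule integral_bound)
      show "continuous_on {a..b} (\<lambda>x. F (Complex x y) * (\<i> * complex_of_real (y * p'' x) * G x y))"
        using y by (intro continuous_intros contF contGs cont) auto
      show "norm (F (Complex x y) * (\<i> * complex_of_real (y * p'' x) * G x y))
          \<le> N / sqrt y * (R * (2 / (1 + m * y)))" if x: "x \<in> {a..b}" for x
      proof -
        have "\<bar>y * p'' x\<bar> * cmod (G x y) \<le> (y * (R * m)) * exp (- (m * y))"
          using upper[OF x] normG[OF x, of y] y R m by (intro mult_mono) (auto simp: abs_mult)
        also have "\<dots> = R * ((m * y) * exp (- (m * y)))" by simp
        also have "\<dots> \<le> R * (2 / (1 + m * y))"
          using R m y by (intro mult_left_mono exp2) auto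
        finally have "\<bar>y * p'' x\<bar> * cmod (G x y) \<le> R * (2 / (1 + m * y))" .
        then have "cmod (F (Complex x y)) * (\<bar>y * p'' x\<bar> * cmod (G x y)) \<le> N / sqrt y * (R * (2 / (1 + m * y)))"
          using normF[OF y(1), of x] y by (rule_tac mult_mono) (auto simp: N_def)
        then show ?thesis
          unfolding norm_mult norm_of_real norm_ii by simp
      qed
    qed (use ab in simp)
    then have "norm (J' y) \<le> (N / sqrt y * (1 / (1 + m * y)) + N / sqrt y * (1 / (1 + m * y)))
        + N / sqrt y * (R * (2 / (1 + m * y))) * (b - a)"
      unfolding J'_def G_eq using edge[of a] edge[of b] ab
      by (intro order_trans[OF norm_triangle_ineq] add_mono)
         (simp_all add: norm_mult order_trans[OF norm_triangle_ineq4] add_mono)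
    also have "\<dots> = K / (sqrt y * (1 + m * y))"
      using y m by (simp add: K_def divide_simps) (simp add: algebra_simps)
    finally show ?thesis .
  qed
  \<comment> \<open>The bound for \<open>J'\<close> blows up at y = 0, but its primitive is
    continuous there, and derivatives are compared only in the open interval. This replaces an
    improper integral.\<close>
  have "norm (J 1 - J 0) \<le> 2 * K / sqrt m * arctan (sqrt m * sqrt 1) - 2 * K / sqrt m * arctan (sqrt m * sqrt 0)"
  proof (rule differentiable_bound_general[of 0 1 J "\<lambda>y. 2 * K / sqrt m * arctan (sqrt m * sqrt y)" J'
        "\<lambda>y. K / (sqrt y * (1 + m * y))"])
    show "continuous_on {0..1} J"
      by (rule continuous_on_vector_derivative[OF dJ])
    show "continuous_on {0..1} (\<lambda>y. 2 * K / sqrt m * arctan (sqrt m * sqrt y))"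
      using m by (intro continuous_intros) auto
    show "(J has_vector_derivative J' y) (at y)" if "0 < y" "y < 1" for y
      using dJ[of y] that by (simp add: at_within_Icc_at)
    show "((\<lambda>y. 2 * K / sqrt m * arctan (sqrt m * sqrt y)) has_vector_derivative K / (sqrt y * (1 + m * y))) (at y)"
      if "0 < y" "y < 1" for y
    proof -
      have "((\<lambda>y. 2 * K / sqrt m * arctan (sqrt m * sqrt y)) has_real_derivative
          2 * K / sqrt m * (inverse (1 + (sqrt m * sqrt y)\<^sup>2) * (sqrt m * (inverse (sqrt y) / 2)))) (at y)"
        by (rule DERIV_cmult[OF DERIV_chain2[OF DERIV_arctan DERIV_cmult[OF DERIV_real_sqrt[OF that(1)]]]])
      moreover have "(sqrt m * sqrt y)\<^sup>2 = m * y" using that m by (simp add: power_mult_distrib)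
      then have "2 * K / sqrt m * (inverse (1 + (sqrt m * sqrt y)\<^sup>2) * (sqrt m * (inverse (sqrt y) / 2)))
          = K / (sqrt y * (1 + m * y))"
      proof -
        have g: "2 * K / s * (inverse D * (s * (inverse r / 2))) = K / (r * D)" if "s \<noteq> 0" "r \<noteq> 0" "D \<noteq> 0" for s r D
          using that by (simp add: field_simps)
        have "0 < 1 + m * y" using that m by (simp add: add_pos_pos)
        then have "sqrt m \<noteq> 0" "sqrt y \<noteq> 0" "1 + m * y \<noteq> 0" using that m by auto
        then show ?thesis
          unfolding \<open>(sqrt m * sqrt y)\<^sup>2 = m * y\<close> by (rule g)
      qed
      ultimately show ?thesis
        by (simp add: has_real_derivative_iff_has_vector_derivative)
    qed
  qed (use J'_le in auto)
  also have "\<dots> \<le> K * pi / sqrt m"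
  proof -
    have "0 \<le> 2 * K / sqrt m" using R ab m by (simp add: K_def N_def)
    moreover have "arctan (sqrt m) \<le> pi / 2" using arctan_ubound less_imp_le by blast
    ultimately have "2 * K / sqrt m * arctan (sqrt m) \<le> 2 * K / sqrt m * (pi / 2)"
      by (rule mult_left_mono[rotated])
    then show ?thesis by simp
  qed
  finally have J10: "norm (J 1 - J 0) \<le> K * pi / sqrt m" .
  \<comment> \<open>The top edge stays at the fixed height 1, where the decay 1/(1 + m) is already
    below 1/sqrt m.\<close>
  have "norm (J 1) \<le> N / sqrt m * (b - a)"
    unfolding J_def
  proof (rule integral_bound)
    show "continuous_on {a..b} (\<lambda>x. F (Complex x 1) * G x 1)"
      by (intro continuous_intros contF contGs) simp
    have "sqrt m \<le> 1 + m"
      using m by (intro real_le_lsqrt) (auto simp: power2_sum)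
    then have le: "1 / (1 + m) \<le> 1 / sqrt m" using m by (intro divide_left_mono) auto
    show "norm (F (Complex x 1) * G x 1) \<le> N / sqrt m" if x: "x \<in> {a..b}" for x
    proof -
      have "norm (F (Complex x 1) * G x 1) \<le> N * (1 / sqrt m)"
        unfolding norm_mult using normF[of 1 x] normG[OF x, of 1] exp1[of m] m le
        by (intro mult_mono) (auto simp: N_def)
      then show ?thesis by simp
    qed
  qed (use ab in simp)
  with J10 have J0: "norm (J 0) \<le> N / sqrt m * (b - a) + K * pi / sqrt m"
    using norm_triangle_ineq4[of "J 1" "J 1 - J 0"] by simp
  let ?u = "\<lambda>x. indicator {a..b} x *\<^sub>R exp (- (\<i> * complex_of_real (p x)))"
  have si: "square_integrable ?u"
    by (rule square_integrable_indicator_unimodular) (auto intro!: continuous_intros contp)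
  have F0: "square_integrable (\<lambda>x. F (Complex x 0))" "abs_L2 (\<lambda>x. F (Complex x 0)) = ksum xs 0"
    using kfun_slice[OF xs, of 0] by (auto simp: F_def)
  have "cinner_L2 (ksum xs 0) (abs_L2 ?u) = (\<integral>x. F (Complex x 0) * cnj (?u x) \<partial>lborel)"
    unfolding F0(2)[symmetric] by (rule cinner_abs_L2[OF F0(1) si])
  also have "\<dots> = (\<integral>x. indicator {a..b} x *\<^sub>R (F (Complex x 0) * G x 0) \<partial>lborel)"
    by (intro Bochner_Integration.integral_cong) (auto simp: G_def indicator_def exp_cnj)
  also have "\<dots> = J 0"
    unfolding J_def set_lebesgue_integral_def[symmetric]
    by (intro set_borel_integral_eq_integral borel_integrable_atLeastAtMost' continuous_intros contF contGs) simp
  finally have "cmod (cinner_L2 (ksum xs 0) (abs_L2 ?u)) \<le> N / sqrt m * (b - a) + K * pi / sqrt m"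
    using J0 by simp
  also have "\<dots> = ((b - a) + pi * (2 + 2 * R * (b - a))) / sqrt m * N"
  proof -
    have "N / sqrt m * (b - a) = (b - a) / sqrt m * N"
      "K * pi / sqrt m = pi * (2 + 2 * R * (b - a)) / sqrt m * N"
      by (simp_all add: K_def)
    then show ?thesis by (simp only: add_divide_distrib distrib_right)
  qed
  finally show ?thesis unfolding N_def .
qed

lemma norm_szego_projection_oscillation:
  fixes p p' p'' :: "real \<Rightarrow> real"
  assumes "a < b" "0 < m" "0 \<le> R"
    and "\<And>x. x \<in> {a..b} \<Longrightarrow> (p has_real_derivative p' x) (at x within {a..b})"
    and "\<And>x. x \<in> {a..b} \<Longrightarrow> (p' has_real_derivative p'' x) (at x within {a..b})"
    and "continuous_on {a..b} p''"
    and "\<And>x. x \<in> {a..b} \<Longrightarrow> m \<le> p' x"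
    and "\<And>x. x \<in> {a..b} \<Longrightarrow> \<bar>p'' x\<bar> \<le> R * m"
  shows "norm (szego_projection (abs_L2 (\<lambda>x. indicator {a..b} x *\<^sub>R exp (- (\<i> * complex_of_real (p x))))))
    \<le> ((b - a) + pi * (2 + 2 * R * (b - a))) / sqrt m"
  by (rule norm_szego_projection_le) (rule cinner_ksum_oscillation[OF assms(1-3) _ assms(4-8)])

section \<open>Projections onto modulated Hardy spaces\<close>

text \<open>The bound 1 covers the two cases that occur, unimodular phases and indicator
  functions.\<close>

definition contractive_multiplier :: "(real \<Rightarrow> complex) \<Rightarrow> bool" where
  "contractive_multiplier u \<longleftrightarrow> u \<in> borel_measurable borel \<and> (\<forall>x. cmod (u x) \<le> 1)"

definition mult_L2 :: "(real \<Rightarrow> complex) \<Rightarrow> L2 \<Rightarrow> L2" where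
  "mult_L2 u g = abs_L2 (\<lambda>x. u x * rep_L2 g x)"

lemma square_integrable_mult:
  assumes u: "contractive_multiplier u" and f: "square_integrable f"
  shows "square_integrable (\<lambda>x. u x * f x)"
  unfolding square_integrable_def
proof
  have [measurable]: "u \<in> borel_measurable borel" "f \<in> borel_measurable borel"
    using u f by (auto simp: contractive_multiplier_def square_integrable_def)
  show "(\<lambda>x. u x * f x) \<in> borel_measurable lborel" by measurable
  show "integrable lborel (\<lambda>x. (cmod (u x * f x))\<^sup>2)"
  proof (rule Bochner_Integration.integrable_bound)
    show "integrable lborel (\<lambda>x. (cmod (f x))\<^sup>2)" using f by (simp add: square_integrable_def)
    have "cmod (u x * f x) \<le> cmod (f x)" for x
      using u by (auto simp: contractive_multiplier_def norm_mult intro: mult_left_le_one_le)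
    then show "AE x in lborel. norm ((cmod (u x * f x))\<^sup>2) \<le> norm ((cmod (f x))\<^sup>2)"
      by (intro AE_I2) (simp add: power_mono)
  qed measurable
qed

lemma mult_abs_L2:
  assumes u: "contractive_multiplier u" and f: "square_integrable f"
  shows "mult_L2 u (abs_L2 f) = abs_L2 (\<lambda>x. u x * f x)"
  unfolding mult_L2_def
proof (rule abs_L2_eqI)
  show "AE x in lborel. u x * rep_L2 (abs_L2 f) x = u x * f x"
    using rep_abs_L2[OF f] by eventually_elim simp
qed (use u f square_integrable_rep_L2 in \<open>auto intro: square_integrable_mult\<close>)

lemma abs_L2_cases: obtains f where "square_integrable f" "g = abs_L2 f"
  using abs_rep_L2[of g] square_integrable_rep_L2[of g] by metis

lemma mult_L2_add:
  assumes u: "contractive_multiplier u"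
  shows "mult_L2 u (g + h) = mult_L2 u g + mult_L2 u h"
proof -
  obtain f k where fk: "square_integrable f" "g = abs_L2 f" "square_integrable k" "h = abs_L2 k"
    by (metis abs_L2_cases)
  then show ?thesis
    using square_integrable_mult[OF u]
    by (simp add: plus_abs_L2 mult_abs_L2[OF u] square_integrable_add distrib_left)
qed

lemma mult_L2_cscale:
  assumes u: "contractive_multiplier u"
  shows "mult_L2 u (cscale_L2 c g) = cscale_L2 c (mult_L2 u g)"
proof -
  obtain f where f: "square_integrable f" "g = abs_L2 f" by (rule abs_L2_cases)
  then show ?thesis
    using square_integrable_mult[OF u]
    by (simp add: cscale_abs_L2 mult_abs_L2[OF u] square_integrable_scale mult.left_commute)
qed

lemma mult_L2_mult:
  assumes u: "contractive_multiplier u" and v: "contractive_multiplier v"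
  shows "mult_L2 u (mult_L2 v g) = mult_L2 (\<lambda>x. u x * v x) g"
proof -
  obtain f where f: "square_integrable f" "g = abs_L2 f" by (rule abs_L2_cases)
  have uv: "contractive_multiplier (\<lambda>x. u x * v x)"
    using u v by (auto simp: contractive_multiplier_def norm_mult intro!: mult_le_one)
  show ?thesis
    using square_integrable_mult[OF v] f
    by (simp add: mult_abs_L2[OF u] mult_abs_L2[OF v] mult_abs_L2[OF uv] mult.assoc)
qed

lemma contractive_multiplier_cnj:
  "contractive_multiplier u \<Longrightarrow> contractive_multiplier (\<lambda>x. cnj (u x))"
  using cnj_measurable[of u] by (auto simp: contractive_multiplier_def)

lemma cinner_mult_left:
  assumes u: "contractive_multiplier u"
  shows "cinner_L2 (mult_L2 u g) h = cinner_L2 g (mult_L2 (\<lambda>x. cnj (u x)) h)"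
proof -
  obtain f k where fk: "square_integrable f" "g = abs_L2 f" "square_integrable k" "h = abs_L2 k"
    by (metis abs_L2_cases)
  then show ?thesis
    using square_integrable_mult[OF u] square_integrable_mult[OF contractive_multiplier_cnj[OF u]]
    by (simp add: cinner_abs_L2 mult_abs_L2[OF u] mult_abs_L2[OF contractive_multiplier_cnj[OF u]] mult_ac)
qed

lemma norm_mult_L2_le:
  assumes u: "contractive_multiplier u"
  shows "norm (mult_L2 u g) \<le> norm g"
proof -
  obtain f where f: "square_integrable f" "g = abs_L2 f" by (rule abs_L2_cases)
  have "norm (abs_L2 (\<lambda>x. u x * f x)) \<le> norm (abs_L2 f)"
    using u by (intro norm_abs_L2_mono square_integrable_mult f AE_I2)
      (auto simp: contractive_multiplier_def norm_mult intro: mult_left_le_one_le)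
  then show ?thesis by (simp add: f mult_abs_L2[OF u])
qed

lemma bounded_linear_mult_L2:
  assumes u: "contractive_multiplier u"
  shows "bounded_linear (mult_L2 u)"
  using norm_mult_L2_le[OF u] mult_L2_cscale[OF u, of "complex_of_real _"]
  by (intro bounded_linear_intro[of _ 1]) (auto simp: mult_L2_add[OF u] cscale_of_real)

lemma mult_L2_one: "mult_L2 (\<lambda>x. 1) g = g"
  by (simp add: mult_L2_def abs_rep_L2)

definition phase :: "(real \<Rightarrow> real) \<Rightarrow> real \<Rightarrow> complex" where
  "phase p x = exp (\<i> * complex_of_real (p x))"

lemma contractive_multiplier_phase:
  assumes "p \<in> borel_measurable borel"
  shows "contractive_multiplier (phase p)"
proof -
  have "(\<lambda>x. exp (\<i> * complex_of_real (p x))) \<in> borel_measurable borel"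
    by (rule measurable_compose[OF assms]) (auto intro!: borel_measurable_continuous_onI continuous_intros)
  then have "phase p \<in> borel_measurable borel" by (simp add: phase_def[abs_def])
  moreover have "cmod (phase p x) = 1" for x by (simp add: phase_def)
  ultimately show ?thesis by (simp add: contractive_multiplier_def)
qed

lemma cnj_phase: "cnj (phase p x) = phase (\<lambda>x. - p x) x"
  by (simp add: phase_def exp_cnj)

lemma phase_mult_minus: "phase p x * phase (\<lambda>x. - p x) x = 1" "phase (\<lambda>x. - p x) x * phase p x = 1"
  by (simp_all add: phase_def flip: exp_add)

context
  fixes p :: "real \<Rightarrow> real"
  assumes p: "p \<in> borel_measurable borel"
begin

lemma phase_multipliers:
  "contractive_multiplier (phase p)" "contractive_multiplier (phase (\<lambda>x. - p x))"
  using p by (auto intro!: contractive_multiplier_phase)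

lemma mult_phase_inverse:
  "mult_L2 (phase p) (mult_L2 (phase (\<lambda>x. - p x)) g) = g"
  "mult_L2 (phase (\<lambda>x. - p x)) (mult_L2 (phase p) g) = g"
  by (simp_all add: mult_L2_mult phase_multipliers phase_mult_minus mult_L2_one)

lemma norm_mult_phase: "norm (mult_L2 (phase p) g) = norm g"
  using norm_mult_L2_le[OF phase_multipliers(1), of g]
    norm_mult_L2_le[OF phase_multipliers(2), of "mult_L2 (phase p) g"]
  by (simp add: mult_phase_inverse)

lemma modulated_H2_eq: "modulated_H2 p = mult_L2 (phase p) ` H2"
proof -
  have "h = mult_L2 (phase p) g \<longleftrightarrow> (AE x in lborel. rep_L2 h x = exp (\<i> * complex_of_real (p x)) * rep_L2 g x)" for g h
  proof
    assume "h = mult_L2 (phase p) g"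
    then show "AE x in lborel. rep_L2 h x = exp (\<i> * complex_of_real (p x)) * rep_L2 g x"
      using rep_abs_L2[OF square_integrable_mult[OF phase_multipliers(1) square_integrable_rep_L2[of g]]]
      by (simp add: mult_L2_def phase_def)
  next
    assume "AE x in lborel. rep_L2 h x = exp (\<i> * complex_of_real (p x)) * rep_L2 g x"
    then show "h = mult_L2 (phase p) g"
      unfolding mult_L2_def
      by (intro abs_L2_rep_eqI square_integrable_mult phase_multipliers square_integrable_rep_L2)
         (simp add: phase_def)
  qed
  then show ?thesis
    unfolding modulated_H2_def by blast
qed

lemma projection_modulated_H2:
  "projection_onto (modulated_H2 p) \<in> projections"
  "projection_onto (modulated_H2 p) g
    = mult_L2 (phase p) (szego_projection (mult_L2 (phase (\<lambda>x. - p x)) g))"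
proof -
  let ?S = "blinfun_apply szego_projection"
  let ?T = "\<lambda>g. mult_L2 (phase p) (?S (mult_L2 (phase (\<lambda>x. - p x)) g))"
  note m = phase_multipliers
  have "bounded_linear ?T"
    using bounded_linear_compose[OF bounded_linear_mult_L2[OF m(1)]
        bounded_linear_compose[OF blinfun.bounded_linear_right bounded_linear_mult_L2[OF m(2)]]] .
  then have ap: "blinfun_apply (Blinfun ?T) = ?T" by (rule bounded_linear_Blinfun_apply)
  have 1: "Blinfun ?T \<in> projections"
    unfolding projections_def mem_Collect_eq ap
  proof (intro conjI allI)
    show "?T (cscale_L2 c f) = cscale_L2 c (?T f)" for c f
      by (simp add: mult_L2_cscale m projections_scale[OF szego_projection(1)])
    show "?T (?T f) = ?T f" for f
      by (simp add: mult_phase_inverse projections_idem[OF szego_projection(1)])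
    show "cinner_L2 (?T f) g = cinner_L2 f (?T g)" for f g
      by (simp add: cinner_mult_left m projections_adjoint[OF szego_projection(1)] cnj_phase)
  qed
  have "range ?T = modulated_H2 p"
  proof -
    have "range (\<lambda>g. mult_L2 (phase (\<lambda>x. - p x)) g) = UNIV"
      using mult_phase_inverse(2) by (metis surjI)
    moreover have "range ?T = mult_L2 (phase p) ` (?S ` range (\<lambda>g. mult_L2 (phase (\<lambda>x. - p x)) g))"
      by (simp only: image_image)
    ultimately show ?thesis by (simp add: modulated_H2_eq szego_projection(2))
  qed
  then have eq: "projection_onto (modulated_H2 p) = Blinfun ?T"
    using projection_onto_eqI[OF 1] by (simp add: ap)
  show "projection_onto (modulated_H2 p) \<in> projections" using 1 eq by simp
  show "projection_onto (modulated_H2 p) g = ?T g" by (simp add: eq ap)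
qed

end

text \<open>\<open>L2_on E\<close> depends on \<open>E\<close> only up to null sets. A Borel version
  \<open>E0\<close> is carried along because the sets to which this is applied are described
  explicitly only outside a countable set.\<close>

lemma projection_L2_on:
  assumes E0: "E0 \<in> sets borel" and E: "AE x in lborel. x \<in> E \<longleftrightarrow> x \<in> E0"
  shows "projection_onto (L2_on E) \<in> projections"
    and "projection_onto (L2_on E) g = mult_L2 (indicator E0) g"
proof -
  have u: "contractive_multiplier (indicator E0)"
    using E0 by (auto simp: contractive_multiplier_def indicator_def)
  have ii: "mult_L2 (indicator E0) (mult_L2 (indicator E0) g) = mult_L2 (indicator E0) g" for g
    by (simp add: mult_L2_mult u flip: indicator_inter_arith)
  have ap: "blinfun_apply (Blinfun (mult_L2 (indicator E0))) = mult_L2 (indicator E0)"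
    by (rule bounded_linear_Blinfun_apply[OF bounded_linear_mult_L2[OF u]])
  have 1: "Blinfun (mult_L2 (indicator E0)) \<in> projections"
    unfolding projections_def mem_Collect_eq ap
  proof (intro conjI allI)
    show "cinner_L2 (mult_L2 (indicator E0) f) g = cinner_L2 f (mult_L2 (indicator E0) g)" for f g
    proof -
      have "(\<lambda>x. cnj (indicator E0 x)) = (indicator E0 :: real \<Rightarrow> complex)" by (auto simp: indicator_def)
      then show ?thesis by (simp add: cinner_mult_left[OF u])
    qed
  qed (simp_all add: mult_L2_cscale u ii)
  have "range (mult_L2 (indicator E0)) = L2_on E"
  proof
    show "range (mult_L2 (indicator E0)) \<subseteq> L2_on E"
    proof
      fix h assume "h \<in> range (mult_L2 (indicator E0))"
      then obtain g where "h = mult_L2 (indicator E0) g" by auto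
      then have "AE x in lborel. rep_L2 h x = indicator E0 x * rep_L2 g x"
        using rep_abs_L2[OF square_integrable_mult[OF u square_integrable_rep_L2[of g]]]
        by (simp add: mult_L2_def)
      with E show "h \<in> L2_on E"
        unfolding L2_on_def mem_Collect_eq by eventually_elim (simp add: indicator_def)
    qed
    show "L2_on E \<subseteq> range (mult_L2 (indicator E0))"
    proof
      fix h assume "h \<in> L2_on E"
      then have "AE x in lborel. x \<notin> E \<longrightarrow> rep_L2 h x = 0" by (simp add: L2_on_def)
      with E have "AE x in lborel. rep_L2 h x = indicator E0 x * rep_L2 h x"
        by eventually_elim (auto simp: indicator_def)
      then have "h = mult_L2 (indicator E0) h"
        unfolding mult_L2_def by (intro abs_L2_rep_eqI square_integrable_mult u square_integrable_rep_L2)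
      then show "h \<in> range (mult_L2 (indicator E0))" by blast
    qed
  qed
  then have eq: "projection_onto (L2_on E) = Blinfun (mult_L2 (indicator E0))"
    using projection_onto_eqI[OF 1] by (simp add: ap)
  show "projection_onto (L2_on E) \<in> projections" using 1 eq by simp
  show "projection_onto (L2_on E) g = mult_L2 (indicator E0) g" by (simp add: eq ap)
qed

section \<open>Strong continuity in the phase, and the oscillatory estimate for modulated
  projections\<close>

lemma tendsto_mult_L2_phase:
  assumes p: "\<And>n. p n \<in> borel_measurable borel" "q \<in> borel_measurable borel"
    and lim: "\<And>x. (\<lambda>n. p n x) \<longlonglongrightarrow> q x"
  shows "(\<lambda>n::nat. mult_L2 (phase (p n)) g) \<longlonglongrightarrow> mult_L2 (phase q) g"
proof -
  obtain f where f: "square_integrable f" "g = abs_L2 f" by (rule abs_L2_cases)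
  note m = contractive_multiplier_phase[OF p(1)] contractive_multiplier_phase[OF p(2)]
  note si = square_integrable_mult[OF m(1) f(1)] square_integrable_mult[OF m(2) f(1)]
  have [measurable]: "f \<in> borel_measurable borel" "phase (p n) \<in> borel_measurable borel" "phase q \<in> borel_measurable borel" for n
    using f m by (auto simp: square_integrable_def contractive_multiplier_def)
  have "(\<lambda>n. \<integral>x. (cmod (phase (p n) x * f x - phase q x * f x))\<^sup>2 \<partial>lborel) \<longlonglongrightarrow> integral\<^sup>L lborel (\<lambda>x::real. 0)"
  proof (rule integral_dominated_convergence[where w = "\<lambda>x. 4 * (cmod (f x))\<^sup>2"])
    show "integrable lborel (\<lambda>x. 4 * (cmod (f x))\<^sup>2)"
      using f by (simp add: square_integrable_def)
    show "AE x in lborel. (\<lambda>n. (cmod (phase (p n) x * f x - phase q x * f x))\<^sup>2) \<longlonglongrightarrow> 0"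
    proof (rule AE_I2)
      fix x
      have "(\<lambda>n. (cmod (phase (p n) x * f x - phase q x * f x))\<^sup>2)
          \<longlonglongrightarrow> (cmod (phase q x * f x - phase q x * f x))\<^sup>2"
        unfolding phase_def by (intro tendsto_intros lim)
      then show "(\<lambda>n. (cmod (phase (p n) x * f x - phase q x * f x))\<^sup>2) \<longlonglongrightarrow> 0" by simp
    qed
    have "(cmod (phase (p n) x * f x - phase q x * f x))\<^sup>2 \<le> 4 * (cmod (f x))\<^sup>2" for n x
    proof -
      have "cmod (phase (p n) x * f x - phase q x * f x) \<le> cmod (phase (p n) x * f x) + cmod (phase q x * f x)"
        by (rule norm_triangle_ineq4)
      also have "\<dots> = 2 * cmod (f x)" by (simp add: norm_mult phase_def)
      finally have "(cmod (phase (p n) x * f x - phase q x * f x))\<^sup>2 \<le> (2 * cmod (f x))\<^sup>2"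
        by (rule power_mono) simp
      then show ?thesis by (simp add: power_mult_distrib)
    qed
    then show "AE x in lborel. norm ((cmod (phase (p n) x * f x - phase q x * f x))\<^sup>2) \<le> 4 * (cmod (f x))\<^sup>2" for n
      by (intro AE_I2) simp
  qed measurable
  then have "(\<lambda>n. (norm (mult_L2 (phase (p n)) g - mult_L2 (phase q) g))\<^sup>2) \<longlonglongrightarrow> 0"
    by (simp add: f(2) mult_abs_L2 m f(1) minus_abs_L2[OF si] norm_abs_L2_square[OF square_integrable_diff[OF si]])
  then have "(\<lambda>n. sqrt ((norm (mult_L2 (phase (p n)) g - mult_L2 (phase q) g))\<^sup>2)) \<longlonglongrightarrow> sqrt 0"
    by (rule tendsto_real_sqrt)
  then show ?thesis
    by (simp add: tendsto_norm_zero_iff LIM_zero_iff)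
qed

text \<open>Both multipliers vary with n. Since they and the projection are contractions, the inner
  one may be replaced by its limit at a cost that tends to 0; the outer one then acts on a fixed
  vector.\<close>

lemma tendsto_projection_modulated_H2:
  assumes p: "\<And>n. p n \<in> borel_measurable borel" "q \<in> borel_measurable borel"
    and lim: "\<And>x. (\<lambda>n. p n x) \<longlonglongrightarrow> q x"
  shows "(\<lambda>n::nat. projection_onto (modulated_H2 (p n)) g) \<longlonglongrightarrow> projection_onto (modulated_H2 q) g"
proof -
  let ?S = "blinfun_apply szego_projection"
  let ?M = "\<lambda>p. mult_L2 (phase p)" and ?N = "\<lambda>p. mult_L2 (phase (\<lambda>x. - p x))"
  have N: "(\<lambda>n. ?N (p n) g) \<longlonglongrightarrow> ?N q g"
    using p lim by (intro tendsto_mult_L2_phase) (auto intro: tendsto_minus)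
  have M: "(\<lambda>n. ?M (p n) (?S (?N q g))) \<longlonglongrightarrow> ?M q (?S (?N q g))"
    by (rule tendsto_mult_L2_phase[OF p lim])
  have "(\<lambda>n. ?M (p n) (?S (?N (p n) g)) - ?M (p n) (?S (?N q g))) \<longlonglongrightarrow> 0"
  proof (rule Lim_null_comparison)
    show "\<forall>\<^sub>F n in sequentially. norm (?M (p n) (?S (?N (p n) g)) - ?M (p n) (?S (?N q g))) \<le> norm (?N (p n) g - ?N q g)"
    proof (intro always_eventually allI)
      fix n
      have "?M (p n) (?S (?N (p n) g)) - ?M (p n) (?S (?N q g)) = ?M (p n) (?S (?N (p n) g - ?N q g))"
        by (simp add: blinfun.diff_right
            linear_diff[OF bounded_linear.linear[OF bounded_linear_mult_L2[OF contractive_multiplier_phase[OF p(1)]]]])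
      then show "norm (?M (p n) (?S (?N (p n) g)) - ?M (p n) (?S (?N q g))) \<le> norm (?N (p n) g - ?N q g)"
        using norm_mult_phase[OF p(1), of n "?S (?N (p n) g - ?N q g)"]
          projections_norm_le[OF szego_projection(1), of "?N (p n) g - ?N q g"] by simp
    qed
    show "(\<lambda>n. norm (?N (p n) g - ?N q g)) \<longlonglongrightarrow> 0"
      using N by (simp add: tendsto_norm_zero_iff LIM_zero_iff)
  qed
  from tendsto_add[OF this M] show ?thesis
    by (simp add: projection_modulated_H2(2)[OF p(1)] projection_modulated_H2(2)[OF p(2)])
qed

definition indicator_L2 :: "real \<Rightarrow> real \<Rightarrow> L2" where
  "indicator_L2 a b = abs_L2 (indicator {a..b})"

text \<open>For the phase -p, undoing the modulation leaves v - P v with v =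
  \<open>conj_L2 u\<close>, and by \<open>szego_projection_conj\<close> the conjugate of this vector
  is P u. So one oscillatory estimate gives both bounds.\<close>

lemma norm_projection_modulated_H2_indicator:
  fixes p p' p'' :: "real \<Rightarrow> real"
  assumes p: "p \<in> borel_measurable borel"
    and "a < b" "0 < m" "0 \<le> R"
    and "\<And>x. x \<in> {a..b} \<Longrightarrow> (p has_real_derivative p' x) (at x within {a..b})"
    and "\<And>x. x \<in> {a..b} \<Longrightarrow> (p' has_real_derivative p'' x) (at x within {a..b})"
    and "continuous_on {a..b} p''"
    and "\<And>x. x \<in> {a..b} \<Longrightarrow> m \<le> p' x"
    and "\<And>x. x \<in> {a..b} \<Longrightarrow> \<bar>p'' x\<bar> \<le> R * m"
  shows "norm (projection_onto (modulated_H2 p) (indicator_L2 a b))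
      \<le> ((b - a) + pi * (2 + 2 * R * (b - a))) / sqrt m"
    and "norm (indicator_L2 a b - projection_onto (modulated_H2 (\<lambda>x. - p x)) (indicator_L2 a b))
      \<le> ((b - a) + pi * (2 + 2 * R * (b - a))) / sqrt m"
proof -
  let ?S = "blinfun_apply szego_projection"
  have p_neg: "(\<lambda>x. - p x) \<in> borel_measurable borel" using p by simp
  define u where "u = abs_L2 (\<lambda>x. indicator {a..b} x *\<^sub>R exp (- (\<i> * complex_of_real (p x))))"
  have u: "mult_L2 (phase (\<lambda>x. - p x)) (indicator_L2 a b) = u"
    unfolding indicator_L2_def mult_abs_L2[OF contractive_multiplier_phase[OF p_neg] square_integrable_indicator] u_def
    by (intro arg_cong[of _ _ abs_L2]) (auto simp: phase_def indicator_def fun_eq_iff)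
  have cu: "mult_L2 (phase p) (indicator_L2 a b) = conj_L2 u"
  proof -
    have "mult_L2 (phase (\<lambda>x. - p x)) (indicator_L2 a b) = abs_L2 (\<lambda>x. phase (\<lambda>x. - p x) x * indicator {a..b} x)"
      unfolding indicator_L2_def by (rule mult_abs_L2[OF contractive_multiplier_phase[OF p_neg] square_integrable_indicator])
    then have "conj_L2 u = abs_L2 (\<lambda>x. cnj (phase (\<lambda>x. - p x) x * indicator {a..b} x))"
      using conj_abs_L2[OF square_integrable_mult[OF contractive_multiplier_phase[OF p_neg] square_integrable_indicator]]
      by (simp add: u)
    also have "\<dots> = mult_L2 (phase p) (indicator_L2 a b)"
      unfolding indicator_L2_def mult_abs_L2[OF contractive_multiplier_phase[OF p] square_integrable_indicator]
      by (intro arg_cong[of _ _ abs_L2]) (auto simp: cnj_phase indicator_def fun_eq_iff)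
    finally show ?thesis by simp
  qed
  have bound: "norm (?S u) \<le> ((b - a) + pi * (2 + 2 * R * (b - a))) / sqrt m"
    unfolding u_def by (rule norm_szego_projection_oscillation[OF assms(2-9)])
  then show "norm (projection_onto (modulated_H2 p) (indicator_L2 a b))
      \<le> ((b - a) + pi * (2 + 2 * R * (b - a))) / sqrt m"
    by (simp add: projection_modulated_H2(2)[OF p] u norm_mult_phase[OF p])
  let ?v = "conj_L2 u"
  have "indicator_L2 a b = mult_L2 (phase (\<lambda>x. - p x)) ?v"
    using mult_phase_inverse(2)[OF p, of "indicator_L2 a b"] by (simp add: cu)
  moreover have "projection_onto (modulated_H2 (\<lambda>x. - p x)) (indicator_L2 a b) = mult_L2 (phase (\<lambda>x. - p x)) (?S ?v)"
    by (simp add: projection_modulated_H2(2)[OF p_neg] cu)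
  ultimately have "indicator_L2 a b - projection_onto (modulated_H2 (\<lambda>x. - p x)) (indicator_L2 a b)
      = mult_L2 (phase (\<lambda>x. - p x)) (?v - ?S ?v)"
    by (simp add: linear_diff[OF bounded_linear.linear[OF bounded_linear_mult_L2[OF contractive_multiplier_phase[OF p_neg]]]])
  then have "norm (indicator_L2 a b - projection_onto (modulated_H2 (\<lambda>x. - p x)) (indicator_L2 a b)) = norm (?v - ?S ?v)"
    by (simp add: norm_mult_phase[OF p_neg])
  also have "\<dots> = norm (conj_L2 (?v - ?S ?v))" by simp
  also have "\<dots> = norm (?S u)"
    unfolding szego_projection_conj by simp
  finally show "norm (indicator_L2 a b - projection_onto (modulated_H2 (\<lambda>x. - p x)) (indicator_L2 a b))
      \<le> ((b - a) + pi * (2 + 2 * R * (b - a))) / sqrt m"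
    using bound by simp
qed

section \<open>Limits of the projections\<close>

lemma no_accumulation_points_closed: "no_accumulation_points A \<Longrightarrow> closed A"
  by (auto simp: no_accumulation_points_def closed_limpt)

lemma no_accumulation_points_countable:
  assumes "no_accumulation_points A"
  shows "countable A"
proof -
  have "finite ({- real n..real n} \<inter> A)" for n
    using assms by (intro finite_not_islimpt_in_compact) (auto simp: no_accumulation_points_def)
  then have "countable (\<Union>n. {- real n..real n} \<inter> A)"
    by - (rule countable_UN, auto intro: countable_finite)
  moreover have "A \<subseteq> (\<Union>n. {- real n..real n} \<inter> A)"
  proof
    fix x assume "x \<in> A"
    obtain n :: nat where "\<bar>x\<bar> \<le> real n" using real_arch_simple by blast
    then have "x \<in> {- real n..real n}" by (simp add: abs_le_iff)
    with \<open>x \<in> A\<close> show "x \<in> (\<Union>n. {- real n..real n} \<inter> A)" by blast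
  qed
  ultimately show ?thesis by (rule countable_subset[rotated])
qed

lemma AE_not_in_countable: "countable A \<Longrightarrow> AE x in lborel. x \<notin> (A :: real set)"
  using AE_not_in[OF countable_imp_null_set_lborel] .

text \<open>One set for all directions. A single combination may be smoother than its terms, but
  estimates uniform in the coefficients need every \<open>f j\<close> to be regular.\<close>

definition regular_set :: "('n::finite \<Rightarrow> real \<Rightarrow> real) \<Rightarrow> real set" where
  "regular_set f = {x. \<forall>j. C2_at (f j) x}"

text \<open>Linear in \<open>c\<close> everywhere, but known to be the derivative of
  \<open>lin_comb f c\<close> only on \<open>regular_set f\<close>; elsewhere \<open>deriv\<close>
  may take an unspecified value.\<close>

definition slope :: "('n::finite \<Rightarrow> real \<Rightarrow> real) \<Rightarrow> real ^ 'n \<Rightarrow> real \<Rightarrow> real" where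
  "slope f c x = (\<Sum>j\<in>UNIV. c $ j * deriv (f j) x)"

definition curvature :: "('n::finite \<Rightarrow> real \<Rightarrow> real) \<Rightarrow> real ^ 'n \<Rightarrow> real \<Rightarrow> real" where
  "curvature f c x = (\<Sum>j\<in>UNIV. c $ j * deriv (deriv (f j)) x)"

lemma regular_set_derivs:
  assumes "x \<in> regular_set f"
  shows "(f j has_real_derivative deriv (f j) x) (at x)"
    and "(deriv (f j) has_real_derivative deriv (deriv (f j)) x) (at x)"
    and "isCont (deriv (deriv (f j))) x"
proof -
  have "\<forall>\<^sub>F y in nhds x. f j differentiable (at y) \<and> deriv (f j) differentiable (at y) \<and>
      isCont (deriv (deriv (f j))) y"
    using assms by (auto simp: regular_set_def C2_at_def)
  then have "f j differentiable (at x) \<and> deriv (f j) differentiable (at x) \<and> isCont (deriv (deriv (f j))) x"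
    by (rule eventually_nhds_x_imp_x)
  then show "(f j has_real_derivative deriv (f j) x) (at x)"
    "(deriv (f j) has_real_derivative deriv (deriv (f j)) x) (at x)"
    "isCont (deriv (deriv (f j))) x"
    by (auto simp: DERIV_deriv_iff_real_differentiable)
qed

lemma lin_comb_derivs:
  assumes "x \<in> regular_set f"
  shows "(lin_comb f c has_real_derivative slope f c x) (at x)"
    and "(slope f c has_real_derivative curvature f c x) (at x)"
    and "isCont (curvature f c) x"
  unfolding lin_comb_def slope_def[abs_def] curvature_def[abs_def]
  by (intro DERIV_sum DERIV_cmult continuous_intros regular_set_derivs[OF assms])+

lemma slope_scaleR: "slope f (t *\<^sub>R c) x = t * slope f c x"
  by (simp add: slope_def sum_distrib_left mult.assoc)

lemma curvature_scaleR: "curvature f (t *\<^sub>R c) x = t * curvature f c x"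
  by (simp add: curvature_def sum_distrib_left mult.assoc)

lemma slope_minus: "slope f (- c) x = - slope f c x"
  using slope_scaleR[of f "-1" c x] by simp

lemma lin_comb_minus: "lin_comb f (- c) = (\<lambda>x. - lin_comb f c x)"
  by (simp add: lin_comb_def sum_negf fun_eq_iff)

lemma abs_weighted_sum_le:
  fixes c :: "real ^ 'n::finite"
  assumes "\<And>j. \<bar>d j\<bar> \<le> B"
  shows "\<bar>\<Sum>j\<in>UNIV. c $ j * d j\<bar> \<le> real CARD('n) * (norm c * B)"
proof -
  have "\<bar>\<Sum>j\<in>UNIV. c $ j * d j\<bar> \<le> (\<Sum>j\<in>UNIV. \<bar>c $ j * d j\<bar>)" by (rule sum_abs)
  also have "\<dots> \<le> (\<Sum>j\<in>(UNIV :: 'n set). norm c * B)"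
    unfolding abs_mult using assms component_le_norm_cart[of c]
    by (intro sum_mono mult_mono) auto
  finally show ?thesis by simp
qed

context
  fixes f :: "'n::finite \<Rightarrow> real \<Rightarrow> real"
  assumes adm: "admissible_tuple f"
begin

lemma lin_comb_in_span: "c \<noteq> 0 \<Longrightarrow> lin_comb f c \<in> span_funs f - {\<lambda>x. 0}"
  using adm by (auto simp: admissible_tuple_def span_funs_def)

lemma lin_comb_admissible: "c \<noteq> 0 \<Longrightarrow> admissible (lin_comb f c)"
  using lin_comb_in_span adm by (auto simp: admissible_tuple_def)

lemma regular_set: "open (regular_set f)" "countable (- regular_set f)"
proof -
  have no_acc: "no_accumulation_points (Gamma_set (f j))" for j
  proof -
    \<comment> \<open>Each \<open>f j\<close> is itself a combination with nonzero coefficients, so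
      it is admissible and its irregular points do not accumulate.\<close>
    have "lin_comb f (axis j 1) = f j"
    proof
      fix x
      have "lin_comb f (axis j 1) x = (\<Sum>i\<in>UNIV. if i = j then f i x else 0)"
        unfolding lin_comb_def axis_def by (intro sum.cong) auto
      then show "lin_comb f (axis j 1) x = f j x" by simp
    qed
    moreover have "axis j 1 \<noteq> (0 :: real ^ 'n)" by (simp add: axis_eq_0_iff)
    ultimately show ?thesis
      using lin_comb_admissible[of "axis j 1"] by (simp add: admissible_def)
  qed
  have eq: "- regular_set f = (\<Union>j. Gamma_set (f j))"
    by (auto simp: regular_set_def Gamma_set_def)
  have "closed (- regular_set f)"
    unfolding eq using no_accumulation_points_closed[OF no_acc] by (intro closed_UN) auto
  then show "open (regular_set f)" by (simp add: open_closed)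
  show "countable (- regular_set f)"
    unfolding eq using no_accumulation_points_countable[OF no_acc] by auto
qed

text \<open>Measurability follows from admissibility: each \<open>f j\<close> is continuous on an
  open set with countable complement.\<close>

lemma lin_comb_measurable: "lin_comb f c \<in> borel_measurable borel"
proof -
  have "f j \<in> borel_measurable borel" for j
  proof (rule measurable_discrete_difference)
    have "continuous_on (regular_set f) (f j)"
      by (intro continuous_at_imp_continuous_on ballI DERIV_isCont[OF regular_set_derivs(1)])
    then show "(\<lambda>x. indicator (regular_set f) x *\<^sub>R f j x) \<in> borel_measurable borel"
      using regular_set(1) by (intro borel_measurable_continuous_on_indicator) auto
    show "countable (- regular_set f)" by (rule regular_set)
  qed auto
  then show ?thesis unfolding lin_comb_def by measurable
qed

lemma slope_continuous: "continuous_on (regular_set f) (slope f c)"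
  by (intro continuous_at_imp_continuous_on ballI DERIV_isCont[OF lin_comb_derivs(2)])

lemma deriv_vimage_iff_slope:
  assumes "x \<in> regular_set f"
  shows "x \<in> deriv_vimage (lin_comb f c) B \<longleftrightarrow> slope f c x \<in> B"
  unfolding deriv_vimage_def mem_Collect_eq
  using lin_comb_derivs(1)[OF assms, of c] DERIV_unique by blast

text \<open>Supplies the open set of full measure on whose compact intervals the oscillatory
  estimate can be applied.\<close>

lemma slope_nonzero_set:
  assumes "c \<noteq> 0"
  shows "open {x \<in> regular_set f. slope f c x \<noteq> 0}"
    and "AE x in lborel. x \<in> {x \<in> regular_set f. slope f c x \<noteq> 0}"
proof -
  let ?Z = "deriv_vimage (lin_comb f c) {0}"
  have Z: "no_accumulation_points ?Z"
    using lin_comb_admissible[OF assms] by (simp add: admissible_def)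
  have eq: "{x \<in> regular_set f. slope f c x \<noteq> 0} = regular_set f \<inter> - ?Z"
    using deriv_vimage_iff_slope[of _ c "{0}"] by auto
  show "open {x \<in> regular_set f. slope f c x \<noteq> 0}"
    unfolding eq using regular_set(1) no_accumulation_points_closed[OF Z] by (auto intro: open_Compl)
  show "AE x in lborel. x \<in> {x \<in> regular_set f. slope f c x \<noteq> 0}"
    unfolding eq
    using AE_not_in_countable[OF regular_set(2)] AE_not_in_countable[OF no_accumulation_points_countable[OF Z]]
    by eventually_elim auto
qed

lemma theta_in_projections: "theta f c \<in> projections"
  unfolding theta_def by (rule projection_modulated_H2(1)[OF lin_comb_measurable])

lemma negative_slope_set_borel: "{x \<in> regular_set f. slope f c x < 0} \<in> sets borel"
proof -
  have "open (slope f c -` {..<0} \<inter> regular_set f)"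
    using continuous_on_open_vimage[OF regular_set(1)] slope_continuous open_lessThan by blast
  moreover have "slope f c -` {..<0} \<inter> regular_set f = {x \<in> regular_set f. slope f c x < 0}" by auto
  ultimately show ?thesis by simp
qed

lemma negative_slope_multiplier:
  "contractive_multiplier (indicator {x \<in> regular_set f. slope f c x < 0})"
  using negative_slope_set_borel by (auto simp: contractive_multiplier_def indicator_def)

text \<open>The combination may be differentiable at a point where some \<open>f j\<close> is not
  regular, so the two descriptions of the negative set can differ, but only inside a countable
  set.\<close>

lemma negative_slope_projection:
  shows "projection_onto (L2_on (deriv_vimage (lin_comb f c) {..<0})) \<in> projections"
    and "projection_onto (L2_on (deriv_vimage (lin_comb f c) {..<0})) g
      = mult_L2 (indicator {x \<in> regular_set f. slope f c x < 0}) g"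
proof -
  note E0 = negative_slope_set_borel[of c]
  have E: "AE x in lborel. x \<in> deriv_vimage (lin_comb f c) {..<0} \<longleftrightarrow> x \<in> {x \<in> regular_set f. slope f c x < 0}"
    using AE_not_in_countable[OF regular_set(2)]
    by eventually_elim (simp add: deriv_vimage_iff_slope)
  show "projection_onto (L2_on (deriv_vimage (lin_comb f c) {..<0})) \<in> projections"
    by (rule projection_L2_on(1)[OF E0 E])
  show "projection_onto (L2_on (deriv_vimage (lin_comb f c) {..<0})) g
      = mult_L2 (indicator {x \<in> regular_set f. slope f c x < 0}) g"
    by (rule projection_L2_on(2)[OF E0 E])
qed

lemma negative_slope_projection_indicator:
  "projection_onto (L2_on (deriv_vimage (lin_comb f c) {..<0})) (indicator_L2 a b)
    = abs_L2 (\<lambda>x. indicator {x \<in> regular_set f. slope f c x < 0} x * indicator {a..b} x)"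
  unfolding negative_slope_projection(2) indicator_L2_def
  by (rule mult_abs_L2[OF negative_slope_multiplier square_integrable_indicator])

section \<open>Continuity of the projections in the coefficients, and their limits at
  infinity\<close>

lemma theta_continuous: "isCont (\<lambda>c. theta f c g) c"
  unfolding continuous_at_sequentially o_def
proof (intro allI impI)
  fix u assume u: "u \<longlonglongrightarrow> c"
  have "(\<lambda>n. lin_comb f (u n) x) \<longlonglongrightarrow> lin_comb f c x" for x
    unfolding lin_comb_def by (intro tendsto_intros u)
  then show "(\<lambda>n. theta f (u n) g) \<longlonglongrightarrow> theta f c g"
    unfolding theta_def by (intro tendsto_projection_modulated_H2 lin_comb_measurable)
qed

text \<open>The oscillatory estimate depends on the phase only through m and R. By compactness of
  the interval, a lower bound \<open>r\<close> for the slope and an upper bound for the curvature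
  hold for all directions near \<open>c\<close>. Multiplying the direction by t replaces m = r by t
  r and keeps R.\<close>

lemma theta_indicator_bound:
  assumes ab: "a < b" and sub: "{a..b} \<subseteq> regular_set f"
    and pos: "\<And>x. x \<in> {a..b} \<Longrightarrow> 0 < slope f c x"
  obtains \<delta> C where "0 < \<delta>"
    "\<And>t d. 0 < t \<Longrightarrow> dist d c < \<delta> \<Longrightarrow> norm (theta f (t *\<^sub>R d) (indicator_L2 a b)) \<le> C / sqrt t"
    "\<And>t d. 0 < t \<Longrightarrow> dist d c < \<delta> \<Longrightarrow>
      norm (indicator_L2 a b - theta f (- (t *\<^sub>R d)) (indicator_L2 a b)) \<le> C / sqrt t"
proof -
  have "\<exists>B. \<forall>x\<in>{a..b}. \<bar>deriv (f j) x\<bar> \<le> B \<and> \<bar>deriv (deriv (f j)) x\<bar> \<le> B" for j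
  proof -
    have "continuous_on {a..b} (deriv (f j))" "continuous_on {a..b} (deriv (deriv (f j)))"
      using sub regular_set_derivs[of _ f j]
      by (auto intro!: continuous_at_imp_continuous_on intro: DERIV_isCont)
    then have "bounded (deriv (f j) ` {a..b})" "bounded (deriv (deriv (f j)) ` {a..b})"
      by (auto intro!: compact_imp_bounded compact_continuous_image)
    then obtain B1 B2 where "\<forall>x\<in>{a..b}. \<bar>deriv (f j) x\<bar> \<le> B1" "\<forall>x\<in>{a..b}. \<bar>deriv (deriv (f j)) x\<bar> \<le> B2"
      unfolding bounded_real by auto
    then show ?thesis by (intro exI[of _ "max B1 B2"]) fastforce
  qed
  then obtain B' where B': "\<And>j x. x \<in> {a..b} \<Longrightarrow> \<bar>deriv (f j) x\<bar> \<le> B' j"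
    "\<And>j x. x \<in> {a..b} \<Longrightarrow> \<bar>deriv (deriv (f j)) x\<bar> \<le> B' j"
    by metis
  define B where "B = (\<Sum>j\<in>UNIV. \<bar>B' j\<bar>)"
  have B0: "0 \<le> B" by (simp add: B_def sum_nonneg)
  have "B' j \<le> B" for j
    using member_le_sum[of j UNIV "\<lambda>j. \<bar>B' j\<bar>"] unfolding B_def by fastforce
  then have B: "\<bar>deriv (f j) x\<bar> \<le> B" "\<bar>deriv (deriv (f j)) x\<bar> \<le> B" if "x \<in> {a..b}" for j x
    using B'[OF that, of j] order_trans by blast+
  obtain x0 where x0: "x0 \<in> {a..b}" "\<And>x. x \<in> {a..b} \<Longrightarrow> slope f c x0 \<le> slope f c x"
    using continuous_attains_inf[of "{a..b}" "slope f c"] ab continuous_on_subset[OF slope_continuous sub] by auto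
  \<comment> \<open>Half the minimal slope for \<open>c\<close>: the other half is the amount by
    which a perturbation of the direction may lower it.\<close>
  define r where "r = slope f c x0 / 2"
  have r: "0 < r" using pos[OF x0(1)] by (simp add: r_def)
  define N where "N = real CARD('n) * B"
  have N: "0 \<le> N" using B0 by (simp add: N_def)
  \<comment> \<open>The slope changes by at most \<open>N\<close> times the distance of the
    directions, so the second term keeps this change below \<open>r\<close>; \<open>N + 1\<close>
    avoids division by zero. The bound 1 gives \<open>norm d \<le> norm c + 1\<close> for the
    curvature.\<close>
  define \<delta> where "\<delta> = min 1 (r / (N + 1))"
  have \<delta>: "0 < \<delta>" using r N by (simp add: \<delta>_def)
  have slope_ge: "r \<le> slope f d x" if "dist d c < \<delta>" "x \<in> {a..b}" for d x
  proof -
    have "\<bar>slope f d x - slope f c x\<bar> = \<bar>\<Sum>j\<in>UNIV. (d - c) $ j * deriv (f j) x\<bar>"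
      by (simp add: slope_def sum_subtractf left_diff_distrib)
    also have "\<dots> \<le> real CARD('n) * (norm (d - c) * B)"
      by (rule abs_weighted_sum_le) (rule B[OF that(2)])
    also have "\<dots> = norm (d - c) * N" by (simp add: N_def)
    also have "\<dots> \<le> r / (N + 1) * N"
      using that(1) N by (intro mult_right_mono) (auto simp: \<delta>_def dist_norm)
    also have "\<dots> \<le> r" using r N by (simp add: field_simps)
    finally have "\<bar>slope f d x - slope f c x\<bar> \<le> r" .
    then show ?thesis using x0(2)[OF that(2)] unfolding r_def by linarith
  qed
  define R where "R = N * (norm c + 1) / r"
  have R: "0 \<le> R" using N r by (simp add: R_def)
  have curv_le: "\<bar>curvature f d x\<bar> \<le> R * r" if "dist d c < \<delta>" "x \<in> {a..b}" for d x
  proof -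
    have "\<bar>curvature f d x\<bar> \<le> real CARD('n) * (norm d * B)"
      unfolding curvature_def by (rule abs_weighted_sum_le) (rule B[OF that(2)])
    also have "\<dots> = norm d * N" by (simp add: N_def)
    also have "\<dots> \<le> (norm c + 1) * N"
    proof (rule mult_right_mono[OF _ N])
      show "norm d \<le> norm c + 1"
        using norm_triangle_ineq2[of d c] that(1) by (simp add: \<delta>_def dist_norm)
    qed
    also have "\<dots> = R * r" using r by (simp add: R_def)
    finally show ?thesis .
  qed
  define C where "C = ((b - a) + pi * (2 + 2 * R * (b - a))) / sqrt r"
  have "norm (theta f (t *\<^sub>R d) (indicator_L2 a b)) \<le> C / sqrt t \<and>
      norm (indicator_L2 a b - theta f (- (t *\<^sub>R d)) (indicator_L2 a b)) \<le> C / sqrt t"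
    if t: "0 < t" and d: "dist d c < \<delta>" for t d
  proof -
    let ?p = "lin_comb f (t *\<^sub>R d)" and ?s = "slope f (t *\<^sub>R d)" and ?k = "curvature f (t *\<^sub>R d)"
    have 1: "0 < t * r" using t r by simp
    have 2: "(?p has_real_derivative ?s x) (at x within {a..b})" if "x \<in> {a..b}" for x
      using lin_comb_derivs(1) sub that by (blast intro: DERIV_subset)
    have 3: "(?s has_real_derivative ?k x) (at x within {a..b})" if "x \<in> {a..b}" for x
      using lin_comb_derivs(2) sub that by (blast intro: DERIV_subset)
    have 4: "continuous_on {a..b} ?k"
      using lin_comb_derivs(3) sub by (intro continuous_at_imp_continuous_on) blast
    have 5: "t * r \<le> ?s x" if "x \<in> {a..b}" for x
      unfolding slope_scaleR using slope_ge[OF d that] t by (intro mult_left_mono) auto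
    have 6: "\<bar>?k x\<bar> \<le> R * (t * r)" if "x \<in> {a..b}" for x
    proof -
      have "\<bar>?k x\<bar> = t * \<bar>curvature f d x\<bar>" using t by (simp add: curvature_scaleR abs_mult)
      also have "\<dots> \<le> t * (R * r)" using curv_le[OF d that] t by (intro mult_left_mono) auto
      finally show ?thesis by (simp add: mult_ac)
    qed
    have C: "((b - a) + pi * (2 + 2 * R * (b - a))) / sqrt (t * r) = C / sqrt t"
      by (simp add: C_def real_sqrt_mult mult.commute)
    show ?thesis
      using norm_projection_modulated_H2_indicator[OF lin_comb_measurable ab 1 R 2 3 4 5 6]
      unfolding C theta_def lin_comb_minus by blast
  qed
  then show thesis using \<delta> by (intro that[of \<delta> C]) auto
qed

text \<open>The limit points at infinity.  The directions are allowed to vary, since a sequence in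
  \<open>\<real>\<^sup>n\<close> that tends to infinity need not do so along a ray.\<close>

lemma theta_at_infinity:
  assumes c: "c \<noteq> 0"
  shows "((\<lambda>x. theta f (fst x *\<^sub>R snd x) g) \<longlongrightarrow>
    projection_onto (L2_on (deriv_vimage (lin_comb f c) {..<0})) g) (at_top \<times>\<^sub>F nhds c)"
proof -
  define Q where "Q = projection_onto (L2_on (deriv_vimage (lin_comb f c) {..<0}))"
  define U where "U = {x \<in> regular_set f. slope f c x \<noteq> 0}"
  \<comment> \<open>The set of vectors with the desired convergence. It is shown to be a closed
    complex subspace with trivial orthogonal complement.\<close>
  define S where "S = {g. ((\<lambda>x. theta f (fst x *\<^sub>R snd x) g) \<longlongrightarrow> Q g) (at_top \<times>\<^sub>F nhds c)}"
  have Q: "Q \<in> projections" unfolding Q_def by (rule negative_slope_projection)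
  have small: "((\<lambda>x. C / sqrt (fst x)) \<longlongrightarrow> 0) (at_top \<times>\<^sub>F nhds c)" for C
    by (rule filterlim_compose[OF _ filterlim_fst])
       (intro tendsto_divide_0[OF tendsto_const] filterlim_at_top_imp_at_infinity sqrt_at_top)
  have ind: "indicator_L2 a b \<in> S" if ab: "a < b" and sub: "{a..b} \<subseteq> U" for a b
  proof -
    have reg: "{a..b} \<subseteq> regular_set f" using sub by (auto simp: U_def)
    have evI: "\<forall>\<^sub>F x in at_top \<times>\<^sub>F nhds c. P x"
      if "0 < \<delta>" "\<And>(t::real) d. 0 < t \<Longrightarrow> dist d c < \<delta> \<Longrightarrow> P (t, d)" for \<delta> :: real and P
    proof -
      have "\<forall>\<^sub>F d in nhds c. dist d c < \<delta>" using that(1) by (auto simp: eventually_nhds_metric)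
      from eventually_prodI[OF eventually_gt_at_top[of "0::real"] this]
      have "\<forall>\<^sub>F x in (at_top :: real filter) \<times>\<^sub>F nhds c. 0 < fst x \<and> dist (snd x) c < \<delta>" .
      then show ?thesis by eventually_elim (use that(2) in auto)
    qed
    \<comment> \<open>Intermediate value theorem: the slope is continuous and nonzero on the
      interval, so one of the two estimates applies to all of it.\<close>
    have signs: "(\<forall>x\<in>{a..b}. 0 < slope f c x) \<or> (\<forall>x\<in>{a..b}. slope f c x < 0)"
    proof (rule ccontr)
      assume "\<not> ?thesis"
      then obtain x y where xy: "x \<in> {a..b}" "slope f c x \<le> 0" "y \<in> {a..b}" "0 \<le> slope f c y"
        by (auto simp: not_less)
      have "connected (slope f c ` {a..b})"
        by (intro connected_continuous_image continuous_on_subset[OF slope_continuous reg] connected_Icc)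
      then have "0 \<in> slope f c ` {a..b}"
        using xy connectedD_interval[of "slope f c ` {a..b}" "slope f c x" "slope f c y" 0] by blast
      then show False using sub by (auto simp: U_def)
    qed
    show ?thesis
    proof (cases "\<forall>x\<in>{a..b}. 0 < slope f c x")
      case True
      have "Q (indicator_L2 a b) = abs_L2 (\<lambda>x. 0)"
      proof -
        have "Q (indicator_L2 a b) = abs_L2 (\<lambda>x. indicator {x \<in> regular_set f. slope f c x < 0} x * indicator {a..b} x)"
          unfolding Q_def by (rule negative_slope_projection_indicator)
        also have "(\<lambda>x. indicator {x \<in> regular_set f. slope f c x < 0} x * indicator {a..b} x) = (\<lambda>x. 0 :: complex)"
        proof
          fix x
          have "\<not> slope f c x < 0" if "x \<in> {a..b}" using True that by force
          then show "indicator {x \<in> regular_set f. slope f c x < 0} x * indicator {a..b} x = (0 :: complex)"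
            by (auto simp: indicator_def)
        qed
        finally show ?thesis .
      qed
      then have Q0: "Q (indicator_L2 a b) = 0" by (simp add: zero_L2_def)
      obtain \<delta> C where "0 < \<delta>"
        "\<And>t d. 0 < t \<Longrightarrow> dist d c < \<delta> \<Longrightarrow> norm (theta f (t *\<^sub>R d) (indicator_L2 a b)) \<le> C / sqrt t"
        using theta_indicator_bound[OF ab reg, of c] True by metis
      then have "\<forall>\<^sub>F x in at_top \<times>\<^sub>F nhds c. norm (theta f (fst x *\<^sub>R snd x) (indicator_L2 a b)) \<le> C / sqrt (fst x)"
        by (intro evI) auto
      from Lim_null_comparison[OF this small] show ?thesis
        by (simp add: S_def Q0)
    next
      case False
      then have neg: "\<And>x. x \<in> {a..b} \<Longrightarrow> slope f c x < 0" using signs by blast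
      have Q1: "Q (indicator_L2 a b) = indicator_L2 a b"
      proof -
        have "Q (indicator_L2 a b) = abs_L2 (\<lambda>x. indicator {x \<in> regular_set f. slope f c x < 0} x * indicator {a..b} x)"
          unfolding Q_def by (rule negative_slope_projection_indicator)
        also have "(\<lambda>x. indicator {x \<in> regular_set f. slope f c x < 0} x * indicator {a..b} x)
            = (indicator {a..b} :: real \<Rightarrow> complex)"
          using neg reg by (auto simp: indicator_def fun_eq_iff)
        finally show ?thesis unfolding indicator_L2_def .
      qed
      have pos: "0 < slope f (- c) x" if "x \<in> {a..b}" for x
        using neg[OF that] by (simp add: slope_minus)
      \<comment> \<open>Negative slope for \<open>c\<close> is positive slope for
        \<open>- c\<close>. A direction d near \<open>c\<close> is handled by writing t d as the
        negative of t (-d), with -d near \<open>- c\<close>.\<close>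
      obtain \<delta> C where \<delta>: "0 < \<delta>"
        "\<And>t d. 0 < t \<Longrightarrow> dist d (- c) < \<delta> \<Longrightarrow>
          norm (indicator_L2 a b - theta f (- (t *\<^sub>R d)) (indicator_L2 a b)) \<le> C / sqrt t"
        using theta_indicator_bound[OF ab reg pos] by metis
      have "\<forall>\<^sub>F x in at_top \<times>\<^sub>F nhds c.
          norm (theta f (fst x *\<^sub>R snd x) (indicator_L2 a b) - indicator_L2 a b) \<le> C / sqrt (fst x)"
      proof (rule evI[OF \<delta>(1)])
        fix t :: real and d assume "0 < t" "dist d c < \<delta>"
        then show "norm (theta f (fst (t, d) *\<^sub>R snd (t, d)) (indicator_L2 a b) - indicator_L2 a b) \<le> C / sqrt (fst (t, d))"
          using \<delta>(2)[of t "- d"] by (simp add: dist_minus norm_minus_commute)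
      qed
      from Lim_null_comparison[OF this small] show ?thesis
        by (simp add: S_def Q1 LIM_zero_iff)
    qed
  qed
  \<comment> \<open>All operators involved have norm at most 1, so convergence on a sequence in
    \<open>S\<close> carries over to its limit with a three-term estimate.\<close>
  have "closed S"
    unfolding closed_sequential_limits
  proof (intro allI impI, elim conjE)
    fix u h assume u: "\<forall>n. u n \<in> S" "u \<longlonglongrightarrow> h"
    show "h \<in> S"
      unfolding S_def mem_Collect_eq
    proof (rule tendstoI)
      fix e :: real assume e: "0 < e"
      then have "\<forall>\<^sub>F n in sequentially. dist (u n) h < e / 3"
        using u(2) by (intro tendstoD) auto
      from eventually_happens'[OF sequentially_bot this] obtain n where "dist (u n) h < e / 3" ..
      then have n: "norm (h - u n) < e / 3" by (simp add: dist_norm norm_minus_commute)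
      have "((\<lambda>x. theta f (fst x *\<^sub>R snd x) (u n)) \<longlongrightarrow> Q (u n)) (at_top \<times>\<^sub>F nhds c)"
        using u(1) by (simp add: S_def)
      then have "\<forall>\<^sub>F x in at_top \<times>\<^sub>F nhds c. dist (theta f (fst x *\<^sub>R snd x) (u n)) (Q (u n)) < e / 3"
        using e by (intro tendstoD) auto
      then show "\<forall>\<^sub>F x in at_top \<times>\<^sub>F nhds c. dist (theta f (fst x *\<^sub>R snd x) h) (Q h) < e"
      proof eventually_elim
        case (elim x)
        let ?T = "theta f (fst x *\<^sub>R snd x)"
        have T: "norm (?T h - ?T (u n)) \<le> norm (h - u n)"
          using projections_norm_le[OF theta_in_projections, of _ "h - u n"] by (simp add: blinfun.diff_right)
        have Q': "norm (Q (u n) - Q h) \<le> norm (h - u n)"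
          using projections_norm_le[OF Q, of "h - u n"] by (simp add: blinfun.diff_right norm_minus_commute)
        have tri: "norm (x + y + z) \<le> norm x + norm y + norm z" for x y z :: L2
          using norm_triangle_ineq[of "x + y" z] norm_triangle_ineq[of x y] by linarith
        have "norm (?T h - Q h) \<le> norm (?T h - ?T (u n)) + norm (?T (u n) - Q (u n)) + norm (Q (u n) - Q h)"
          using tri[of "?T h - ?T (u n)" "?T (u n) - Q (u n)" "Q (u n) - Q h"] by simp
        then show ?case using T Q' elim n by (simp add: dist_norm)
      qed
    qed
  qed
  moreover have "complex_subspace S"
    unfolding complex_subspace_def S_def mem_Collect_eq
    by (auto simp: blinfun.add_right blinfun.zero_right projections_scale[OF Q] projections_scale[OF theta_in_projections]
        intro!: tendsto_add bounded_linear.tendsto[OF bounded_linear_cscale])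
  \<comment> \<open>A vector orthogonal to the indicators of all compact intervals in
    \<open>U\<close> has vanishing integrals over these intervals, and \<open>U\<close> has full
    measure.\<close>
  moreover have "h = 0" if orth: "\<And>s. s \<in> S \<Longrightarrow> cinner_L2 h s = 0" for h
  proof -
    define k where "k = rep_L2 h"
    have k: "square_integrable k" "h = abs_L2 k"
      by (simp_all add: k_def square_integrable_rep_L2 abs_rep_L2)
    have "AE x in lborel. k x = 0"
    proof (rule AE_zero_of_interval_integrals[OF k(1), of U])
      show "open U" "AE x in lborel. x \<in> U"
        unfolding U_def by (rule slope_nonzero_set[OF c])+
      fix a b :: real assume ab: "a < b" "{a..b} \<subseteq> U"
      have "(\<lambda>x. indicator {a..b} x *\<^sub>R k x) = (\<lambda>x. k x * cnj (indicator {a..b} x))"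
        by (auto simp: indicator_def)
      then show "(\<integral>x. indicator {a..b} x *\<^sub>R k x \<partial>lborel) = 0"
        using orth[OF ind[OF ab]] by (simp add: k(2) indicator_L2_def cinner_abs_L2[OF k(1) square_integrable_indicator])
    qed
    then show "h = 0"
      unfolding k(2) zero_L2_def by (intro abs_L2_eqI k square_integrable_zero)
  qed
  ultimately have "S = UNIV" by (rule complex_subspace_dense)
  then show ?thesis by (auto simp: S_def Q_def)
qed

end

section \<open>The closure of the range in the strong operator topology\<close>

lemma strong_operator_limit_in_closure:
  fixes T :: "'i \<Rightarrow> 'a::real_normed_vector \<Rightarrow>\<^sub>L 'b::real_normed_vector" and P :: "'a \<Rightarrow>\<^sub>L 'b"
  assumes F: "F \<noteq> bot" and lim: "\<And>x. ((\<lambda>i. T i x) \<longlongrightarrow> P x) F" and R: "\<And>i. T i \<in> R"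
  shows "P \<in> strong_operator_topology closure_of R"
  unfolding in_closure_of strong_operator_topology_topspace
proof (intro conjI allI impI UNIV_I)
  \<comment> \<open>The strong operator topology is the pullback of the product topology on
    functions, in which convergence is pointwise. Hence a limit along any proper filter suffices,
    here the product filter at infinity.\<close>
  fix V assume V: "P \<in> V \<and> openin strong_operator_topology V"
  then obtain W where W: "open W" "V = blinfun_apply -` W"
    unfolding strong_operator_topology_def openin_pullback_topology by auto
  have "limitin (product_topology (\<lambda>_. euclidean) UNIV) (\<lambda>i. blinfun_apply (T i)) (blinfun_apply P) F"
    unfolding limitin_componentwise using lim by simp
  then have "((\<lambda>i. blinfun_apply (T i)) \<longlongrightarrow> blinfun_apply P) F"
    by (simp add: euclidean_product_topology)
  then have "\<forall>\<^sub>F i in F. blinfun_apply (T i) \<in> W"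
    using W V by (intro topological_tendstoD) auto
  then obtain i where "blinfun_apply (T i) \<in> W"
    using F eventually_happens' by blast
  then show "\<exists>y. y \<in> R \<and> y \<in> V" using R W by auto
qed

theorem theorem4p2:
  fixes f :: "'n::finite \<Rightarrow> real \<Rightarrow> real"
  assumes "admissible_tuple f"
  shows "subtopology strong_operator_topology projections closure_of range (theta f) =
    range (theta f) \<union>
    {projection_onto (L2_on (deriv_vimage \<psi> {..<0})) | \<psi>. \<psi> \<in> span_funs f - {\<lambda>x. 0}}"
proof -
  define Q where "Q = (\<lambda>c. projection_onto (L2_on (deriv_vimage (lin_comb f c) {..<0})))"
  note proj = theta_in_projections[OF assms] negative_slope_projection(1)[OF assms]
  have rhs: "{projection_onto (L2_on (deriv_vimage \<psi> {..<0})) | \<psi>. \<psi> \<in> span_funs f - {\<lambda>x. 0}} = Q ` (- {0})"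
  proof -
    have "lin_comb f 0 = (\<lambda>x. 0)" by (simp add: lin_comb_def)
    then have "span_funs f - {\<lambda>x. 0} = lin_comb f ` (- {0})"
      using lin_comb_in_span[OF assms] by (auto simp: span_funs_def)
    then show ?thesis by (auto simp: Q_def)
  qed
  have closure: "subtopology strong_operator_topology projections closure_of range (theta f)
      = projections \<inter> (strong_operator_topology closure_of range (theta f))"
    using proj(1) by (subst closure_of_subtopology) (auto simp: Int_absorb1 image_subset_iff)
  have lim: "((\<lambda>x. theta f (fst x *\<^sub>R snd x) g) \<longlongrightarrow> Q c g) (at_top \<times>\<^sub>F nhds c)" if "c \<noteq> 0" for c g
    unfolding Q_def by (rule theta_at_infinity[OF assms that])
  show ?thesis
    unfolding closure rhs
  proof (intro equalityI subsetI)
    fix P assume "P \<in> range (theta f) \<union> Q ` (- {0})"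
    then consider "P \<in> range (theta f)" | c where "c \<noteq> 0" "P = Q c" by auto
    then show "P \<in> projections \<inter> (strong_operator_topology closure_of range (theta f))"
    proof cases
      case 1
      then show ?thesis
        using proj(1) closure_of_subset[of "range (theta f)" strong_operator_topology]
        by (auto simp: strong_operator_topology_topspace)
    next
      case 2
      have "P \<in> strong_operator_topology closure_of range (theta f)"
        unfolding 2(2)
        by (rule strong_operator_limit_in_closure[OF _ lim[OF 2(1)]]) (auto simp: prod_filter_eq_bot)
      then show ?thesis using proj(2) by (simp add: 2(2) Q_def)
    qed
  next
    fix P assume "P \<in> projections \<inter> (strong_operator_topology closure_of range (theta f))"
    then have P: "P \<in> strong_operator_topology closure_of range (theta f)" by simp
    show "P \<in> range (theta f) \<union> Q ` (- {0})"
    proof (rule ccontr)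
      assume nP: "P \<notin> range (theta f) \<union> Q ` (- {0})"
      text \<open>The data \<open>(N, T, g, e)\<close> describe a neighbourhood of a point at infinity whose image under
        \<^term>\<open>theta f\<close> misses a strong neighbourhood of \<^term>\<open>P\<close>.\<close>
      have "\<exists>N T g e. open N \<and> c \<in> N \<and> 0 < e \<and> (\<forall>t>T. \<forall>d\<in>N. e \<le> dist (theta f (t *\<^sub>R d) g) (P g))"
        if "c \<in> sphere 0 1" for c
      proof -
        have "c \<noteq> 0" using that by auto
        then have "Q c \<noteq> P" using nP by auto
        then obtain g where g: "Q c g \<noteq> P g" using blinfun_eqI by metis
        define e where "e = dist (Q c g) (P g) / 2"
        have e: "0 < e" using g by (simp add: e_def)
        have "\<forall>\<^sub>F x in at_top \<times>\<^sub>F nhds c. dist (theta f (fst x *\<^sub>R snd x) g) (Q c g) < e"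
          using lim[OF \<open>c \<noteq> 0\<close>, of g] e by (rule tendstoD)
        then obtain A B where A: "eventually A at_top" and B: "eventually B (nhds c)"
          and AB: "\<And>t d. A t \<Longrightarrow> B d \<Longrightarrow> dist (theta f (t *\<^sub>R d) g) (Q c g) < e"
          unfolding eventually_prod_filter by auto
        obtain T where T: "\<And>t. t > T \<Longrightarrow> A t" using A unfolding eventually_at_top_dense by auto
        obtain N where N: "open N" "c \<in> N" "\<And>d. d \<in> N \<Longrightarrow> B d" using B unfolding eventually_nhds by auto
        have "e \<le> dist (theta f (t *\<^sub>R d) g) (P g)" if "t > T" "d \<in> N" for t d
          using AB[OF T[OF that(1)] N(3)[OF that(2)]] dist_triangle3[of "Q c g" "P g" "theta f (t *\<^sub>R d) g"]
          by (simp add: e_def field_simps)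
        then show ?thesis using N e by blast
      qed
      then obtain N T g e where sph: "\<And>c. c \<in> sphere 0 1 \<Longrightarrow> open (N c)" "\<And>c. c \<in> sphere 0 1 \<Longrightarrow> c \<in> N c"
        "\<And>c. c \<in> sphere 0 1 \<Longrightarrow> 0 < e c"
        "\<And>c t d. c \<in> sphere 0 1 \<Longrightarrow> t > T c \<Longrightarrow> d \<in> N c \<Longrightarrow> (e c :: real) \<le> dist (theta f (t *\<^sub>R d) (g c)) (P (g c))"
        by metis
      \<comment> \<open>Compactness of the unit sphere reduces the neighbourhoods of the points at
        infinity to finitely many.\<close>
      obtain I where I: "I \<subseteq> sphere 0 1" "finite I" "sphere 0 1 \<subseteq> (\<Union>c\<in>I. N c)"
        using compactE_image[OF compact_sphere, of "sphere 0 1" N 0 1] sph(1,2) by blast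
      \<comment> \<open>A common radius: beyond \<open>M\<close>, every one of the finitely many
        estimates at infinity is in force, and what remains is a compact ball.\<close>
      obtain M where M: "\<And>c. c \<in> I \<Longrightarrow> T c < M" "0 < M"
      proof
        show "T c < (\<Sum>c\<in>I. \<bar>T c\<bar>) + 1" if "c \<in> I" for c
          using member_le_sum[OF that, of "\<lambda>c. \<bar>T c\<bar>"] I(2) by (simp add: abs_le_iff)
        show "0 < (\<Sum>c\<in>I. \<bar>T c\<bar>) + 1" by (simp add: add_nonneg_pos sum_nonneg)
      qed
      \<comment> \<open>The counterpart for finite points: \<open>theta f c\<close> differs from
        \<open>P\<close> on some vector, and strong continuity keeps the distance bounded below near
        \<open>c\<close>.\<close>
      have "\<exists>N g e. open N \<and> c \<in> N \<and> 0 < e \<and> (\<forall>d\<in>N. e \<le> dist (theta f d g) (P g))" for c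
      proof -
        have "theta f c \<noteq> P" using nP by auto
        then obtain g where g: "theta f c g \<noteq> P g" using blinfun_eqI by metis
        define e where "e = dist (theta f c g) (P g) / 2"
        have e: "0 < e" using g by (simp add: e_def)
        have "((\<lambda>c. theta f c g) \<longlongrightarrow> theta f c g) (nhds c)"
          using theta_continuous[OF assms, of c g] by (simp add: continuous_at tendsto_nhds_iff)
        then have "\<forall>\<^sub>F d in nhds c. dist (theta f d g) (theta f c g) < e"
          using e by (rule tendstoD)
        then obtain N where N: "open N" "c \<in> N" "\<And>d. d \<in> N \<Longrightarrow> dist (theta f d g) (theta f c g) < e"
          unfolding eventually_nhds by auto
        have "e \<le> dist (theta f d g) (P g)" if "d \<in> N" for d
          using N(3)[OF that] dist_triangle3[of "theta f c g" "P g" "theta f d g"]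
          by (simp add: e_def field_simps)
        then show ?thesis using N e by blast
      qed
      then obtain N' g' e' where fin: "\<And>c. open (N' c)" "\<And>c. c \<in> N' c" "\<And>c. 0 < e' c"
        "\<And>c d. d \<in> N' c \<Longrightarrow> (e' c :: real) \<le> dist (theta f d (g' c)) (P (g' c))"
        by metis
      have "cball 0 M \<subseteq> (\<Union>c\<in>cball 0 M. N' c)" using fin(2) by blast
      then obtain I' where I': "finite I'" "cball 0 M \<subseteq> (\<Union>c\<in>I'. N' c)"
        by (rule compactE_image[OF compact_cball fin(1)]) (rule that)
      \<comment> \<open>Finitely many test vectors give a strong neighbourhood of \<open>P\<close>.
        Every \<open>c\<close> violates one of its conditions: a condition from \<open>I\<close> if
        \<open>norm c > M\<close>, after normalising \<open>c\<close> to the sphere, and one from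
        \<open>I'\<close> otherwise.\<close>
      let ?V = "{R. \<forall>c\<in>I. blinfun_apply R (g c) \<in> ball (P (g c)) (e c)}"
      let ?V' = "{R. \<forall>c\<in>I'. blinfun_apply R (g' c) \<in> ball (P (g' c)) (e' c)}"
      define V where "V = ?V \<inter> ?V'"
      have "openin strong_operator_topology V" unfolding V_def
        using I(2) I'(1) by (intro openin_Int strong_operator_topology_basis) auto
      moreover have "P \<in> V" unfolding V_def using sph(3) I(1) fin(3) by auto
      ultimately obtain c where "theta f c \<in> V"
        using P unfolding in_closure_of by blast
      then have c: "theta f c \<in> ?V \<inter> ?V'" unfolding V_def .
      show False
      proof (cases "norm c \<le> M")
        case True
        then obtain d where "d \<in> I'" "c \<in> N' d" using I'(2) by auto
        then show False using fin(4)[of c d] c by (auto simp: dist_commute)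
      next
        case False
        then have pos: "0 < norm c" using M(2) by linarith
        then have "inverse (norm c) *\<^sub>R c \<in> sphere 0 1" by simp
        with I(3) have "inverse (norm c) *\<^sub>R c \<in> (\<Union>c\<in>I. N c)" by (rule subsetD)
        then obtain d where d: "d \<in> I" "inverse (norm c) *\<^sub>R c \<in> N d" by (rule UN_E)
        have "e d \<le> dist (theta f (norm c *\<^sub>R (inverse (norm c) *\<^sub>R c)) (g d)) (P (g d))"
          by (rule sph(4)[OF subsetD[OF I(1) d(1)] _ d(2)]) (use M(1)[OF d(1)] False in simp)
        then show False using c d(1) pos by (auto simp: dist_commute)
      qed
    qed
  qed
qed

end
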